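(* Let $(F,\Phi)$ be a quasi-bimonad over a 0-cell $\mathcal A$ of a 2-category $\mathcal K$ and $B:\mathcal A\to\mathcal A$ a left $F$-comodule monad with coaction $\lambda:B\to FB$ and $\psi_{B,F}=(\mu\times B)\circ(F\times\tau_{B,F})\circ(\lambda\times F)$. Let $\mathcal C={}_{\tau_B(\mathcal A,F,\Phi)}\mathcal T$ and, for $X\in\mathcal C$ with action $\nu_X:FX\to X$, put $\psi_{B,X}=(\nu_X\times B)\circ(F\times\tau_{B,X})\circ(\lambda\times X)$. Let $\Phi_\lambda:\mathrm{Id}_{\mathcal A}\to FFB$ be a given 2-cell. The following are equivalent: 1. The 2-cells $$\bar\rho_{X,Y}=(\nu_X\times\nu_Y\times B)\circ(F\times\tau_{F,X}\times\tau_{B,Y})\circ(F\times F\times\tau_{B,X}\times Y)\circ(\Phi_\lambda\times X\times Y):XY\to XYB,$$ $X,Y\in\mathcal C$, satisfy conditions (i)–(v) of the context (i.e. they form an invertible normalized 2-cocycle in $\mathrm{EM}^M(\mathcal K)$). 2. $(B,F,\psi_{B,F},\Delta_M,\varepsilon_M,\eta_F,\beta)$ is a Hausser–Nill datum, where $\Delta_M=(\mu\times\mu\times B)\circ(F\times\tau_{F,F}\times F\times B)\circ(F\times F\times\Delta\times B)\circ(F\times F\times\tau_{B,F})\circ(\Phi_\lambda\times F)$, $\varepsilon_M=\eta_B\circ\varepsilon_F$, $\beta=\mu_{FFF}\circ(F\times F\times F\times\Phi^{-1})$, and the Hausser–Nill 2-cocycle $\Phi_\lambda$ is invertible in the convolution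 algebra $\mathcal K(\mathcal A)(\mathrm{Id}_{\mathcal A},FFB)$.
   Context: Conventions: 1-cells are composed by juxtaposition, $\times$ is horizontal and $\circ$ (or juxtaposition) vertical composition of 2-cells; a 1-cell in a formula stands for its identity 2-cell; $F^n=F\cdots F$. Distributive laws: for $F$ with 2-cells $\mu,\eta,\Delta,\varepsilon$, $\tau:FF\to FF$ is left monadic if $\tau(\mu\times F)=(F\times\mu)(\tau\times F)(F\times\tau)$, $\tau(\eta\times F)=F\times\eta$; right monadic if $\tau(F\times\mu)=(\mu\times F)(F\times\tau)(\tau\times F)$, $\tau(F\times\eta)=\eta\times F$; left comonadic if $(\Delta\times F)\tau=(F\times\tau)(\tau\times F)(F\times\Delta)$, $(\varepsilon\times F)\tau=F\times\varepsilon$; right comonadic if $(F\times\Delta)\tau=(\tau\times F)(F\times\tau)(\Delta\times F)$, $(F\times\varepsilon)\tau=\varepsilon\times F$. A quasi-bimonad is $(\mathcal A,F,\mu,\eta,\Delta,\varepsilon,\tau=\tau_{F,F},\Phi)$ where $(F,\mu,\eta)$ is a monad, $\tau$ is left and right monadic and left and right comonadic, $(\varepsilon\times F)\Delta=F=(F\times\varepsilon)\Delta$, $\Delta\mu=(\mu\times\mu)(F\times\tau\times F)(\Delta\times\Delta)$, $\Delta\eta=\eta\times\eta$, $\varepsilon\mu=\varepsilon\times\varepsilon$, $\varepsilon\eta=\mathrm{Id}$. With $\mu_{FFF}=(\mu\times\mu\times\mu)(F\times\tau\times\tau\times F)(F^2\times\tau\times F^2)$, $\Phi:\mathrm{Id}_{\mathcal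 A}\to FFF$ is invertible (inverse $\Phi^{-1}$) for $\Psi*\Psi'=\mu_{FFF}(\Psi\times\Psi')$ with unit $\eta\times\eta\times\eta$, $(F\times\varepsilon\times F)\Phi=\eta\times\eta$, $(\mu\times\mu\times F)(F\times\tau\times F^2)(F^2\times\Delta\times\mu)(F^2\times\tau\times F)(\Phi\times\Delta)=\mu_{FFF}((F\times\Delta)\Delta\times\Phi)$, and $$(F\times\mu\times\mu\times F)(F^2\times\tau\times F^2)(F\times\mu\times\mu\times F\times\tau)(F^2\times\tau\times F\times\tau\times F)(F^3\times\Delta\times\mu\times F^2)(F^3\times\tau\times F^3)(F\times\Phi\times F^4)(\mu\times F^4)(F\times\tau\times F^3)(F^2\times\tau\times F^2)(\Phi\times\Phi)$$ $$=(\mu\times\mu\times\mu\times\mu)(F\times\tau\times F^2\times\tau\times F)(F^2\times\Delta\times\Delta\times F^2)(F^2\times\tau\times F^2)(\Phi\times\Phi).$$ It is moreover a 0-cell of $\mathrm{QB}(\mathcal K)$: $\Phi\times F=(F^2\times\tau)(F\times\tau\times F)(\tau\times F^2)(F\times\Phi)$. ${}_{(\mathcal A,F,\Phi)}\mathcal T$ (left Tambara modules): $(X,\tau_{F,X}:FX\to XF,\nu_X)$, $X:\mathcal A\to\mathcal A$, with $(X,\nu_X)$ a left $F$-module and $\tau_{F,X}(\mu\times X)=(X\times\mu)(\tau_{F,X}\times F)(F\times\tau_{F,X})$, $\tau_{F,X}(\eta\times X)=X\times\eta$, $(X\times\Delta)\tau_{F,X}=(\tau_{F,X}\times F)(F\times\tau_{F,X})(\Delta\times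 X)$, $(X\times\varepsilon)\tau_{F,X}=\varepsilon\times X$, $X\times\Phi=(\tau_{F,X}\times F^2)(F\times\tau_{F,X}\times F)(F^2\times\tau_{F,X})(\Phi\times X)$, $(X\times\tau)(\tau_{F,X}\times F)(F\times\tau_{F,X})=(\tau_{F,X}\times F)(F\times\tau_{F,X})(\tau\times X)$, $\tau_{F,X}(F\times\nu_X)=(\nu_X\times F)(F\times\tau_{F,X})(\tau\times X)$. $\mathcal T(\mathcal A,B)$: pairs $(X,\psi:BX\to XB)$ with $\psi(\mu_B\times X)=(X\times\mu_B)(\psi\times B)(B\times\psi)$, $\psi(\eta_B\times X)=X\times\eta_B$. Left $F$-comodule monad: $\lambda=\psi_{B,F}(B\times\eta)$ satisfies $(F\times\mu_B)(\psi_{B,F}\times B)(B\times\lambda)=\lambda\mu_B$ and $\lambda\eta_B=\eta\times\eta_B$. The category ${}_{\tau_B(\mathcal A,F,\Phi)}\mathcal T$: objects $(X,\tau_{B,X},\tau_{F,X})$ (with $\nu_X$), where $(X,\tau_{F,X},\nu_X)\in{}_{(\mathcal A,F,\Phi)}\mathcal T$, $(X,\tau_{B,X})\in\mathcal T(\mathcal A,B)$, $\tau_{B,X}(B\times\nu_X)=(\nu_X\times B)(F\times\tau_{B,X})(\tau_{B,F}\times X)$, $(X\times\lambda)\tau_{B,X}=(\tau_{F,X}\times B)(F\times\tau_{B,X})(\lambda\times X)$, $(X\times\tau_{B,F})(\tau_{B,X}\times F)(B\times\tau_{F,X})=(\tau_{F,X}\times B)(F\times\tau_{B,X})(\tau_{B,F}\times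 X)$; these are assumed to include the case $X=F$ (with $\tau_{F,F}=\tau$, $\nu_F=\mu$ and the given $\tau_{B,F}$). Also $\Phi\times B=(F^2\times\tau_{B,F})(F\times\tau_{B,F}\times F)(\tau_{B,F}\times F^2)(B\times\Phi)$. Morphisms are left $F$-linear 2-cells $\zeta$ with $(\zeta\times B)\tau_{B,X}=\tau_{B,Y}(B\times\zeta)$, $(\zeta\times F)\tau_{F,X}=\tau_{F,Y}(F\times\zeta)$. It is monoidal: $XY$ has $\tau_{-,XY}=(X\times\tau_{-,Y})(\tau_{-,X}\times Y)$, action $(\nu_X\times\nu_Y)(F\times\tau_{F,X}\times Y)(\Delta\times XY)$, identity unit constraints, and associativity $\alpha_{X,Y,Z}=(\nu_X\times\nu_Y\times\nu_Z)(F\times\tau_{F,X}\times\tau_{F,Y}\times Z)(F^2\times\tau_{F,X}\times YZ)(\Phi\times XYZ)$. The convolution algebra $\mathcal K(\mathcal A)(\mathrm{Id}_{\mathcal A},FFB)$ has product $f*g=\mu_{FFB}(f\times g)$, $\mu_{FFB}=(\mu\times\mu\times\mu_B)(F\times\tau\times\tau_{B,F}\times B)(F^2\times\tau_{B,F}\times F\times B)$, unit $\eta\times\eta\times\eta_B$. Conditions on $\bar\rho$, with $\psi_{B,XY}=(X\times\psi_{B,Y})(\psi_{B,X}\times Y)$: (i) $(\zeta\times\xi\times B)\bar\rho_{X,Y}=\bar\rho_{X',Y'}(\zeta\times\xi)$ for morphisms $\zeta,\xi$ of $\mathcal C$; (ii) there is $\bar\rho^{-1}_{X,Y}:XY\to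 XYB$ with $(XY\times\mu_B)(\bar\rho^{-1}_{X,Y}\times B)\bar\rho_{X,Y}=XY\times\eta_B=(XY\times\mu_B)(\bar\rho_{X,Y}\times B)\bar\rho^{-1}_{X,Y}$; (iii) $(XY\times\mu_B)(\bar\rho_{X,Y}\times B)\psi_{B,XY}=(XY\times\mu_B)(\psi_{B,XY}\times B)(B\times\bar\rho_{X,Y})$; (iv) $(XYZ\times\mu_B)(X\times\bar\rho_{Y,Z}\times B)\bar\rho_{X,YZ}\,\alpha=(XYZ\times\mu_B)(XY\times\psi_{B,Z}\times B)(\bar\rho_{X,Y}\times Z\times B)\bar\rho_{XY,Z}$; (v) $\bar\rho_{X,\mathrm{Id}}=X\times\eta_B=\bar\rho_{\mathrm{Id},X}$. These are the conditions under which $(X,M)\mapsto XM$ is an action of $\mathcal C$ on the category of left $B$-modules with associativity $(XY)M\to X(YM)$ given by $(XY\times\nu_M)(\bar\rho_{X,Y}\times M)$. Hausser–Nill datum $(B,F,\psi,\Delta_M,\varepsilon_M,\eta_F,\beta)$: $B$ a monad and $F$ a 1-cell on $\mathcal A$, $\psi:BF\to FB$, $\Delta_M:F\to FFB$, $\varepsilon_M:F\to B$, $\eta_F:\mathrm{Id}\to F$, and $\beta:FFF\to FFF$ a 3-cocycle on $FFF$ in $\mathcal K$ (a 3-cocycle is a natural operator $\rho_{X,Y,Z}:XYZ\to XYZ$ with $(X\times\rho_{Y,Z,W})\rho_{X,YZ,W}(\rho_{X,Y,Z}\times W)=\rho_{X,Y,ZW}\rho_{XY,Z,W}$); putting $\lambda=\psi(B\times\eta_F)$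 and $\Phi_\lambda=\Delta_M\eta_F$ (called the Hausser–Nill 2-cocycle), the following hold: $(F\times\mu_B)(\psi\times B)(B\times\lambda)=\lambda\mu_B$; $\lambda\eta_B=\eta_F\times\eta_B$; $(F^2\times\mu_B)(\Delta_M\times B)\lambda=(F^2\times\mu_B)(F\times\psi\times B)(\psi\times F\times B)(B\times\Phi_\lambda)$; $\mu_B(\varepsilon_M\times B)\lambda=\mu_B(B\times\varepsilon_M\eta_F)$; $(\beta\times\mu_B)(F^2\times\psi\times B)(\Delta_M\times F\times B)\Phi_\lambda=(F^3\times\mu_B)(F\times\Delta_M\times B)\Phi_\lambda$; $(F\times\mu_B)(\psi\times B)(\varepsilon_M\times F\times B)\Phi_\lambda=\eta_F\times\eta_B=(F\times\mu_B)(F\times\varepsilon_M\times B)\Phi_\lambda$.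
   Formalization: Added: λ is counital; C keeps only objects X across which Φ_λ moves along τ_{F,X}, τ_{B,X}, with F among them. In (iii) the source ψ_{B,XY} is that of the tensor object XY, the target the composite. "3-cocycle" means natural over right Tambara modules. *)

theory Defs
  imports Main
begin

section \<open>Strict 2-categories\<close>

text \<open>Composition is written in the order of juxtaposition of functors: \<open>X \<cdot> Y\<close> is defined when
  \<open>src X = trg Y\<close>. The operations are total functions, constrained only on composable cells.\<close>

record ('o, 'm, 'c) two_cat =
  Cells0 :: "'o set"
  Cells1 :: "'m set"
  Cells2 :: "'c set"
  src :: "'m \<Rightarrow> 'o"
  trg :: "'m \<Rightarrow> 'o"
  dom2 :: "'c \<Rightarrow> 'm"
  cod2 :: "'c \<Rightarrow> 'm"
  Id1 :: "'o \<Rightarrow> 'm"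
  comp1 :: "'m \<Rightarrow> 'm \<Rightarrow> 'm" (infixr "\<cdot>\<index>" 75)
  id2 :: "'m \<Rightarrow> 'c" ("\<iota>\<index> _" [1000] 1000)
  hcomp :: "'c \<Rightarrow> 'c \<Rightarrow> 'c" (infixr "\<star>\<index>" 70)
  vcomp :: "'c \<Rightarrow> 'c \<Rightarrow> 'c" (infixr "\<bullet>\<index>" 60)

definition hom2 :: "('o, 'm, 'c) two_cat \<Rightarrow> 'm \<Rightarrow> 'm \<Rightarrow> 'c set" where
  "hom2 K X Y = {f \<in> Cells2 K. dom2 K f = X \<and> cod2 K f = Y}"

definition endo :: "('o, 'm, 'c) two_cat \<Rightarrow> 'o \<Rightarrow> 'm set" where
  "endo K a = {X \<in> Cells1 K. src K X = a \<and> trg K X = a}"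

locale two_category =
  fixes K :: "('o, 'm, 'c) two_cat" (structure)
  assumes src_trg: "X \<in> Cells1 K \<Longrightarrow> src K X \<in> Cells0 K \<and> trg K X \<in> Cells0 K"
    and Id1_cell: "a \<in> Cells0 K \<Longrightarrow> Id1 K a \<in> endo K a"
    and comp1_cell: "\<lbrakk>X \<in> Cells1 K; Y \<in> Cells1 K; src K X = trg K Y\<rbrakk>
      \<Longrightarrow> X \<cdot> Y \<in> Cells1 K \<and> src K (X \<cdot> Y) = src K Y \<and> trg K (X \<cdot> Y) = trg K X"
    and comp1_assoc: "\<lbrakk>X \<in> Cells1 K; Y \<in> Cells1 K; Z \<in> Cells1 K; src K X = trg K Y; src K Y = trg K Z\<rbrakk>
      \<Longrightarrow> (X \<cdot> Y) \<cdot> Z = X \<cdot> (Y \<cdot> Z)"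
    and comp1_Id: "X \<in> Cells1 K \<Longrightarrow> Id1 K (trg K X) \<cdot> X = X \<and> X \<cdot> Id1 K (src K X) = X"
    and dom_cod: "f \<in> Cells2 K \<Longrightarrow> dom2 K f \<in> Cells1 K \<and> cod2 K f \<in> Cells1 K \<and>
      src K (dom2 K f) = src K (cod2 K f) \<and> trg K (dom2 K f) = trg K (cod2 K f)"
    and id2_cell: "X \<in> Cells1 K \<Longrightarrow> \<iota> X \<in> hom2 K X X"
    and vcomp_cell: "\<lbrakk>f \<in> hom2 K X Y; g \<in> hom2 K Y Z\<rbrakk> \<Longrightarrow> g \<bullet> f \<in> hom2 K X Z"
    and vcomp_assoc: "\<lbrakk>f \<in> hom2 K X Y; g \<in> hom2 K Y Z; h \<in> hom2 K Z W\<rbrakk>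
      \<Longrightarrow> (h \<bullet> g) \<bullet> f = h \<bullet> (g \<bullet> f)"
    and vcomp_id: "f \<in> hom2 K X Y \<Longrightarrow> \<iota> Y \<bullet> f = f \<and> f \<bullet> \<iota> X = f"
    and hcomp_cell: "\<lbrakk>f \<in> hom2 K X X'; g \<in> hom2 K Y Y'; src K X = trg K Y\<rbrakk>
      \<Longrightarrow> f \<star> g \<in> hom2 K (X \<cdot> Y) (X' \<cdot> Y')"
    and hcomp_assoc: "\<lbrakk>f \<in> hom2 K X X'; g \<in> hom2 K Y Y'; h \<in> hom2 K Z Z'; src K X = trg K Y; src K Y = trg K Z\<rbrakk>
      \<Longrightarrow> (f \<star> g) \<star> h = f \<star> (g \<star> h)"
    and hcomp_Id: "f \<in> hom2 K X Y
      \<Longrightarrow> \<iota> (Id1 K (trg K X)) \<star> f = f \<and> f \<star> \<iota> (Id1 K (src K X)) = f"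
    and hcomp_id2: "\<lbrakk>X \<in> Cells1 K; Y \<in> Cells1 K; src K X = trg K Y\<rbrakk> \<Longrightarrow> \<iota> X \<star> \<iota> Y = \<iota> (X \<cdot> Y)"
    and interchange: "\<lbrakk>f \<in> hom2 K X X'; f' \<in> hom2 K X' X''; g \<in> hom2 K Y Y'; g' \<in> hom2 K Y' Y'';
      src K X = trg K Y\<rbrakk> \<Longrightarrow> (f' \<bullet> f) \<star> (g' \<bullet> g) = (f' \<star> g') \<bullet> (f \<star> g)"


context
  fixes K :: "('o, 'm, 'c) two_cat" (structure)
begin

section \<open>Monads, modules and distributive laws\<close>

definition monad :: "'o \<Rightarrow> 'm \<Rightarrow> 'c \<Rightarrow> 'c \<Rightarrow> bool" where
  "monad \<A> T m e \<longleftrightarrow> T \<in> endo K \<A> \<and> m \<in> hom2 K (T \<cdot> T) T \<and> e \<in> hom2 K (Id1 K \<A>) T \<and>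
     m \<bullet> (m \<star> \<iota> T) = m \<bullet> (\<iota> T \<star> m) \<and> m \<bullet> (e \<star> \<iota> T) = \<iota> T \<and> m \<bullet> (\<iota> T \<star> e) = \<iota> T"

definition left_module :: "'o \<Rightarrow> 'm \<Rightarrow> 'c \<Rightarrow> 'c \<Rightarrow> 'm \<Rightarrow> 'c \<Rightarrow> bool" where
  "left_module \<A> T m e X \<nu> \<longleftrightarrow> X \<in> endo K \<A> \<and> \<nu> \<in> hom2 K (T \<cdot> X) X \<and>
     \<nu> \<bullet> (m \<star> \<iota> X) = \<nu> \<bullet> (\<iota> T \<star> \<nu>) \<and> \<nu> \<bullet> (e \<star> \<iota> X) = \<iota> X"

definition right_module :: "'o \<Rightarrow> 'm \<Rightarrow> 'c \<Rightarrow> 'c \<Rightarrow> 'm \<Rightarrow> 'c \<Rightarrow> bool" where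
  "right_module \<A> T m e X \<nu> \<longleftrightarrow> X \<in> endo K \<A> \<and> \<nu> \<in> hom2 K (X \<cdot> T) X \<and>
     \<nu> \<bullet> (\<iota> X \<star> m) = \<nu> \<bullet> (\<nu> \<star> \<iota> T) \<and> \<nu> \<bullet> (\<iota> X \<star> e) = \<iota> X"

definition left_monadic :: "'m \<Rightarrow> 'c \<Rightarrow> 'c \<Rightarrow> 'c \<Rightarrow> bool" where
  "left_monadic F \<mu> \<eta> \<tau> \<longleftrightarrow>
     \<tau> \<bullet> (\<mu> \<star> \<iota> F) = (\<iota> F \<star> \<mu>) \<bullet> (\<tau> \<star> \<iota> F) \<bullet> (\<iota> F \<star> \<tau>) \<and> \<tau> \<bullet> (\<eta> \<star> \<iota> F) = \<iota> F \<star> \<eta>"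

definition right_monadic :: "'m \<Rightarrow> 'c \<Rightarrow> 'c \<Rightarrow> 'c \<Rightarrow> bool" where
  "right_monadic F \<mu> \<eta> \<tau> \<longleftrightarrow>
     \<tau> \<bullet> (\<iota> F \<star> \<mu>) = (\<mu> \<star> \<iota> F) \<bullet> (\<iota> F \<star> \<tau>) \<bullet> (\<tau> \<star> \<iota> F) \<and> \<tau> \<bullet> (\<iota> F \<star> \<eta>) = \<eta> \<star> \<iota> F"

definition left_comonadic :: "'m \<Rightarrow> 'c \<Rightarrow> 'c \<Rightarrow> 'c \<Rightarrow> bool" where
  "left_comonadic F \<Delta> \<epsilon> \<tau> \<longleftrightarrow>
     (\<Delta> \<star> \<iota> F) \<bullet> \<tau> = (\<iota> F \<star> \<tau>) \<bullet> (\<tau> \<star> \<iota> F) \<bullet> (\<iota> F \<star> \<Delta>) \<and> (\<epsilon> \<star> \<iota> F) \<bullet> \<tau> = \<iota> F \<star> \<epsilon>"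

definition right_comonadic :: "'m \<Rightarrow> 'c \<Rightarrow> 'c \<Rightarrow> 'c \<Rightarrow> bool" where
  "right_comonadic F \<Delta> \<epsilon> \<tau> \<longleftrightarrow>
     (\<iota> F \<star> \<Delta>) \<bullet> \<tau> = (\<tau> \<star> \<iota> F) \<bullet> (\<iota> F \<star> \<tau>) \<bullet> (\<Delta> \<star> \<iota> F) \<and> (\<iota> F \<star> \<epsilon>) \<bullet> \<tau> = \<epsilon> \<star> \<iota> F"

section \<open>Quasi-bimonads\<close>

definition mu_FFF :: "'m \<Rightarrow> 'c \<Rightarrow> 'c \<Rightarrow> 'c" where
  "mu_FFF F \<mu> \<tau> =
     (\<mu> \<star> \<mu> \<star> \<mu>) \<bullet> (\<iota> F \<star> \<tau> \<star> \<tau> \<star> \<iota> F) \<bullet> (\<iota> (F \<cdot> F) \<star> \<tau> \<star> \<iota> (F \<cdot> F))"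

definition Phi_invertible :: "'o \<Rightarrow> 'm \<Rightarrow> 'c \<Rightarrow> 'c \<Rightarrow> 'c \<Rightarrow> 'c \<Rightarrow> 'c \<Rightarrow> bool" where
  "Phi_invertible \<A> F \<mu> \<eta> \<tau> \<Phi> \<Phi>i \<longleftrightarrow>
     \<Phi> \<in> hom2 K (Id1 K \<A>) (F \<cdot> F \<cdot> F) \<and> \<Phi>i \<in> hom2 K (Id1 K \<A>) (F \<cdot> F \<cdot> F) \<and>
     mu_FFF F \<mu> \<tau> \<bullet> (\<Phi> \<star> \<Phi>i) = \<eta> \<star> \<eta> \<star> \<eta> \<and> mu_FFF F \<mu> \<tau> \<bullet> (\<Phi>i \<star> \<Phi>) = \<eta> \<star> \<eta> \<star> \<eta>"

definition quasi_coassociative :: "'m \<Rightarrow> 'c \<Rightarrow> 'c \<Rightarrow> 'c \<Rightarrow> 'c \<Rightarrow> bool" where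
  "quasi_coassociative F \<mu> \<Delta> \<tau> \<Phi> \<longleftrightarrow>
     (\<mu> \<star> \<mu> \<star> \<iota> F) \<bullet> (\<iota> F \<star> \<tau> \<star> \<iota> (F \<cdot> F)) \<bullet> (\<iota> (F \<cdot> F) \<star> \<Delta> \<star> \<mu>)
       \<bullet> (\<iota> (F \<cdot> F) \<star> \<tau> \<star> \<iota> F) \<bullet> (\<Phi> \<star> \<Delta>)
     = mu_FFF F \<mu> \<tau> \<bullet> (((\<iota> F \<star> \<Delta>) \<bullet> \<Delta>) \<star> \<Phi>)"

definition Phi_cocycle :: "'m \<Rightarrow> 'c \<Rightarrow> 'c \<Rightarrow> 'c \<Rightarrow> 'c \<Rightarrow> bool" where
  "Phi_cocycle F \<mu> \<Delta> \<tau> \<Phi> \<longleftrightarrow>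
     (\<iota> F \<star> \<mu> \<star> \<mu> \<star> \<iota> F)
       \<bullet> (\<iota> (F \<cdot> F) \<star> \<tau> \<star> \<iota> (F \<cdot> F))
       \<bullet> (\<iota> F \<star> \<mu> \<star> \<mu> \<star> \<iota> F \<star> \<tau>)
       \<bullet> (\<iota> (F \<cdot> F) \<star> \<tau> \<star> \<iota> F \<star> \<tau> \<star> \<iota> F)
       \<bullet> (\<iota> (F \<cdot> F \<cdot> F) \<star> \<Delta> \<star> \<mu> \<star> \<iota> (F \<cdot> F))
       \<bullet> (\<iota> (F \<cdot> F \<cdot> F) \<star> \<tau> \<star> \<iota> (F \<cdot> F \<cdot> F))
       \<bullet> (\<iota> F \<star> \<Phi> \<star> \<iota> (F \<cdot> F \<cdot> F \<cdot> F))
       \<bullet> (\<mu> \<star> \<iota> (F \<cdot> F \<cdot> F \<cdot> F))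
       \<bullet> (\<iota> F \<star> \<tau> \<star> \<iota> (F \<cdot> F \<cdot> F))
       \<bullet> (\<iota> (F \<cdot> F) \<star> \<tau> \<star> \<iota> (F \<cdot> F))
       \<bullet> (\<Phi> \<star> \<Phi>)
     = (\<mu> \<star> \<mu> \<star> \<mu> \<star> \<mu>)
       \<bullet> (\<iota> F \<star> \<tau> \<star> \<iota> (F \<cdot> F) \<star> \<tau> \<star> \<iota> F)
       \<bullet> (\<iota> (F \<cdot> F) \<star> \<Delta> \<star> \<Delta> \<star> \<iota> (F \<cdot> F))
       \<bullet> (\<iota> (F \<cdot> F) \<star> \<tau> \<star> \<iota> (F \<cdot> F))
       \<bullet> (\<Phi> \<star> \<Phi>)"

text \<open>\<open>\<Phi>i\<close> is the convolution inverse of \<open>\<Phi>\<close>. The last clause says that \<open>(F, \<Phi>)\<close> is a 0-cell of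
  \<open>QB(K)\<close>. There is no coassociativity axiom for \<open>\<Delta>\<close>.\<close>

definition quasi_bimonad ::
  "'o \<Rightarrow> 'm \<Rightarrow> 'c \<Rightarrow> 'c \<Rightarrow> 'c \<Rightarrow> 'c \<Rightarrow> 'c \<Rightarrow> 'c \<Rightarrow> 'c \<Rightarrow> bool" where
  "quasi_bimonad \<A> F \<mu> \<eta> \<Delta> \<epsilon> \<tau> \<Phi> \<Phi>i \<longleftrightarrow>
     monad \<A> F \<mu> \<eta> \<and>
     \<Delta> \<in> hom2 K F (F \<cdot> F) \<and> \<epsilon> \<in> hom2 K F (Id1 K \<A>) \<and> \<tau> \<in> hom2 K (F \<cdot> F) (F \<cdot> F) \<and>
     left_monadic F \<mu> \<eta> \<tau> \<and> right_monadic F \<mu> \<eta> \<tau> \<and>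
     left_comonadic F \<Delta> \<epsilon> \<tau> \<and> right_comonadic F \<Delta> \<epsilon> \<tau> \<and>
     (\<epsilon> \<star> \<iota> F) \<bullet> \<Delta> = \<iota> F \<and> (\<iota> F \<star> \<epsilon>) \<bullet> \<Delta> = \<iota> F \<and>
     \<Delta> \<bullet> \<mu> = (\<mu> \<star> \<mu>) \<bullet> (\<iota> F \<star> \<tau> \<star> \<iota> F) \<bullet> (\<Delta> \<star> \<Delta>) \<and>
     \<Delta> \<bullet> \<eta> = \<eta> \<star> \<eta> \<and> \<epsilon> \<bullet> \<mu> = \<epsilon> \<star> \<epsilon> \<and> \<epsilon> \<bullet> \<eta> = \<iota> (Id1 K \<A>) \<and>
     Phi_invertible \<A> F \<mu> \<eta> \<tau> \<Phi> \<Phi>i \<and>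
     (\<iota> F \<star> \<epsilon> \<star> \<iota> F) \<bullet> \<Phi> = \<eta> \<star> \<eta> \<and>
     quasi_coassociative F \<mu> \<Delta> \<tau> \<Phi> \<and>
     Phi_cocycle F \<mu> \<Delta> \<tau> \<Phi> \<and>
     \<Phi> \<star> \<iota> F = (\<iota> (F \<cdot> F) \<star> \<tau>) \<bullet> (\<iota> F \<star> \<tau> \<star> \<iota> F) \<bullet> (\<tau> \<star> \<iota> (F \<cdot> F)) \<bullet> (\<iota> F \<star> \<Phi>)"

section \<open>Tambara modules\<close>

definition left_tambara ::
  "'o \<Rightarrow> 'm \<Rightarrow> 'c \<Rightarrow> 'c \<Rightarrow> 'c \<Rightarrow> 'c \<Rightarrow> 'c \<Rightarrow> 'c \<Rightarrow> 'm \<Rightarrow> 'c \<Rightarrow> 'c \<Rightarrow> bool" where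
  "left_tambara \<A> F \<mu> \<eta> \<Delta> \<epsilon> \<tau> \<Phi> X \<tau>X \<nu> \<longleftrightarrow>
     left_module \<A> F \<mu> \<eta> X \<nu> \<and> \<tau>X \<in> hom2 K (F \<cdot> X) (X \<cdot> F) \<and>
     \<tau>X \<bullet> (\<mu> \<star> \<iota> X) = (\<iota> X \<star> \<mu>) \<bullet> (\<tau>X \<star> \<iota> F) \<bullet> (\<iota> F \<star> \<tau>X) \<and>
     \<tau>X \<bullet> (\<eta> \<star> \<iota> X) = \<iota> X \<star> \<eta> \<and>
     (\<iota> X \<star> \<Delta>) \<bullet> \<tau>X = (\<tau>X \<star> \<iota> F) \<bullet> (\<iota> F \<star> \<tau>X) \<bullet> (\<Delta> \<star> \<iota> X) \<and>
     (\<iota> X \<star> \<epsilon>) \<bullet> \<tau>X = \<epsilon> \<star> \<iota> X \<and>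
     \<iota> X \<star> \<Phi> = (\<tau>X \<star> \<iota> (F \<cdot> F)) \<bullet> (\<iota> F \<star> \<tau>X \<star> \<iota> F) \<bullet> (\<iota> (F \<cdot> F) \<star> \<tau>X) \<bullet> (\<Phi> \<star> \<iota> X) \<and>
     (\<iota> X \<star> \<tau>) \<bullet> (\<tau>X \<star> \<iota> F) \<bullet> (\<iota> F \<star> \<tau>X) = (\<tau>X \<star> \<iota> F) \<bullet> (\<iota> F \<star> \<tau>X) \<bullet> (\<tau> \<star> \<iota> X) \<and>
     \<tau>X \<bullet> (\<iota> F \<star> \<nu>) = (\<nu> \<star> \<iota> F) \<bullet> (\<iota> F \<star> \<tau>X) \<bullet> (\<tau> \<star> \<iota> X)"

text \<open>Membership of \<open>(X, \<psi>)\<close> in \<open>T(\<A>, B)\<close>.\<close>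

definition EM_cell :: "'o \<Rightarrow> 'm \<Rightarrow> 'c \<Rightarrow> 'c \<Rightarrow> 'm \<Rightarrow> 'c \<Rightarrow> bool" where
  "EM_cell \<A> B \<mu>B \<eta>B X \<psi> \<longleftrightarrow> X \<in> endo K \<A> \<and> \<psi> \<in> hom2 K (B \<cdot> X) (X \<cdot> B) \<and>
     \<psi> \<bullet> (\<mu>B \<star> \<iota> X) = (\<iota> X \<star> \<mu>B) \<bullet> (\<psi> \<star> \<iota> B) \<bullet> (\<iota> B \<star> \<psi>) \<and>
     \<psi> \<bullet> (\<eta>B \<star> \<iota> X) = \<iota> X \<star> \<eta>B"

end

record ('m, 'c) tambara =
  cell :: 'm
  tauB :: 'c
  tauF :: 'c
  act :: 'c

context
  fixes K :: "('o, 'm, 'c) two_cat" (structure)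
begin

definition tambara_objects ::
  "'o \<Rightarrow> 'm \<Rightarrow> 'c \<Rightarrow> 'c \<Rightarrow> 'c \<Rightarrow> 'c \<Rightarrow> 'c \<Rightarrow> 'c \<Rightarrow> 'm \<Rightarrow> 'c \<Rightarrow> 'c \<Rightarrow> 'c \<Rightarrow> 'c
    \<Rightarrow> ('m, 'c) tambara set" where
  "tambara_objects \<A> F \<mu> \<eta> \<Delta> \<epsilon> \<tau> \<Phi> B \<mu>B \<eta>B coact \<tau>BF = {X.
     left_tambara K \<A> F \<mu> \<eta> \<Delta> \<epsilon> \<tau> \<Phi> (cell X) (tauF X) (act X) \<and>
     EM_cell K \<A> B \<mu>B \<eta>B (cell X) (tauB X) \<and>
     tauB X \<bullet> (\<iota> B \<star> act X) = (act X \<star> \<iota> B) \<bullet> (\<iota> F \<star> tauB X) \<bullet> (\<tau>BF \<star> \<iota> (cell X)) \<and>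
     (\<iota> (cell X) \<star> coact) \<bullet> tauB X = (tauF X \<star> \<iota> B) \<bullet> (\<iota> F \<star> tauB X) \<bullet> (coact \<star> \<iota> (cell X)) \<and>
     (\<iota> (cell X) \<star> \<tau>BF) \<bullet> (tauB X \<star> \<iota> F) \<bullet> (\<iota> B \<star> tauF X)
       = (tauF X \<star> \<iota> B) \<bullet> (\<iota> F \<star> tauB X) \<bullet> (\<tau>BF \<star> \<iota> (cell X))}"

definition tambara_mor :: "'m \<Rightarrow> 'm \<Rightarrow> ('m, 'c) tambara \<Rightarrow> ('m, 'c) tambara \<Rightarrow> 'c set" where
  "tambara_mor F B X Y = {\<zeta> \<in> hom2 K (cell X) (cell Y).
     \<zeta> \<bullet> act X = act Y \<bullet> (\<iota> F \<star> \<zeta>) \<and>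
     (\<zeta> \<star> \<iota> B) \<bullet> tauB X = tauB Y \<bullet> (\<iota> B \<star> \<zeta>) \<and>
     (\<zeta> \<star> \<iota> F) \<bullet> tauF X = tauF Y \<bullet> (\<iota> F \<star> \<zeta>)}"

definition tambara_unit :: "'o \<Rightarrow> 'm \<Rightarrow> 'c \<Rightarrow> 'm \<Rightarrow> ('m, 'c) tambara" where
  "tambara_unit \<A> F \<epsilon> B = \<lparr>cell = Id1 K \<A>, tauB = \<iota> B, tauF = \<iota> F, act = \<epsilon>\<rparr>"

definition tambara_tensor ::
  "'m \<Rightarrow> 'c \<Rightarrow> ('m, 'c) tambara \<Rightarrow> ('m, 'c) tambara \<Rightarrow> ('m, 'c) tambara" where
  "tambara_tensor F \<Delta> X Y = \<lparr>cell = cell X \<cdot> cell Y,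
     tauB = (\<iota> (cell X) \<star> tauB Y) \<bullet> (tauB X \<star> \<iota> (cell Y)),
     tauF = (\<iota> (cell X) \<star> tauF Y) \<bullet> (tauF X \<star> \<iota> (cell Y)),
     act = (act X \<star> act Y) \<bullet> (\<iota> F \<star> tauF X \<star> \<iota> (cell Y)) \<bullet> (\<Delta> \<star> \<iota> (cell X \<cdot> cell Y))\<rparr>"

definition tambara_alpha ::
  "'m \<Rightarrow> 'c \<Rightarrow> ('m, 'c) tambara \<Rightarrow> ('m, 'c) tambara \<Rightarrow> ('m, 'c) tambara \<Rightarrow> 'c" where
  "tambara_alpha F \<Phi> X Y Z =
     (act X \<star> act Y \<star> act Z)
       \<bullet> (\<iota> F \<star> tauF X \<star> tauF Y \<star> \<iota> (cell Z))
       \<bullet> (\<iota> (F \<cdot> F) \<star> tauF X \<star> \<iota> (cell Y \<cdot> cell Z))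
       \<bullet> (\<Phi> \<star> \<iota> (cell X \<cdot> cell Y \<cdot> cell Z))"

text \<open>The part of monoidality that does not follow from the axioms on objects and on \<open>(F, \<Phi>)\<close>:
  unit and tensor products are again objects. For \<open>X = Y = F\<close> this forces \<open>\<tau>BF\<close> to be
  compatible with \<open>\<epsilon>\<close> and \<open>\<Delta>\<close>.\<close>

definition tensor_closed ::
  "'o \<Rightarrow> 'm \<Rightarrow> 'c \<Rightarrow> 'c \<Rightarrow> 'm \<Rightarrow> ('m, 'c) tambara set \<Rightarrow> bool" where
  "tensor_closed \<A> F \<Delta> \<epsilon> B \<T> \<longleftrightarrow>
     tambara_unit \<A> F \<epsilon> B \<in> \<T> \<and> (\<forall>X\<in>\<T>. \<forall>Y\<in>\<T>. tambara_tensor F \<Delta> X Y \<in> \<T>)"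

text \<open>\<open>\<Phi>L\<close> is the candidate Hausser--Nill 2-cocycle; it can be moved across \<open>X\<close> along
  \<open>\<tau>\<^bsub>F,X\<^esub>\<close> and \<open>\<tau>\<^bsub>B,X\<^esub>\<close> as \<open>\<Phi>\<close> can by \<^const>\<open>left_tambara\<close>. This is not automatic, but the
  cocycle condition needs it: \<open>\<rho> Y Z\<close> inserts \<open>\<Phi>L\<close> to the right of \<open>X\<close>. If normalization and
  the cocycle condition hold for all Tambara modules, then all of them have this property (put
  the trivial action on \<open>X\<close> and take \<open>Y = Z = F\<close>).\<close>

definition transports :: "'m \<Rightarrow> 'm \<Rightarrow> 'c \<Rightarrow> ('m, 'c) tambara \<Rightarrow> bool" where
  "transports F B \<Phi>L X \<longleftrightarrow>
     \<iota> (cell X) \<star> \<Phi>L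
       = (tauF X \<star> \<iota> (F \<cdot> B)) \<bullet> (\<iota> F \<star> tauF X \<star> \<iota> B) \<bullet> (\<iota> (F \<cdot> F) \<star> tauB X) \<bullet> (\<Phi>L \<star> \<iota> (cell X))"

definition comodule_monad ::
  "'o \<Rightarrow> 'm \<Rightarrow> 'c \<Rightarrow> 'm \<Rightarrow> 'c \<Rightarrow> 'c \<Rightarrow> 'c \<Rightarrow> 'c \<Rightarrow> bool" where
  "comodule_monad \<A> F \<eta> B \<mu>B \<eta>B \<psi> coact \<longleftrightarrow>
     monad K \<A> B \<mu>B \<eta>B \<and> \<psi> \<in> hom2 K (B \<cdot> F) (F \<cdot> B) \<and> coact \<in> hom2 K B (F \<cdot> B) \<and>
     coact = \<psi> \<bullet> (\<iota> B \<star> \<eta>) \<and>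
     (\<iota> F \<star> \<mu>B) \<bullet> (\<psi> \<star> \<iota> B) \<bullet> (\<iota> B \<star> coact) = coact \<bullet> \<mu>B \<and>
     coact \<bullet> \<eta>B = \<eta> \<star> \<eta>B"

section \<open>Invertible normalized 2-cocycles\<close>

definition psiB :: "'m \<Rightarrow> 'm \<Rightarrow> 'c \<Rightarrow> ('m, 'c) tambara \<Rightarrow> 'c" where
  "psiB F B coact X = (act X \<star> \<iota> B) \<bullet> (\<iota> F \<star> tauB X) \<bullet> (coact \<star> \<iota> (cell X))"

definition rho_bar ::
  "'m \<Rightarrow> 'm \<Rightarrow> 'c \<Rightarrow> ('m, 'c) tambara \<Rightarrow> ('m, 'c) tambara \<Rightarrow> 'c" where
  "rho_bar F B \<Phi>L X Y =
     (act X \<star> act Y \<star> \<iota> B) \<bullet> (\<iota> F \<star> tauF X \<star> tauB Y)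
       \<bullet> (\<iota> F \<star> \<iota> F \<star> tauB X \<star> \<iota> (cell Y)) \<bullet> (\<Phi>L \<star> \<iota> (cell X) \<star> \<iota> (cell Y))"

definition cocycle_natural ::
  "'m \<Rightarrow> 'm \<Rightarrow> ('m, 'c) tambara set
    \<Rightarrow> (('m, 'c) tambara \<Rightarrow> ('m, 'c) tambara \<Rightarrow> 'c) \<Rightarrow> bool" where
  "cocycle_natural F B \<C> \<rho> \<longleftrightarrow>
     (\<forall>X\<in>\<C>. \<forall>X'\<in>\<C>. \<forall>Y\<in>\<C>. \<forall>Y'\<in>\<C>. \<forall>\<zeta>\<in>tambara_mor F B X X'. \<forall>\<xi>\<in>tambara_mor F B Y Y'.
       (\<zeta> \<star> \<xi> \<star> \<iota> B) \<bullet> \<rho> X Y = \<rho> X' Y' \<bullet> (\<zeta> \<star> \<xi>))"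

definition cocycle_invertible ::
  "'m \<Rightarrow> 'c \<Rightarrow> 'c \<Rightarrow> ('m, 'c) tambara set
    \<Rightarrow> (('m, 'c) tambara \<Rightarrow> ('m, 'c) tambara \<Rightarrow> 'c) \<Rightarrow> bool" where
  "cocycle_invertible B \<mu>B \<eta>B \<C> \<rho> \<longleftrightarrow>
     (\<forall>X\<in>\<C>. \<forall>Y\<in>\<C>. \<exists>\<rho>i \<in> hom2 K (cell X \<cdot> cell Y) (cell X \<cdot> cell Y \<cdot> B).
       (\<iota> (cell X \<cdot> cell Y) \<star> \<mu>B) \<bullet> (\<rho>i \<star> \<iota> B) \<bullet> \<rho> X Y = \<iota> (cell X \<cdot> cell Y) \<star> \<eta>B \<and>
       (\<iota> (cell X \<cdot> cell Y) \<star> \<mu>B) \<bullet> (\<rho> X Y \<star> \<iota> B) \<bullet> \<rho>i = \<iota> (cell X \<cdot> cell Y) \<star> \<eta>B)"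

text \<open>\<open>\<rho> X Y\<close> is a 2-cell from the tensor product of \<open>X\<close> and \<open>Y\<close>, with its own
  \<open>\<psi>\<^bsub>B,XY\<^esub>\<close>, to the composite of \<open>(X, \<psi>\<^bsub>B,X\<^esub>)\<close> and \<open>(Y, \<psi>\<^bsub>B,Y\<^esub>)\<close>; equivalently, the
  associativity \<open>(XY)M \<rightarrow> X(YM)\<close> is \<open>B\<close>-linear. The two occurrences of \<open>\<psi>\<close> therefore differ:
  \<open>\<Delta>\<close> enters the one at the source, \<open>coact\<close> is applied twice in the one at the target.\<close>

definition cocycle_linear ::
  "'m \<Rightarrow> 'c \<Rightarrow> 'm \<Rightarrow> 'c \<Rightarrow> 'c \<Rightarrow> ('m, 'c) tambara set
    \<Rightarrow> (('m, 'c) tambara \<Rightarrow> ('m, 'c) tambara \<Rightarrow> 'c) \<Rightarrow> bool" where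
  "cocycle_linear F \<Delta> B \<mu>B coact \<C> \<rho> \<longleftrightarrow>
     (\<forall>X\<in>\<C>. \<forall>Y\<in>\<C>.
       (\<iota> (cell X \<cdot> cell Y) \<star> \<mu>B) \<bullet> (\<rho> X Y \<star> \<iota> B) \<bullet> psiB F B coact (tambara_tensor F \<Delta> X Y)
       = (\<iota> (cell X \<cdot> cell Y) \<star> \<mu>B)
         \<bullet> (((\<iota> (cell X) \<star> psiB F B coact Y) \<bullet> (psiB F B coact X \<star> \<iota> (cell Y))) \<star> \<iota> B)
         \<bullet> (\<iota> B \<star> \<rho> X Y))"

definition cocycle_condition ::
  "'m \<Rightarrow> 'c \<Rightarrow> 'c \<Rightarrow> 'm \<Rightarrow> 'c \<Rightarrow> 'c \<Rightarrow> ('m, 'c) tambara set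
    \<Rightarrow> (('m, 'c) tambara \<Rightarrow> ('m, 'c) tambara \<Rightarrow> 'c) \<Rightarrow> bool" where
  "cocycle_condition F \<Delta> \<Phi> B \<mu>B coact \<C> \<rho> \<longleftrightarrow>
     (\<forall>X\<in>\<C>. \<forall>Y\<in>\<C>. \<forall>Z\<in>\<C>.
       (\<iota> (cell X \<cdot> cell Y \<cdot> cell Z) \<star> \<mu>B) \<bullet> (\<iota> (cell X) \<star> \<rho> Y Z \<star> \<iota> B)
         \<bullet> \<rho> X (tambara_tensor F \<Delta> Y Z) \<bullet> tambara_alpha F \<Phi> X Y Z
       = (\<iota> (cell X \<cdot> cell Y \<cdot> cell Z) \<star> \<mu>B) \<bullet> (\<iota> (cell X \<cdot> cell Y) \<star> psiB F B coact Z \<star> \<iota> B)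
         \<bullet> (\<rho> X Y \<star> \<iota> (cell Z) \<star> \<iota> B) \<bullet> \<rho> (tambara_tensor F \<Delta> X Y) Z)"

definition cocycle_normalized ::
  "'o \<Rightarrow> 'm \<Rightarrow> 'c \<Rightarrow> 'm \<Rightarrow> 'c \<Rightarrow> ('m, 'c) tambara set
    \<Rightarrow> (('m, 'c) tambara \<Rightarrow> ('m, 'c) tambara \<Rightarrow> 'c) \<Rightarrow> bool" where
  "cocycle_normalized \<A> F \<epsilon> B \<eta>B \<C> \<rho> \<longleftrightarrow>
     (\<forall>X\<in>\<C>. \<rho> X (tambara_unit \<A> F \<epsilon> B) = \<iota> (cell X) \<star> \<eta>B \<and>
            \<rho> (tambara_unit \<A> F \<epsilon> B) X = \<iota> (cell X) \<star> \<eta>B)"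

definition invertible_normalized_2cocycle ::
  "'o \<Rightarrow> 'm \<Rightarrow> 'c \<Rightarrow> 'c \<Rightarrow> 'c \<Rightarrow> 'm \<Rightarrow> 'c \<Rightarrow> 'c \<Rightarrow> 'c \<Rightarrow> ('m, 'c) tambara set
    \<Rightarrow> (('m, 'c) tambara \<Rightarrow> ('m, 'c) tambara \<Rightarrow> 'c) \<Rightarrow> bool" where
  "invertible_normalized_2cocycle \<A> F \<Delta> \<epsilon> \<Phi> B \<mu>B \<eta>B coact \<C> \<rho> \<longleftrightarrow>
     cocycle_natural F B \<C> \<rho> \<and>
     cocycle_invertible B \<mu>B \<eta>B \<C> \<rho> \<and>
     cocycle_linear F \<Delta> B \<mu>B coact \<C> \<rho> \<and>
     cocycle_condition F \<Delta> \<Phi> B \<mu>B coact \<C> \<rho> \<and>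
     cocycle_normalized \<A> F \<epsilon> B \<eta>B \<C> \<rho>"

end

section \<open>Hausser--Nill data\<close>

text \<open>A 3-cocycle is a natural operator on a category of 1-cells with additional structure: the
  tensor product of structured 1-cells has the composite as underlying 1-cell, but need not be
  associative. Naturality with respect to all 2-cells of \<open>K\<close> would be far too strong: for algebras
  over a field it leaves only scalars.\<close>

record ('x, 'm, 'c) structured_cells =
  Objs :: "'x set"
  under :: "'x \<Rightarrow> 'm"
  tens :: "'x \<Rightarrow> 'x \<Rightarrow> 'x"
  Mors :: "'x \<Rightarrow> 'x \<Rightarrow> 'c set"

record ('m, 'c) right_tambara =
  rcell :: 'm
  rtau :: 'c
  ract :: 'c

context
  fixes K :: "('o, 'm, 'c) two_cat" (structure)
begin

definition three_cocycle ::
  "('x, 'm, 'c) structured_cells \<Rightarrow> ('x \<Rightarrow> 'x \<Rightarrow> 'x \<Rightarrow> 'c) \<Rightarrow> bool" where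
  "three_cocycle D \<rho> \<longleftrightarrow>
     (\<forall>X\<in>Objs D. \<forall>Y\<in>Objs D. \<forall>Z\<in>Objs D.
        \<rho> X Y Z \<in> hom2 K (under D X \<cdot> under D Y \<cdot> under D Z) (under D X \<cdot> under D Y \<cdot> under D Z)) \<and>
     (\<forall>X\<in>Objs D. \<forall>X'\<in>Objs D. \<forall>Y\<in>Objs D. \<forall>Y'\<in>Objs D. \<forall>Z\<in>Objs D. \<forall>Z'\<in>Objs D.
        \<forall>\<zeta>\<in>Mors D X X'. \<forall>\<xi>\<in>Mors D Y Y'. \<forall>\<chi>\<in>Mors D Z Z'.
          (\<zeta> \<star> \<xi> \<star> \<chi>) \<bullet> \<rho> X Y Z = \<rho> X' Y' Z' \<bullet> (\<zeta> \<star> \<xi> \<star> \<chi>)) \<and>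
     (\<forall>X\<in>Objs D. \<forall>Y\<in>Objs D. \<forall>Z\<in>Objs D. \<forall>W\<in>Objs D.
        (\<iota> (under D X) \<star> \<rho> Y Z W) \<bullet> \<rho> X (tens D Y Z) W \<bullet> (\<rho> X Y Z \<star> \<iota> (under D W))
        = \<rho> X Y (tens D Z W) \<bullet> \<rho> (tens D X Y) Z W)"

text \<open>\<open>F\<close> enters as an object \<open>F0\<close> of \<open>D\<close>; \<open>\<beta>\<close> is a 3-cocycle on \<open>FFF\<close> if it is the component at
  \<open>(F0, F0, F0)\<close> of a 3-cocycle over \<open>D\<close>.\<close>

definition hausser_nill_datum ::
  "'o \<Rightarrow> ('x, 'm, 'c) structured_cells \<Rightarrow> 'x \<Rightarrow> 'm \<Rightarrow> 'c \<Rightarrow> 'c \<Rightarrow> 'm \<Rightarrow> 'c \<Rightarrow> 'c \<Rightarrow> 'c \<Rightarrow> 'c \<Rightarrow> 'c \<Rightarrow> bool" where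
  "hausser_nill_datum \<A> D F0 B \<mu>B \<eta>B F \<psi> \<Delta>M \<epsilon>M \<eta>F \<beta> \<longleftrightarrow>
     monad K \<A> B \<mu>B \<eta>B \<and> F \<in> endo K \<A> \<and>
     \<psi> \<in> hom2 K (B \<cdot> F) (F \<cdot> B) \<and> \<Delta>M \<in> hom2 K F (F \<cdot> F \<cdot> B) \<and>
     \<epsilon>M \<in> hom2 K F B \<and> \<eta>F \<in> hom2 K (Id1 K \<A>) F \<and>
     F0 \<in> Objs D \<and> under D F0 = F \<and> (\<exists>\<rho>. three_cocycle D \<rho> \<and> \<rho> F0 F0 F0 = \<beta>) \<and>
     (let coact = \<psi> \<bullet> (\<iota> B \<star> \<eta>F); \<Phi>L = \<Delta>M \<bullet> \<eta>F in
       (\<iota> F \<star> \<mu>B) \<bullet> (\<psi> \<star> \<iota> B) \<bullet> (\<iota> B \<star> coact) = coact \<bullet> \<mu>B \<and>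
       coact \<bullet> \<eta>B = \<eta>F \<star> \<eta>B \<and>
       (\<iota> (F \<cdot> F) \<star> \<mu>B) \<bullet> (\<Delta>M \<star> \<iota> B) \<bullet> coact
         = (\<iota> (F \<cdot> F) \<star> \<mu>B) \<bullet> (\<iota> F \<star> \<psi> \<star> \<iota> B) \<bullet> (\<psi> \<star> \<iota> F \<star> \<iota> B) \<bullet> (\<iota> B \<star> \<Phi>L) \<and>
       \<mu>B \<bullet> (\<epsilon>M \<star> \<iota> B) \<bullet> coact = \<mu>B \<bullet> (\<iota> B \<star> (\<epsilon>M \<bullet> \<eta>F)) \<and>
       (\<beta> \<star> \<mu>B) \<bullet> (\<iota> (F \<cdot> F) \<star> \<psi> \<star> \<iota> B) \<bullet> (\<Delta>M \<star> \<iota> F \<star> \<iota> B) \<bullet> \<Phi>L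
         = (\<iota> (F \<cdot> F \<cdot> F) \<star> \<mu>B) \<bullet> (\<iota> F \<star> \<Delta>M \<star> \<iota> B) \<bullet> \<Phi>L \<and>
       (\<iota> F \<star> \<mu>B) \<bullet> (\<psi> \<star> \<iota> B) \<bullet> (\<epsilon>M \<star> \<iota> F \<star> \<iota> B) \<bullet> \<Phi>L = \<eta>F \<star> \<eta>B \<and>
       (\<iota> F \<star> \<mu>B) \<bullet> (\<iota> F \<star> \<epsilon>M \<star> \<iota> B) \<bullet> \<Phi>L = \<eta>F \<star> \<eta>B)"

text \<open>For a quasi-bimonad, \<open>\<beta>\<close> multiplies by \<open>\<Phi>i\<close> from the right, so it is natural in right
  \<open>F\<close>-modules. The structured 1-cells are the mirror images of left Tambara modules; in particular
  \<open>\<sigma>\<close> moves \<open>F\<close> from the right of \<open>X\<close> to its left.\<close>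

definition is_right_tambara ::
  "'o \<Rightarrow> 'm \<Rightarrow> 'c \<Rightarrow> 'c \<Rightarrow> 'c \<Rightarrow> 'c \<Rightarrow> 'c \<Rightarrow> 'c \<Rightarrow> 'm \<Rightarrow> 'c \<Rightarrow> 'c \<Rightarrow> bool" where
  "is_right_tambara \<A> F \<mu> \<eta> \<Delta> \<epsilon> \<tau> \<Phi> X \<sigma> \<nu> \<longleftrightarrow>
     right_module K \<A> F \<mu> \<eta> X \<nu> \<and> \<sigma> \<in> hom2 K (X \<cdot> F) (F \<cdot> X) \<and>
     \<sigma> \<bullet> (\<iota> X \<star> \<mu>) = (\<mu> \<star> \<iota> X) \<bullet> (\<iota> F \<star> \<sigma>) \<bullet> (\<sigma> \<star> \<iota> F) \<and>
     \<sigma> \<bullet> (\<iota> X \<star> \<eta>) = \<eta> \<star> \<iota> X \<and>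
     (\<Delta> \<star> \<iota> X) \<bullet> \<sigma> = (\<iota> F \<star> \<sigma>) \<bullet> (\<sigma> \<star> \<iota> F) \<bullet> (\<iota> X \<star> \<Delta>) \<and>
     (\<epsilon> \<star> \<iota> X) \<bullet> \<sigma> = \<iota> X \<star> \<epsilon> \<and>
     \<Phi> \<star> \<iota> X = (\<iota> (F \<cdot> F) \<star> \<sigma>) \<bullet> (\<iota> F \<star> \<sigma> \<star> \<iota> F) \<bullet> (\<sigma> \<star> \<iota> (F \<cdot> F)) \<bullet> (\<iota> X \<star> \<Phi>) \<and>
     (\<tau> \<star> \<iota> X) \<bullet> (\<iota> F \<star> \<sigma>) \<bullet> (\<sigma> \<star> \<iota> F) = (\<iota> F \<star> \<sigma>) \<bullet> (\<sigma> \<star> \<iota> F) \<bullet> (\<iota> X \<star> \<tau>) \<and>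
     \<sigma> \<bullet> (\<nu> \<star> \<iota> F) = (\<iota> F \<star> \<nu>) \<bullet> (\<sigma> \<star> \<iota> F) \<bullet> (\<iota> X \<star> \<tau>)"

definition right_tambara_modules ::
  "'o \<Rightarrow> 'm \<Rightarrow> 'c \<Rightarrow> 'c \<Rightarrow> 'c \<Rightarrow> 'c \<Rightarrow> 'c \<Rightarrow> 'c
    \<Rightarrow> (('m, 'c) right_tambara, 'm, 'c) structured_cells" where
  "right_tambara_modules \<A> F \<mu> \<eta> \<Delta> \<epsilon> \<tau> \<Phi> = \<lparr>
     Objs = {X. is_right_tambara \<A> F \<mu> \<eta> \<Delta> \<epsilon> \<tau> \<Phi> (rcell X) (rtau X) (ract X)},
     under = rcell,
     tens = (\<lambda>X Y. \<lparr>rcell = rcell X \<cdot> rcell Y,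
       rtau = (rtau X \<star> \<iota> (rcell Y)) \<bullet> (\<iota> (rcell X) \<star> rtau Y),
       ract = (ract X \<star> ract Y) \<bullet> (\<iota> (rcell X) \<star> rtau Y \<star> \<iota> F) \<bullet> (\<iota> (rcell X \<cdot> rcell Y) \<star> \<Delta>)\<rparr>),
     Mors = (\<lambda>X Y. {\<zeta> \<in> hom2 K (rcell X) (rcell Y).
       \<zeta> \<bullet> ract X = ract Y \<bullet> (\<zeta> \<star> \<iota> F) \<and> (\<iota> F \<star> \<zeta>) \<bullet> rtau X = rtau Y \<bullet> (\<zeta> \<star> \<iota> F)})\<rparr>"

definition mu_FFB :: "'m \<Rightarrow> 'c \<Rightarrow> 'c \<Rightarrow> 'm \<Rightarrow> 'c \<Rightarrow> 'c \<Rightarrow> 'c" where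
  "mu_FFB F \<mu> \<tau> B \<mu>B \<tau>BF =
     (\<mu> \<star> \<mu> \<star> \<mu>B) \<bullet> (\<iota> F \<star> \<tau> \<star> \<tau>BF \<star> \<iota> B) \<bullet> (\<iota> (F \<cdot> F) \<star> \<tau>BF \<star> \<iota> F \<star> \<iota> B)"

definition convolution_invertible ::
  "'o \<Rightarrow> 'm \<Rightarrow> 'c \<Rightarrow> 'c \<Rightarrow> 'c \<Rightarrow> 'm \<Rightarrow> 'c \<Rightarrow> 'c \<Rightarrow> 'c \<Rightarrow> 'c \<Rightarrow> bool" where
  "convolution_invertible \<A> F \<mu> \<eta> \<tau> B \<mu>B \<eta>B \<tau>BF f \<longleftrightarrow>
     (\<exists>g \<in> hom2 K (Id1 K \<A>) (F \<cdot> F \<cdot> B).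
        mu_FFB F \<mu> \<tau> B \<mu>B \<tau>BF \<bullet> (f \<star> g) = \<eta> \<star> \<eta> \<star> \<eta>B \<and>
        mu_FFB F \<mu> \<tau> B \<mu>B \<tau>BF \<bullet> (g \<star> f) = \<eta> \<star> \<eta> \<star> \<eta>B)"

end

end

theory Submission
  imports Defs
begin

text \<open>Evaluating at \<open>X = Y = Z = F\<close> and precomposing with units recovers an element
  \<open>u : Id \<rightarrow> F \<dots> F B\<close> from the operator \<open>u\<close> defines on \<open>X \<dots> Z\<close>. Hence a condition on all
  \<open>\<rho>\<close> holds as soon as both sides are operators defined by elements, and then it is an equation
  between these elements: linearity compares \<open>\<Phi>\<^sub>\<lambda> * (\<Delta> \<times> B)\<lambda>\<close> with \<open>(F \<times> \<lambda>)\<lambda> * \<Phi>\<^sub>\<lambda>\<close>, and the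
  cocycle condition is the pentagon of the datum multiplied from the right by \<open>\<Phi> \<times> \<eta>\<^sub>B\<close>, while
  \<open>\<beta>\<close> multiplies by \<open>\<Phi>\<inverse>\<close>. An inverse \<open>i\<close> of \<open>\<rho>\<^sub>F\<^sub>,\<^sub>F\<close> need not be linear, but
  \<open>i(\<eta> \<times> \<eta>)\<close> is a right convolution inverse of \<open>\<Phi>\<^sub>\<lambda>\<close>, and a two-sided one because left
  multiplication by \<open>\<Phi>\<^sub>\<lambda>\<close> is injective. That \<open>\<beta>\<close> extends to a 3-cocycle follows by inverting
  the operators given by \<open>\<Phi>\<close>, which satisfy the opposite identity.

  The identities between composite 2-cells are checked by rewriting string diagrams: a verified
  function applies a given list of rewrite steps to two diagrams and compares the results up
  to interchange.\<close>

section \<open>String diagrams up to interchange\<close>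

text \<open>Composites of operators given by elements are again such operators because actions pass
  crossings (\<open>crf_act\<close>, \<open>crb_act\<close>) and successive actions merge
  (\<open>mod_assoc\<close>); every element thus gathers to the left of the modules. The exception
  is the 2-cell inserted by \<rho> at Y, Z to the right of X: only membership of X in
  \<open>\<C>\<close>, through \<open>transports\<close>, brings it to the left.

  The comparison also needs \<open>\<tau>BF\<close> to respect \<eta>, \<Delta> and \<epsilon>.
  Compatibility with \<epsilon> and \<Delta> comes from closure under unit and tensor product,
  compatibility with \<eta> from moving \<Phi> across B.

  Modules, elements and morphisms enter the diagrams as numbered generators, so each identity is a
  closed term that can be evaluated once; arbitrary X, Y, Z are reached afterwards by choosing which
  objects the numbers denote. The lists of rewrite steps are certificates: soundness does not depend
  on how they were found.\<close>

datatype ('w, 'g) tm = Wire "'w list" | Gen 'g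
  | Hor "('w, 'g) tm" "('w, 'g) tm" (infixr "\<otimes>" 70)
  | Ver "('w, 'g) tm" "('w, 'g) tm" (infixr "\<odot>" 60)

type_synonym ('w, 'g) arity = "'g \<Rightarrow> 'w list \<times> 'w list"
type_synonym 'g diagram = "(nat \<times> 'g) list"

fun dmw :: "('w, 'g) arity \<Rightarrow> ('w, 'g) tm \<Rightarrow> 'w list"
  and cdw :: "('w, 'g) arity \<Rightarrow> ('w, 'g) tm \<Rightarrow> 'w list" where
  "dmw ar (Wire w) = w" | "dmw ar (Gen g) = fst (ar g)"
| "dmw ar (s \<otimes> t) = dmw ar s @ dmw ar t" | "dmw ar (s \<odot> t) = dmw ar t"
| "cdw ar (Wire w) = w" | "cdw ar (Gen g) = snd (ar g)"
| "cdw ar (s \<otimes> t) = cdw ar s @ cdw ar t" | "cdw ar (s \<odot> t) = cdw ar s"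

fun typed :: "('w, 'g) arity \<Rightarrow> ('w, 'g) tm \<Rightarrow> bool" where
  "typed ar (Wire w) = True" | "typed ar (Gen g) = True"
| "typed ar (s \<otimes> t) = (typed ar s \<and> typed ar t)"
| "typed ar (s \<odot> t) = (typed ar s \<and> typed ar t \<and> dmw ar s = cdw ar t)"

text \<open>A slice \<open>(i, g)\<close> applies \<open>g\<close> with \<open>i\<close> wires to its left; the head of a diagram is applied first.\<close>

fun slices :: "('w, 'g) arity \<Rightarrow> nat \<Rightarrow> ('w, 'g) tm \<Rightarrow> 'g diagram" where
  "slices ar i (Wire w) = []" | "slices ar i (Gen g) = [(i, g)]"
| "slices ar i (s \<otimes> t) = slices ar i s @ slices ar (i + length (cdw ar s)) t"
| "slices ar i (s \<odot> t) = slices ar i t @ slices ar i s"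

definition fire :: "('w, 'g) arity \<Rightarrow> 'w list \<Rightarrow> nat \<times> 'g \<Rightarrow> 'w list" where
  "fire ar w s = take (fst s) w @ snd (ar (snd s)) @ drop (fst s + length (fst (ar (snd s)))) w"

definition enabled :: "('w, 'g) arity \<Rightarrow> 'w list \<Rightarrow> nat \<times> 'g \<Rightarrow> bool" where
  "enabled ar w s \<longleftrightarrow> (\<exists>l r. w = l @ fst (ar (snd s)) @ r \<and> length l = fst s)"

fun wf_diagram :: "('w, 'g) arity \<Rightarrow> 'w list \<Rightarrow> 'g diagram \<Rightarrow> bool" where
  "wf_diagram ar w [] = True"
| "wf_diagram ar w (s # d) = (enabled ar w s \<and> wf_diagram ar (fire ar w s) d)"

fun target :: "('w, 'g) arity \<Rightarrow> 'w list \<Rightarrow> 'g diagram \<Rightarrow> 'w list" where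
  "target ar w [] = w"
| "target ar w (s # d) = target ar (fire ar w s) d"

text \<open>\<open>s\<close> fires before \<open>t\<close>. Only offsets and lengths are compared;
  that the labels fit is supplied later by well-formedness. If \<open>s\<close> has no outputs,
  \<open>t\<close> no inputs and the offsets agree, both branches apply, and \<open>t\<close> is
  placed to the right of \<open>s\<close>.\<close>

definition commute :: "('w, 'g) arity \<Rightarrow> nat \<times> 'g \<Rightarrow> nat \<times> 'g \<Rightarrow> ((nat \<times> 'g) \<times> (nat \<times> 'g)) option" where
  "commute ar s t =
     (if fst s + length (snd (ar (snd s))) \<le> fst t
      then Some ((fst t - length (snd (ar (snd s))) + length (fst (ar (snd s))), snd t), s)
      else if fst t + length (fst (ar (snd t))) \<le> fst s
      then Some (t, (fst s - length (fst (ar (snd t))) + length (snd (ar (snd t))), snd s))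
      else None)"

fun pull :: "('w, 'g) arity \<Rightarrow> 'g diagram \<Rightarrow> nat \<times> 'g \<Rightarrow> ((nat \<times> 'g) \<times> 'g diagram) option" where
  "pull ar [] s = Some (s, [])"
| "pull ar (a # d) s = (case pull ar d s of None \<Rightarrow> None
     | Some (s', d') \<Rightarrow> (case commute ar a s' of None \<Rightarrow> None
         | Some (s'', a') \<Rightarrow> Some (s'', a' # d')))"

text \<open>Brings the slices with the given increasing indices together, as the middle part of the result.
  A slice that does not depend on them is moved before them, even if it comes later.\<close>

fun gather :: "('w, 'g) arity \<Rightarrow> nat list \<Rightarrow> nat \<Rightarrow> 'g diagram \<Rightarrow> 'g diagram \<Rightarrow> 'g diagram \<Rightarrow> 'g diagram
    \<Rightarrow> ('g diagram \<times> 'g diagram \<times> 'g diagram) option" where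
  "gather ar [] k p g a d = Some (p, g, a @ d)"
| "gather ar (n # ns) k p g a [] = None"
| "gather ar (n # ns) k p g a (s # d) =
     (if k = n
      then (case pull ar a s of None \<Rightarrow> None
        | Some (s', a') \<Rightarrow> gather ar ns (Suc k) p (g @ [s']) a' d)
      else (case pull ar (g @ a) s of None \<Rightarrow> gather ar (n # ns) (Suc k) p g (a @ [s]) d
        | Some (s', e) \<Rightarrow>
            gather ar (n # ns) (Suc k) (p @ [s']) (take (length g) e) (drop (length g) e) d))"

text \<open>Interchange changes the offset of a slice but never its generator, so only slices with
  the generator of \<open>t\<close> are candidates. The argument \<open>a\<close> holds the slices
  already passed.\<close>

fun extractions :: "('w, 'g) arity \<Rightarrow> nat \<times> 'g \<Rightarrow> 'g diagram \<Rightarrow> 'g diagram \<Rightarrow> 'g diagram list" where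
  "extractions ar t a [] = []"
| "extractions ar t a (s # d) =
     (if snd s = snd t
      then (case pull ar a s of None \<Rightarrow> extractions ar t (a @ [s]) d
        | Some (s', a') \<Rightarrow> if s' = t then (a' @ d) # extractions ar t (a @ [s]) d
            else extractions ar t (a @ [s]) d)
      else extractions ar t (a @ [s]) d)"

text \<open>The diagrams in \<open>ds\<close> are all the ways to continue: a slice without inputs can occur several
  times in equal positions, and the first match need not be the right one.\<close>

fun interchange_eq :: "('w, 'g) arity \<Rightarrow> 'g diagram list \<Rightarrow> 'g diagram \<Rightarrow> bool" where
  "interchange_eq ar ds [] = ([] \<in> set ds)"
| "interchange_eq ar ds (t # e) = interchange_eq ar (concat (map (extractions ar t []) ds)) e"

type_synonym ('w, 'g) equation = "('w, 'g) tm \<times> ('w, 'g) tm"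

text \<open>An executable form of the splitting in \<open>enabled\<close>. The bound on
  \<open>i\<close> matters when \<open>u\<close> is empty, since the second conjunct is then
  vacuous.\<close>

definition occurs :: "'w list \<Rightarrow> nat \<Rightarrow> 'w list \<Rightarrow> bool" where
  "occurs u i w \<longleftrightarrow> i \<le> length w \<and> take (length u) (drop i w) = u"

text \<open>Comparing slices says nothing about wires that run through \<open>l\<close> untouched;
  \<open>occurs\<close> checks that they are present at the place of the match.\<close>

fun rewrite_step :: "('w, 'g) arity \<Rightarrow> 'w list \<Rightarrow> ('w, 'g) equation \<Rightarrow> nat list \<Rightarrow> nat \<Rightarrow> 'g diagram \<Rightarrow> 'g diagram
    option" where
  "rewrite_step ar w (l, r) ns i d = (case gather ar ns 0 [] [] [] d of None \<Rightarrow> None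
     | Some (p, g, a) \<Rightarrow>
         if occurs (dmw ar l) i (target ar w p) \<and> interchange_eq ar [g] (slices ar i l)
         then Some (p @ slices ar i r @ a) else None)"

text \<open>A step \<open>((l, r), ns, i)\<close> replaces the slices with indices \<open>ns\<close>, which have to form \<open>l\<close> at
  offset \<open>i\<close>, by \<open>r\<close>.\<close>

type_synonym ('w, 'g) step = "('w, 'g) equation \<times> nat list \<times> nat"

fun rewrite_steps :: "('w, 'g) arity \<Rightarrow> 'w list \<Rightarrow> ('w, 'g) step list \<Rightarrow> 'g diagram \<Rightarrow> 'g diagram option" where
  "rewrite_steps ar w [] d = Some d"
| "rewrite_steps ar w ((e, ns, i) # rs) d = (case rewrite_step ar w e ns i d of None \<Rightarrow> None
     | Some d' \<Rightarrow> rewrite_steps ar w rs d')"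

text \<open>Each side has its own list of steps and the results meet in the middle, so a law can be
  applied from left to right on either side; reversed applications go through
  \<open>swap\<close>.\<close>

definition derivable :: "('w, 'g) arity \<Rightarrow> ('w, 'g) step list \<Rightarrow> ('w, 'g) step list
    \<Rightarrow> ('w, 'g) equation \<Rightarrow> bool" where
  "derivable ar rs rs' e \<longleftrightarrow> typed ar (fst e) \<and> typed ar (snd e) \<and>
     dmw ar (fst e) = dmw ar (snd e) \<and> cdw ar (fst e) = cdw ar (snd e) \<and>
     (case rewrite_steps ar (dmw ar (fst e)) rs (slices ar 0 (fst e)) of None \<Rightarrow> False
      | Some d \<Rightarrow> (case rewrite_steps ar (dmw ar (fst e)) rs' (slices ar 0 (snd e)) of None \<Rightarrow> False
          | Some d' \<Rightarrow> interchange_eq ar [d] d'))"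

lemma enabledI: "length l = i \<Longrightarrow> enabled ar (l @ fst (ar g) @ r) (i, g)"
  by (auto simp: enabled_def)

lemma fire_app: "length l = i \<Longrightarrow> fire ar (l @ fst (ar g) @ r) (i, g) = l @ snd (ar g) @ r"
  by (auto simp: fire_def)

lemma wf_append: "wf_diagram ar w (d @ e) \<longleftrightarrow> wf_diagram ar w d \<and> wf_diagram ar (target ar w d) e"
  by (induction d arbitrary: w) auto

lemma target_append: "target ar w (d @ e) = target ar (target ar w d) e"
  by (induction d arbitrary: w) auto

lemma slices_wf:
  "typed ar t \<Longrightarrow> length l = i \<Longrightarrow>
    wf_diagram ar (l @ dmw ar t @ r) (slices ar i t) \<and>
    target ar (l @ dmw ar t @ r) (slices ar i t) = l @ cdw ar t @ r"
proof (induction t arbitrary: l i r)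
  case (Gen g)
  then show ?case by (simp add: enabledI fire_app)
next
  case (Hor s t)
  from Hor.IH(1)[of l i "dmw ar t @ r"] Hor.IH(2)[of "l @ cdw ar s" "i + length (cdw ar s)" r] Hor.prems
  show ?case by (simp add: wf_append target_append)
next
  case (Ver s t)
  from Ver.IH(1)[of l i "r"] Ver.IH(2)[of l i r] Ver.prems
  show ?case by (simp add: wf_append target_append)
qed auto

section \<open>Interpretation of diagrams in a 2-category\<close>

locale diagrams = two_category K for K :: "('o, 'm, 'c) two_cat" (structure) +
  fixes \<A> :: 'o and ar :: "('w, 'g) arity" and cel :: "'w \<Rightarrow> 'm" and gen :: "'g \<Rightarrow> 'c"
  assumes \<A>_cell: "\<A> \<in> Cells0 K"
begin

fun word :: "'w list \<Rightarrow> 'm" where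
  "word [] = Id1 K \<A>" | "word (w # ws) = cel w \<cdot> word ws"

fun ev :: "('w, 'g) tm \<Rightarrow> 'c" where
  "ev (Wire w) = \<iota> (word w)" | "ev (Gen g) = gen g"
| "ev (s \<otimes> t) = ev s \<star> ev t" | "ev (s \<odot> t) = ev s \<bullet> ev t"

definition holds :: "('w, 'g) equation \<Rightarrow> bool" where
  "holds e \<longleftrightarrow> typed ar (fst e) \<and> typed ar (snd e) \<and> dmw ar (fst e) = dmw ar (snd e) \<and>
     cdw ar (fst e) = cdw ar (snd e) \<and> ev (fst e) = ev (snd e)"

definition slice :: "'w list \<Rightarrow> nat \<times> 'g \<Rightarrow> 'c" where
  "slice w s = \<iota> (word (take (fst s) w)) \<star> gen (snd s) \<star> \<iota> (word (drop (fst s + length (fst (ar (snd s)))) w))"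

fun evs :: "'w list \<Rightarrow> 'g diagram \<Rightarrow> 'c" where
  "evs w [] = \<iota> (word w)"
| "evs w (s # d) = evs (fire ar w s) d \<bullet> slice w s"

text \<open>An implication rather than an equivalence: the moves inspect only offsets and lengths,
  so the matching of labels has to be taken from the well-formedness of \<open>d\<close> and handed
  on to \<open>e\<close>.\<close>

definition simulates :: "'g diagram \<Rightarrow> 'g diagram \<Rightarrow> bool" where
  "simulates d e \<longleftrightarrow> (\<forall>w. wf_diagram ar w d \<longrightarrow>
     wf_diagram ar w e \<and> target ar w d = target ar w e \<and> evs w d = evs w e)"

end

text \<open>Separate from \<open>diagrams\<close> because the typing of generators is itself stated,
  and later proved, with the help of \<open>word\<close>.\<close>

locale typed_diagrams = diagrams +
  assumes cel_endo: "cel w \<in> endo K \<A>"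
    and gen_hom: "gen g \<in> hom2 K (word (fst (ar g))) (word (snd (ar g)))"
begin

lemma endo_cell: "X \<in> endo K \<A> \<Longrightarrow> X \<in> Cells1 K \<and> src K X = \<A> \<and> trg K X = \<A>"
  by (simp add: endo_def)

lemma endo_comp: "X \<in> endo K \<A> \<Longrightarrow> Y \<in> endo K \<A> \<Longrightarrow> X \<cdot> Y \<in> endo K \<A>"
  using comp1_cell by (auto simp: endo_def)

lemma word_endo: "word w \<in> endo K \<A>"
  by (induction w) (auto simp: Id1_cell \<A>_cell cel_endo intro: endo_comp)

lemma word_append: "word (u @ v) = word u \<cdot> word v"
proof (induction u)
  case Nil
  then show ?case using comp1_Id[of "word v"] endo_cell[OF word_endo[of v]] by auto
next
  case (Cons a u)
  then show ?case
    using comp1_assoc endo_cell[OF word_endo[of v]] endo_cell[OF word_endo[of u]] endo_cell[OF cel_endo[of a]]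
    by auto
qed

lemma id_hom: "\<iota> (word w) \<in> hom2 K (word w) (word w)"
  using id2_cell endo_cell[OF word_endo] by auto

lemma hor_hom:
  assumes "f \<in> hom2 K (word u) (word u')" "g \<in> hom2 K (word v) (word v')"
  shows "f \<star> g \<in> hom2 K (word (u @ v)) (word (u' @ v'))"
  using hcomp_cell[OF assms] endo_cell[OF word_endo] by (auto simp: word_append)

lemma ev_hom: "typed ar t \<Longrightarrow> ev t \<in> hom2 K (word (dmw ar t)) (word (cdw ar t))"
  by (induction t) (auto simp: id_hom gen_hom intro: hor_hom vcomp_cell)

lemma hor_assoc:
  assumes "f \<in> hom2 K (word u) (word u')" "g \<in> hom2 K (word v) (word v')" "h \<in> hom2 K (word w) (word w')"
  shows "(f \<star> g) \<star> h = f \<star> g \<star> h"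
  using hcomp_assoc[OF assms] endo_cell[OF word_endo] by auto

lemma hor_id: "\<iota> (word u) \<star> \<iota> (word v) = \<iota> (word (u @ v))"
  using hcomp_id2 endo_cell[OF word_endo] by (auto simp: word_append)

lemma hor_Nil:
  assumes "f \<in> hom2 K (word u) (word u')"
  shows "\<iota> (word []) \<star> f = f" "f \<star> \<iota> (word []) = f"
  using hcomp_Id[OF assms] endo_cell[OF word_endo] by auto

lemma hor_ver:
  assumes "f \<in> hom2 K (word u) (word u')" "f' \<in> hom2 K (word u') (word u'')"
    "g \<in> hom2 K (word v) (word v')" "g' \<in> hom2 K (word v') (word v'')"
  shows "(f' \<bullet> f) \<star> (g' \<bullet> g) = (f' \<star> g') \<bullet> (f \<star> g)"
  using interchange[OF assms] endo_cell[OF word_endo] by auto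

lemma ver_id:
  assumes "f \<in> hom2 K (word u) (word u')"
  shows "\<iota> (word u') \<bullet> f = f" "f \<bullet> \<iota> (word u) = f"
  using vcomp_id[OF assms] by auto

lemma slice_app: "length l = i \<Longrightarrow>
    slice (l @ fst (ar g) @ r) (i, g) = \<iota> (word l) \<star> gen g \<star> \<iota> (word r)"
  by (simp add: slice_def)

lemma slice_hom: "enabled ar w s \<Longrightarrow> slice w s \<in> hom2 K (word w) (word (fire ar w s))"
  by (cases s) (auto simp: enabled_def slice_app fire_app intro!: hor_hom id_hom gen_hom)

lemma evs_hom: "wf_diagram ar w d \<Longrightarrow> evs w d \<in> hom2 K (word w) (word (target ar w d))"
  by (induction d arbitrary: w) (auto simp: id_hom intro: vcomp_cell slice_hom)

lemma evs_append: "wf_diagram ar w (d @ e) \<Longrightarrow> evs w (d @ e) = evs (target ar w d) e \<bullet> evs w d"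
proof (induction d arbitrary: w)
  case Nil
  then show ?case using ver_id[OF evs_hom] by auto
next
  case (Cons s d)
  then have "evs w ((s # d) @ e) = (evs (target ar w (s # d)) e \<bullet> evs (fire ar w s) d) \<bullet> slice w s"
    by simp
  also have "\<dots> = evs (target ar w (s # d)) e \<bullet> (evs (fire ar w s) d \<bullet> slice w s)"
    by (rule vcomp_assoc) (use Cons.prems in \<open>auto simp: wf_append intro: slice_hom evs_hom\<close>)
  finally show ?case by simp
qed

lemma whisker_ver:
  assumes "f \<in> hom2 K (word u) (word u')" "f' \<in> hom2 K (word u') (word u'')"
  shows "\<iota> (word l) \<star> (f' \<bullet> f) \<star> \<iota> (word r)
    = (\<iota> (word l) \<star> f' \<star> \<iota> (word r)) \<bullet> (\<iota> (word l) \<star> f \<star> \<iota> (word r))"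
proof -
  have "(f' \<bullet> f) \<star> \<iota> (word r) = (f' \<star> \<iota> (word r)) \<bullet> (f \<star> \<iota> (word r))"
    using hor_ver[OF assms id_hom id_hom, of r] ver_id[OF id_hom] by simp
  moreover have "\<iota> (word l) \<star> ((f' \<star> \<iota> (word r)) \<bullet> (f \<star> \<iota> (word r)))
    = (\<iota> (word l) \<star> f' \<star> \<iota> (word r)) \<bullet> (\<iota> (word l) \<star> f \<star> \<iota> (word r))"
    using hor_ver[OF id_hom id_hom hor_hom[OF assms(1) id_hom] hor_hom[OF assms(2) id_hom], of l r] ver_id[OF
        id_hom] by simp
  ultimately show ?thesis by simp
qed

lemma hor_slide:
  assumes "f \<in> hom2 K (word u) (word u')" "g \<in> hom2 K (word v) (word v')"
  shows "(f \<star> \<iota> (word v')) \<bullet> (\<iota> (word u) \<star> g) = f \<star> g"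
    and "(\<iota> (word u') \<star> g) \<bullet> (f \<star> \<iota> (word v)) = f \<star> g"
  using hor_ver[OF id_hom assms(1) assms(2) id_hom] hor_ver[OF assms(1) id_hom id_hom assms(2)]
    ver_id[OF assms(1)] ver_id[OF assms(2)] by auto

text \<open>Flattening fires the left factor of a horizontal composite first, so the right factor
  sees the codomain of the left one; the interchange law in the form \<open>hor_slide\<close> undoes
  this choice.\<close>

lemma evs_slices:
  "typed ar t \<Longrightarrow> length l = i \<Longrightarrow>
    evs (l @ dmw ar t @ r) (slices ar i t) = \<iota> (word l) \<star> ev t \<star> \<iota> (word r)"
proof (induction t arbitrary: l i r)
  case (Wire w)
  then show ?case by (simp add: hor_id)
next
  case (Gen g)
  then show ?case
    using ver_id(1)[OF hor_hom[OF id_hom[of l] hor_hom[OF gen_hom[of g] id_hom[of r]]]]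
    by (simp add: slice_app fire_app)
next
  case (Hor s t)
  let ?a = "\<iota> (word l)" and ?c = "\<iota> (word r)"
  note s = ev_hom[of s] and t = ev_hom[of t]
  have ty: "typed ar s" "typed ar t" using Hor.prems by auto
  have wf: "wf_diagram ar (l @ dmw ar (s \<otimes> t) @ r) (slices ar i (s \<otimes> t))"
    using slices_wf[OF Hor.prems] by blast
  have "evs (l @ dmw ar (s \<otimes> t) @ r) (slices ar i (s \<otimes> t))
      = evs ((l @ cdw ar s) @ dmw ar t @ r) (slices ar (i + length (cdw ar s)) t)
        \<bullet> evs (l @ dmw ar s @ (dmw ar t @ r)) (slices ar i s)"
    using evs_append[OF wf[simplified]] slices_wf[of ar s l i "dmw ar t @ r"] Hor.prems by simp
  also have "\<dots> = (\<iota> (word (l @ cdw ar s)) \<star> ev t \<star> ?c) \<bullet> (?a \<star> ev s \<star> \<iota> (word (dmw ar t @ r)))"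
    using Hor.IH(1)[of l i "dmw ar t @ r"] Hor.IH(2)[of "l @ cdw ar s" "i + length (cdw ar s)" r] Hor.prems
    by simp
  also have "\<iota> (word (l @ cdw ar s)) \<star> ev t \<star> ?c = ?a \<star> (\<iota> (word (cdw ar s)) \<star> ev t) \<star> ?c"
    using hor_assoc[OF id_hom id_hom hor_hom[OF t[OF ty(2)] id_hom], of l "cdw ar s" r]
      hor_assoc[OF id_hom t[OF ty(2)] id_hom, of "cdw ar s" r] by (simp add: hor_id)
  also have "?a \<star> ev s \<star> \<iota> (word (dmw ar t @ r)) = ?a \<star> (ev s \<star> \<iota> (word (dmw ar t))) \<star> ?c"
    using hor_assoc[OF s[OF ty(1)] id_hom id_hom, of "dmw ar t" r] by (simp add: hor_id)
  also have "(?a \<star> (\<iota> (word (cdw ar s)) \<star> ev t) \<star> ?c) \<bullet> (?a \<star> (ev s \<star> \<iota> (word (dmw ar t))) \<star> ?c)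
      = ?a \<star> ((\<iota> (word (cdw ar s)) \<star> ev t) \<bullet> (ev s \<star> \<iota> (word (dmw ar t)))) \<star> ?c"
    using whisker_ver[OF hor_hom[OF s[OF ty(1)] id_hom] hor_hom[OF id_hom t[OF ty(2)]]] by simp
  also have "\<dots> = ?a \<star> ev (s \<otimes> t) \<star> ?c"
    using hor_slide(2)[OF s[OF ty(1)] t[OF ty(2)]] by simp
  finally show ?case .
next
  case (Ver s t)
  have ty: "typed ar s" "typed ar t" "dmw ar s = cdw ar t" using Ver.prems by auto
  have wf: "wf_diagram ar (l @ dmw ar (s \<odot> t) @ r) (slices ar i (s \<odot> t))"
    using slices_wf[OF Ver.prems] by blast
  then show ?case
    using evs_append[OF wf[simplified]] slices_wf[of ar t l i r] Ver.prems Ver.IH(1)[of l i r] Ver.IH(2)[of l i r]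
      whisker_ver[OF ev_hom[of t] ev_hom[of s, unfolded ty(3)], of l r] ty
    by simp
qed

section \<open>Soundness of interchange and rewriting\<close>

lemma simulates_refl: "simulates d d"
  by (simp add: simulates_def)

lemma simulates_trans: "simulates d e \<Longrightarrow> simulates e f \<Longrightarrow> simulates d f"
  by (simp add: simulates_def)

lemma simulates_append: "simulates d e \<Longrightarrow> simulates (p @ d @ q) (p @ e @ q)"
  unfolding simulates_def
  by (auto simp: wf_append target_append evs_append[of _ p] evs_append[of _ _ q])

lemma commute_sound:
  assumes "commute ar s t = Some (t', s')" shows "simulates [s, t] [t', s']"
  unfolding simulates_def
proof (intro allI impI)
  fix w assume wf: "wf_diagram ar w [s, t]"
  obtain i g where s: "s = (i, g)" by (cases s)
  obtain j h where t: "t = (j, h)" by (cases t)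
  let ?G = "fst (ar g)" and ?G' = "snd (ar g)" and ?H = "fst (ar h)" and ?H' = "snd (ar h)"
  obtain l r where w: "w = l @ ?G @ r" "length l = i"
    using wf by (auto simp: enabled_def s)
  obtain l' r' where w': "l @ ?G' @ r = l' @ ?H @ r'" "length l' = j"
    using wf by (auto simp: enabled_def s t w fire_app[OF w(2)])
  \<comment> \<open>\<open>m\<close> is the stretch of wires between the two generators. The two
    cases are \<open>t\<close> to the right and \<open>t\<close> to the left of
    \<open>s\<close>.\<close>
  consider m where "l' = l @ ?G' @ m" "r = m @ ?H @ r'" "t' = (i + length ?G + length m, h)" "s' = s"
    | m where "l = l' @ ?H @ m" "r' = m @ ?G' @ r" "t' = t" "s' = (j + length ?H' + length m, g)"
  proof (cases "i + length ?G' \<le> j")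
    case True
    have "(l @ ?G') @ r = l' @ ?H @ r'" using w' by simp
    then consider us where "l @ ?G' = l' @ us" "us @ r = ?H @ r'" | us where "(l @ ?G') @ us = l'" "r = us @
        ?H @ r'"
      unfolding append_eq_append_conv2[of "l @ ?G'" r l' "?H @ r'"] by blast
    then obtain m where "l' = (l @ ?G') @ m" "r = m @ ?H @ r'"
    proof cases
      case 1
      \<comment> \<open>\<open>us\<close> would be an overlap of the outputs of \<open>s\<close>
        with the inputs of \<open>t\<close>; the offsets leave no room for it.\<close>
      from arg_cong[OF 1(1), of length] True w w' have "us = []" by simp
      with 1 that[of "[]"] show thesis by simp
    next
      case 2
      then show thesis using that by blast
    qed
    with True assms w w' show thesis
      by (intro that(1)[of m]) (auto simp: commute_def s t)
  next
    case False
    then have le: "j + length ?H \<le> i" and ts: "t' = t" "s' = (i - length ?H + length ?H', g)"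
      using assms by (auto simp: commute_def s t split: if_splits)
    have "(l' @ ?H) @ r' = l @ ?G' @ r" using w' by simp
    then consider us where "l' @ ?H = l @ us" "us @ r' = ?G' @ r" | us where "(l' @ ?H) @ us = l" "r' = us @
        ?G' @ r"
      unfolding append_eq_append_conv2[of "l' @ ?H" r' l "?G' @ r"] by blast
    then obtain m where "l = (l' @ ?H) @ m" "r' = m @ ?G' @ r"
    proof cases
      case 1
      from arg_cong[OF 1(1), of length] le w w' have "us = []" by simp
      with 1 that[of "[]"] show thesis by simp
    next
      case 2
      then show thesis using that by blast
    qed
    with ts w w' show thesis
      by (intro that(2)[of m]) auto
  qed
  then show "wf_diagram ar w [t', s'] \<and> target ar w [s, t] = target ar w [t', s'] \<and> evs w [s, t] = evs w [t', s']"
  proof cases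
    case 1
    let ?a = "\<iota> (word l)" and ?m = "\<iota> (word m)" and ?c = "\<iota> (word r')"
    note g = gen_hom[of g] and h = gen_hom[of h]
    have f1: "fire ar w s = (l @ ?G' @ m) @ ?H @ r'" using w 1 by (simp add: s fire_app)
    have e1: "enabled ar w t'" using enabledI[of "l @ ?G @ m" "i + length ?G + length m" ar h r'] w 1 by simp
    have f2: "fire ar w t' = l @ ?G @ (m @ ?H' @ r')"
      using fire_app[of "l @ ?G @ m" "i + length ?G + length m" ar h r'] w 1 by simp
    have e2: "enabled ar (fire ar w t') s'" using enabledI[of l i ar g "m @ ?H' @ r'"] w 1 f2 by (simp add: s)
    have f3: "fire ar (fire ar w s) t = l @ ?G' @ m @ ?H' @ r'"
      using fire_app[of "l @ ?G' @ m" j ar h r'] w' 1 f1 by (simp add: t)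
    have f4: "fire ar (fire ar w t') s' = l @ ?G' @ m @ ?H' @ r'"
      using fire_app[of l i ar g "m @ ?H' @ r'"] w 1 f2 by (simp add: s)
    have "slice (fire ar w s) t = \<iota> (word (l @ ?G' @ m)) \<star> gen h \<star> ?c"
      using slice_app[of "l @ ?G' @ m" j h r'] w' 1 f1 by (simp add: t)
    also have "\<dots> = ?a \<star> \<iota> (word ?G') \<star> (?m \<star> gen h \<star> ?c)"
      using hor_assoc[OF id_hom id_hom hor_hom[OF id_hom hor_hom[OF h id_hom]], of l ?G' m r']
        hor_assoc[OF id_hom id_hom hor_hom[OF h id_hom], of "l @ ?G'" m r'] by (simp add: hor_id)
    finally have s1: "slice (fire ar w s) t = ?a \<star> \<iota> (word ?G') \<star> (?m \<star> gen h \<star> ?c)" .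
    have "slice w t' = \<iota> (word (l @ ?G @ m)) \<star> gen h \<star> ?c"
      using slice_app[of "l @ ?G @ m" "i + length ?G + length m" h r'] w 1 by simp
    also have "\<dots> = ?a \<star> \<iota> (word ?G) \<star> (?m \<star> gen h \<star> ?c)"
      using hor_assoc[OF id_hom id_hom hor_hom[OF id_hom hor_hom[OF h id_hom]], of l ?G m r']
        hor_assoc[OF id_hom id_hom hor_hom[OF h id_hom], of "l @ ?G" m r'] by (simp add: hor_id)
    finally have s2: "slice w t' = ?a \<star> \<iota> (word ?G) \<star> (?m \<star> gen h \<star> ?c)" .
    have s3: "slice w s = ?a \<star> gen g \<star> \<iota> (word (m @ ?H @ r'))"
      using slice_app[of l i g r] w 1 by (simp add: s)
    have s4: "slice (fire ar w t') s' = ?a \<star> gen g \<star> \<iota> (word (m @ ?H' @ r'))"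
      using slice_app[of l i g "m @ ?H' @ r'"] w 1 f2 by (simp add: s)
    note mh = hor_hom[OF id_hom[of m] hor_hom[OF h id_hom[of r']]]
    note aid = id_hom[of l]
    have k1: "slice (fire ar w s) t \<bullet> slice w s = ?a \<star> gen g \<star> (?m \<star> gen h \<star> ?c)"
      using hor_ver[OF aid aid hor_hom[OF g id_hom] hor_hom[OF id_hom mh]] hor_slide(2)[OF g mh] ver_id[OF aid]
      by (simp add: s1 s3)
    have k2: "slice (fire ar w t') s' \<bullet> slice w t' = ?a \<star> gen g \<star> (?m \<star> gen h \<star> ?c)"
      using hor_ver[OF aid aid hor_hom[OF id_hom mh] hor_hom[OF g id_hom]] hor_slide(1)[OF g mh] ver_id[OF aid]
      by (simp add: s2 s4)
    have sl: "slice (fire ar w s) t \<in> hom2 K (word (fire ar w s)) (word (fire ar (fire ar w s) t))"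
      "slice (fire ar w t') s' \<in> hom2 K (word (fire ar w t')) (word (fire ar (fire ar w t') s'))"
      using slice_hom wf e2 by auto
    show ?thesis
      using e1 e2 f3 f4 k1 k2 ver_id(1)[OF sl(1)] ver_id(1)[OF sl(2)] by simp
  next
    case 2
    let ?a = "\<iota> (word l')" and ?m = "\<iota> (word m)" and ?c = "\<iota> (word r)"
    note g = gen_hom[of g] and h = gen_hom[of h]
    have f1: "fire ar w s = l' @ ?H @ (m @ ?G' @ r)" using w 2 fire_app[of l i ar g r] by (simp add: s)
    have e1: "enabled ar w t'" using enabledI[of l' j ar h "m @ ?G @ r"] w w' 2 by (simp add: t)
    have f2: "fire ar w t' = (l' @ ?H' @ m) @ ?G @ r"
      using fire_app[of l' j ar h "m @ ?G @ r"] w w' 2 by (simp add: t)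
    have e2: "enabled ar (fire ar w t') s'" using enabledI[of "l' @ ?H' @ m" "j + length ?H' + length m" ar g
        r] w w' 2 f2 by simp
    have f3: "fire ar (fire ar w s) t = l' @ ?H' @ m @ ?G' @ r"
      using fire_app[of l' j ar h r'] w' 2 f1 by (simp add: t)
    have f4: "fire ar (fire ar w t') s' = l' @ ?H' @ m @ ?G' @ r"
      using fire_app[of "l' @ ?H' @ m" "j + length ?H' + length m" ar g r] w w' 2 f2 by simp
    have s1: "slice (fire ar w s) t = ?a \<star> gen h \<star> \<iota> (word (m @ ?G' @ r))"
      using slice_app[of l' j h r'] w' 2 f1 by (simp add: t)
    have s2: "slice w t' = ?a \<star> gen h \<star> \<iota> (word (m @ ?G @ r))"
      using slice_app[of l' j h "m @ ?G @ r"] w w' 2 by (simp add: t)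
    have "slice w s = \<iota> (word (l' @ ?H @ m)) \<star> gen g \<star> ?c"
      using slice_app[of l i g r] w 2 by (simp add: s)
    also have "\<dots> = ?a \<star> \<iota> (word ?H) \<star> (?m \<star> gen g \<star> ?c)"
      using hor_assoc[OF id_hom id_hom hor_hom[OF id_hom hor_hom[OF g id_hom]], of l' ?H m r]
        hor_assoc[OF id_hom id_hom hor_hom[OF g id_hom], of "l' @ ?H" m r] by (simp add: hor_id)
    finally have s3: "slice w s = ?a \<star> \<iota> (word ?H) \<star> (?m \<star> gen g \<star> ?c)" .
    have "slice (fire ar w t') s' = \<iota> (word (l' @ ?H' @ m)) \<star> gen g \<star> ?c"
      using slice_app[of "l' @ ?H' @ m" "j + length ?H' + length m" g r] w w' 2 f2 by simp
    also have "\<dots> = ?a \<star> \<iota> (word ?H') \<star> (?m \<star> gen g \<star> ?c)"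
      using hor_assoc[OF id_hom id_hom hor_hom[OF id_hom hor_hom[OF g id_hom]], of l' ?H' m r]
        hor_assoc[OF id_hom id_hom hor_hom[OF g id_hom], of "l' @ ?H'" m r] by (simp add: hor_id)
    finally have s4: "slice (fire ar w t') s' = ?a \<star> \<iota> (word ?H') \<star> (?m \<star> gen g \<star> ?c)" .
    note mh = hor_hom[OF id_hom[of m] hor_hom[OF g id_hom[of r]]]
    note aid = id_hom[of l']
    have k1: "slice (fire ar w s) t \<bullet> slice w s = ?a \<star> gen h \<star> (?m \<star> gen g \<star> ?c)"
      using hor_ver[OF aid aid hor_hom[OF id_hom mh] hor_hom[OF h id_hom]] hor_slide(1)[OF h mh] ver_id[OF aid]
      by (simp add: s1 s3)
    have k2: "slice (fire ar w t') s' \<bullet> slice w t' = ?a \<star> gen h \<star> (?m \<star> gen g \<star> ?c)"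
      using hor_ver[OF aid aid hor_hom[OF h id_hom] hor_hom[OF id_hom mh]] hor_slide(2)[OF h mh] ver_id[OF aid]
      by (simp add: s2 s4)
    have sl: "slice (fire ar w s) t \<in> hom2 K (word (fire ar w s)) (word (fire ar (fire ar w s) t))"
      "slice (fire ar w t') s' \<in> hom2 K (word (fire ar w t')) (word (fire ar (fire ar w t') s'))"
      using slice_hom wf e2 by auto
    show ?thesis
      using e1 e2 f3 f4 k1 k2 ver_id(1)[OF sl(1)] ver_id(1)[OF sl(2)] by simp
  qed
qed

lemma pull_sound: "pull ar d s = Some (s', d') \<Longrightarrow> simulates (d @ [s]) (s' # d')"
proof (induction d arbitrary: s' d')
  case Nil
  then show ?case by (simp add: simulates_refl)
next
  case (Cons a d)
  then obtain u e a' where u: "pull ar d s = Some (u, e)" "commute ar a u = Some (s', a')" "d' = a' # e"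
    by (auto split: option.splits)
  have "simulates ((a # d) @ [s]) ([a] @ (u # e) @ [])"
    using simulates_append[OF Cons.IH[OF u(1)], of "[a]" "[]"] by simp
  moreover have "simulates ([] @ [a, u] @ e) ([] @ [s', a'] @ e)"
    by (rule simulates_append[OF commute_sound[OF u(2)]])
  ultimately have "simulates ((a # d) @ [s]) (s' # a' # e)" using simulates_trans[of "(a # d) @ [s]" "a # u #
      e"] by simp
  then show ?case using u(3) by simp
qed

lemma gather_sound:
  "gather ar ns k p g a d = Some (p', g', a') \<Longrightarrow> simulates (p @ g @ a @ d) (p' @ g' @ a')"
proof (induction d arbitrary: ns k p g a)
  case Nil
  then show ?case by (cases ns) (auto simp: simulates_refl)
next
  case (Cons s d)
  show ?case
  proof (cases ns)
    case Nil
    then show ?thesis using Cons.prems by (auto simp: simulates_refl)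
  next
    case ns: (Cons n ns')
    consider s' b where "k = n" "pull ar a s = Some (s', b)"
        "gather ar ns' (Suc k) p (g @ [s']) b d = Some (p', g', a')"
      | "pull ar (g @ a) s = None" "gather ar ns (Suc k) p g (a @ [s]) d = Some (p', g', a')"
      | s' e where "pull ar (g @ a) s = Some (s', e)"
        "gather ar ns (Suc k) (p @ [s']) (take (length g) e) (drop (length g) e) d = Some (p', g', a')"
      using Cons.prems by (auto simp: ns split: if_splits option.splits)
    then show ?thesis
    proof cases
      case 1
      have "simulates ((p @ g) @ (a @ [s]) @ d) ((p @ g) @ (s' # b) @ d)"
        by (rule simulates_append[OF pull_sound[OF 1(2)]])
      then have "simulates (p @ g @ a @ s # d) (p @ (g @ [s']) @ b @ d)" by simp
      then show ?thesis using Cons.IH[OF 1(3)] by (rule simulates_trans)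
    next
      case 2
      then show ?thesis using Cons.IH[OF 2(2)] by simp
    next
      case 3
      have "simulates (p @ ((g @ a) @ [s]) @ d) (p @ (s' # e) @ d)"
        by (rule simulates_append[OF pull_sound[OF 3(1)]])
      \<comment> \<open>The place where \<open>e\<close> is split is irrelevant for soundness, since
        only the concatenation is interpreted.\<close>
      moreover have "(p @ [s']) @ take (length g) e @ drop (length g) e @ d = p @ (s' # e) @ d"
        by (simp add: append_assoc[of "take _ _", symmetric] del: append_assoc)
      ultimately have "simulates (p @ g @ a @ s # d) ((p @ [s']) @ take (length g) e @ drop (length g) e @ d)"
        by (simp only: append_assoc append_Cons append_Nil)
      then show ?thesis using Cons.IH[OF 3(2)] by (rule simulates_trans)
    qed
  qed
qed

lemma extractions_sound:
  "e \<in> set (extractions ar t a d) \<Longrightarrow> simulates (a @ d) (t # e)"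
proof (induction d arbitrary: a)
  case Nil
  then show ?case by simp
next
  case (Cons s d)
  have "(\<exists>b. pull ar a s = Some (t, b) \<and> e = b @ d) \<or> e \<in> set (extractions ar t (a @ [s]) d)"
    using Cons.prems by (cases "pull ar a s") (auto split: if_splits)
  then consider b where "pull ar a s = Some (t, b)" "e = b @ d"
    | "e \<in> set (extractions ar t (a @ [s]) d)" by blast
  then show ?case
  proof cases
    case 1
    then show ?thesis using simulates_append[OF pull_sound[OF 1(1)], of "[]" d] by simp
  next
    case 2
    then show ?thesis using Cons.IH[OF 2] by simp
  qed
qed

lemma interchange_eq_sound: "interchange_eq ar ds e \<Longrightarrow> \<exists>d\<in>set ds. simulates d e"
proof (induction e arbitrary: ds)
  case Nil
  then show ?case using simulates_refl by auto
next
  case (Cons t e)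
  then obtain d d' where d: "d \<in> set ds" "d' \<in> set (extractions ar t [] d)" "simulates d' e"
    by fastforce
  have "simulates d (t # d')" using extractions_sound[OF d(2)] by simp
  moreover have "simulates (t # d') (t # e)"
    using simulates_append[OF d(3), of "[t]" "[]"] by simp
  ultimately show ?case using d(1) simulates_trans by blast
qed

lemma interchange_eq_single: "interchange_eq ar [d] e \<Longrightarrow> simulates d e"
  using interchange_eq_sound[of "[d]"] by simp

lemma occurs_iff: "occurs u i w \<longleftrightarrow> (\<exists>l r. w = l @ u @ r \<and> length l = i)"
proof
  assume "occurs u i w"
  then have "w = take i w @ u @ drop (length u) (drop i w)" "length (take i w) = i"
    unfolding occurs_def by (metis append_take_drop_id) (use \<open>occurs u i w\<close> in \<open>simp add: occurs_def\<close>)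
  then show "\<exists>l r. w = l @ u @ r \<and> length l = i" by blast
qed (auto simp: occurs_def)

lemma rewrite_step_sound:
  assumes e: "holds e" and d: "wf_diagram ar w d" and rw: "rewrite_step ar w e ns i d = Some d'"
  shows "wf_diagram ar w d' \<and> target ar w d = target ar w d' \<and> evs w d = evs w d'"
proof -
  obtain s t where st: "e = (s, t)" by (cases e)
  obtain p g a where g: "gather ar ns 0 [] [] [] d = Some (p, g, a)"
    and occ: "occurs (dmw ar s) i (target ar w p)" and ieq: "interchange_eq ar [g] (slices ar i s)"
    and d': "d' = p @ slices ar i t @ a"
    using rw by (auto simp: st split: option.splits if_splits)
  obtain l r where lr: "target ar w p = l @ dmw ar s @ r" "length l = i"
    using occ by (auto simp: occurs_iff)
  note h = e[unfolded holds_def st, simplified]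
  have "simulates d (p @ g @ a)" using gather_sound[OF g] by simp
  moreover have "simulates (p @ g @ a) (p @ slices ar i s @ a)"
    by (rule simulates_append[OF interchange_eq_single[OF ieq]])
  ultimately have "simulates d (p @ slices ar i s @ a)" by (rule simulates_trans)
  then have 1: "wf_diagram ar w (p @ slices ar i s @ a)" "target ar w d = target ar w (p @ slices ar i s @ a)"
    "evs w d = evs w (p @ slices ar i s @ a)" using d by (auto simp: simulates_def)
  have s: "target ar (target ar w p) (slices ar i s) = l @ cdw ar s @ r"
    "evs (target ar w p) (slices ar i s) = \<iota> (word l) \<star> ev s \<star> \<iota> (word r)"
    using slices_wf[of ar s l i r] evs_slices[of s l i r] h lr by auto
  have t: "wf_diagram ar (target ar w p) (slices ar i t)"
    "target ar (target ar w p) (slices ar i t) = l @ cdw ar s @ r"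
    "evs (target ar w p) (slices ar i t) = \<iota> (word l) \<star> ev s \<star> \<iota> (word r)"
    using slices_wf[of ar t l i r] evs_slices[of t l i r] h lr by auto
  have 2: "wf_diagram ar w d'" using 1(1) s t by (simp add: d' wf_append)
  show ?thesis
    using 1 2 s t by (simp add: d' wf_append target_append evs_append)
qed

lemma rewrite_steps_sound:
  assumes "\<And>e. e \<in> fst ` set rs \<Longrightarrow> holds e"
    and "wf_diagram ar w d" and "rewrite_steps ar w rs d = Some d'"
  shows "wf_diagram ar w d' \<and> target ar w d = target ar w d' \<and> evs w d = evs w d'"
  using assms
proof (induction rs arbitrary: d)
  case (Cons q rs)
  obtain r ns i where q: "q = (r, ns, i)" by (cases q)
  obtain e where e: "rewrite_step ar w r ns i d = Some e" "rewrite_steps ar w rs e = Some d'"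
    using Cons.prems(3) by (auto simp: q split: option.splits)
  have "holds r" using Cons.prems(1) by (simp add: q)
  from rewrite_step_sound[OF this Cons.prems(2) e(1)] Cons.IH[OF Cons.prems(1) _ e(2)]
  show ?case by simp
qed auto

text \<open>Reflection: in all applications the first premise is a closed term decided by
  evaluation, and only the validity of the laws that occur in the lists refers to the
  2-category.\<close>

theorem derivable_sound:
  assumes dv: "derivable ar rs rs' q" and laws: "\<forall>e \<in> fst ` set (rs @ rs'). holds e"
  shows "holds q"
proof -
  obtain s t where q: "q = (s, t)" by (cases q)
  obtain d e where d: "rewrite_steps ar (dmw ar s) rs (slices ar 0 s) = Some d"
    and e: "rewrite_steps ar (dmw ar s) rs' (slices ar 0 t) = Some e"
    and ieq: "interchange_eq ar [d] e" and ty: "typed ar s" "typed ar t" "dmw ar s = dmw ar t" "cdw ar s = cdw ar t"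
    using dv by (auto simp: q derivable_def split: option.splits)
  have flat: "wf_diagram ar (dmw ar u) (slices ar 0 u) \<and> evs (dmw ar u) (slices ar 0 u) = ev u"
    if "typed ar u" for u
    using slices_wf[OF that, of "[]" 0 "[]"] evs_slices[OF that, of "[]" 0 "[]"] hor_Nil[OF ev_hom[OF that]]
      hor_Nil(1)[OF hor_hom[OF ev_hom[OF that] id_hom[of "[]"]]] by simp
  have h: "\<And>e. e \<in> fst ` set rs \<Longrightarrow> holds e" "\<And>e. e \<in> fst ` set rs' \<Longrightarrow> holds e"
    using laws by (simp_all only: set_append image_Un ball_Un)
  have "evs (dmw ar s) (slices ar 0 s) = evs (dmw ar s) d \<and> wf_diagram ar (dmw ar s) d"
    using rewrite_steps_sound[OF h(1) conjunct1[OF flat[OF ty(1)]] d] flat[OF ty(1)] by simp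
  moreover have "evs (dmw ar s) (slices ar 0 t) = evs (dmw ar s) e"
    using rewrite_steps_sound[OF h(2) _ e] flat[OF ty(2)] ty(3) by simp
  moreover have "simulates d e" by (rule interchange_eq_single[OF ieq])
  ultimately show ?thesis using flat[OF ty(1)] flat[OF ty(2)] ty by (simp add: simulates_def q holds_def)
qed

lemma holds_swap: "holds (prod.swap e) = holds e"
  by (cases e) (auto simp: holds_def)

end

section \<open>Diagrams for comodule monads over quasi-bimonads\<close>

text \<open>The wires \<open>Mw n\<close> stand for left and \<open>Rw n\<close> for right Tambara modules, with \<open>Mw 0\<close> for \<open>F\<close>
  itself, so that \<open>Act 0\<close> is \<open>\<mu>\<close>, \<open>Crf 0\<close> is \<open>\<tau>\<close> and \<open>Crb 0\<close> is \<open>\<tau>\<^bsub>B,F\<^esub>\<close>. \<open>Ph\<close> and \<open>Phi\<close> are \<open>\<Phi>\<close> and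
  its inverse, \<open>El 0\<close> is \<open>\<Phi>\<^sub>\<lambda>\<close>, the other \<open>El n\<close> and \<open>Inv\<close> are arbitrary 2-cells, and \<open>LMor n\<close> and
  \<open>RMor n\<close> are morphisms from module \<open>n\<close> to module \<open>n + 4\<close>.\<close>

datatype wire = Bw | Mw nat | Rw nat

abbreviation "Fw \<equiv> Mw 0"

datatype generator = Act nat | Crf nat | Crb nat | Eta | Del | Cou | Ph | Phi
  | MuB | EtaB | Lam | El nat | Inv | LMor nat | RAct nat | Sig nat | RMor nat

type_synonym diag = "(wire, generator) tm"

declare [[coercion_enabled]]
declare [[coercion "Gen :: generator \<Rightarrow> diag"]]
declare [[coercion "\<lambda>w :: wire list. (Wire w :: diag)"]]

fun arity :: "(wire, generator) arity" where
  "arity (Act n) = ([Fw, Mw n], [Mw n])"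
| "arity (Crf n) = ([Fw, Mw n], [Mw n, Fw])"
| "arity (Crb n) = ([Bw, Mw n], [Mw n, Bw])"
| "arity Eta = ([], [Fw])"
| "arity Del = ([Fw], [Fw, Fw])"
| "arity Cou = ([Fw], [])"
| "arity Ph = ([], [Fw, Fw, Fw])"
| "arity Phi = ([], [Fw, Fw, Fw])"
| "arity MuB = ([Bw, Bw], [Bw])"
| "arity EtaB = ([], [Bw])"
| "arity Lam = ([Bw], [Fw, Bw])"
| "arity (El n) = ([], [Fw, Fw, Bw])"
| "arity Inv = ([Fw, Fw], [Fw, Fw, Bw])"
| "arity (LMor n) = ([Mw n], [Mw (n + 4)])"
| "arity (RAct n) = ([Rw n, Fw], [Rw n])"
| "arity (Sig n) = ([Rw n, Fw], [Fw, Rw n])"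
| "arity (RMor n) = ([Rw n], [Rw (n + 4)])"

abbreviation diag_equation :: "diag \<Rightarrow> diag \<Rightarrow> (wire, generator) equation" (infix "\<doteq>" 55) where
  "s \<doteq> t \<equiv> (s, t)"

abbreviation swap :: "(wire, generator) equation \<Rightarrow> (wire, generator) equation" where
  "swap \<equiv> prod.swap"

definition "prodFFF = (Act 0 \<otimes> Act 0 \<otimes> Act 0 \<odot> [Fw] \<otimes> Crf 0 \<otimes> Crf 0 \<otimes> [Fw] \<odot> [Fw, Fw] \<otimes> Crf 0 \<otimes> [Fw, Fw] :: diag)"

definition "prodFFB = (Act 0 \<otimes> Act 0 \<otimes> MuB \<odot> [Fw] \<otimes> Crf 0 \<otimes> Crb 0 \<otimes> [Bw] \<odot> [Fw, Fw] \<otimes> Crb 0 \<otimes> [Fw] \<otimes> [Bw] :: diag)"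

definition "psiF = (Act 0 \<otimes> [Bw] \<odot> [Fw] \<otimes> Crb 0 \<odot> Lam \<otimes> [Fw] :: diag)"

section \<open>The axioms as equations between diagrams\<close>

definition "mod_assoc n = (Act n \<odot> Act 0 \<otimes> [Mw n] \<doteq> Act n \<odot> [Fw] \<otimes> Act n)"
definition "mod_unit n = (Act n \<odot> Eta \<otimes> [Mw n] \<doteq> [Mw n])"
definition "mul_unit = (Act 0 \<odot> [Fw] \<otimes> Eta \<doteq> [Fw])"
definition "crf_mul n = (Crf n \<odot> Act 0 \<otimes> [Mw n] \<doteq> [Mw n] \<otimes> Act 0 \<odot> Crf n \<otimes> [Fw] \<odot> [Fw] \<otimes> Crf n)"
definition "crf_eta n = (Crf n \<odot> Eta \<otimes> [Mw n] \<doteq> [Mw n] \<otimes> Eta)"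
definition "crf_del n = ([Mw n] \<otimes> Del \<odot> Crf n \<doteq> Crf n \<otimes> [Fw] \<odot> [Fw] \<otimes> Crf n \<odot> Del \<otimes> [Mw n])"
definition "crf_eps n = ([Mw n] \<otimes> Cou \<odot> Crf n \<doteq> Cou \<otimes> [Mw n])"
definition "ph_mod n = ([Mw n] \<otimes> Ph \<doteq> Crf n \<otimes> [Fw, Fw] \<odot> [Fw] \<otimes> Crf n \<otimes> [Fw] \<odot> [Fw, Fw] \<otimes> Crf n \<odot> Ph \<otimes> [Mw n])"
definition "crf_yb n = ([Mw n] \<otimes> Crf 0 \<odot> Crf n \<otimes> [Fw] \<odot> [Fw] \<otimes> Crf n \<doteq> Crf n \<otimes> [Fw] \<odot> [Fw] \<otimes> Crf n \<odot> Crf 0 \<otimes> [Mw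
     n])"
definition "crf_act n = (Crf n \<odot> [Fw] \<otimes> Act n \<doteq> Act n \<otimes> [Fw] \<odot> [Fw] \<otimes> Crf n \<odot> Crf 0 \<otimes> [Mw n])"
definition "tau_eta = (Crf 0 \<odot> [Fw] \<otimes> Eta \<doteq> Eta \<otimes> [Fw])"
definition "del_tau = (Del \<otimes> [Fw] \<odot> Crf 0 \<doteq> [Fw] \<otimes> Crf 0 \<odot> Crf 0 \<otimes> [Fw] \<odot> [Fw] \<otimes> Del)"
definition "del_mul = (Del \<odot> Act 0 \<doteq> Act 0 \<otimes> Act 0 \<odot> [Fw] \<otimes> Crf 0 \<otimes> [Fw] \<odot> Del \<otimes> Del)"
definition "del_eta = (Del \<odot> Eta \<doteq> Eta \<otimes> Eta)"
definition "eps_eta = (Cou \<odot> Eta \<doteq> Wire [])"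
definition "ph_inv_r = (prodFFF \<odot> Ph \<otimes> Phi \<doteq> Eta \<otimes> Eta \<otimes> Eta)"
definition "ph_inv_l = (prodFFF \<odot> Phi \<otimes> Ph \<doteq> Eta \<otimes> Eta \<otimes> Eta)"
definition "ph_counit = ([Fw] \<otimes> Cou \<otimes> [Fw] \<odot> Ph \<doteq> Eta \<otimes> Eta)"
definition "ph_cocycle = ([Fw] \<otimes> Act 0 \<otimes> Act 0 \<otimes> [Fw] \<odot> [Fw, Fw] \<otimes> Crf 0 \<otimes> [Fw, Fw] \<odot> [Fw] \<otimes> Act 0 \<otimes> Act 0 \<otimes>
     [Fw] \<otimes> Crf 0 \<odot> [Fw, Fw] \<otimes> Crf 0 \<otimes> [Fw] \<otimes> Crf 0 \<otimes> [Fw] \<odot> [Fw, Fw, Fw] \<otimes> Del \<otimes> Act 0 \<otimes> [Fw, Fw] \<odot> [Fw, Fw,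
     Fw] \<otimes> Crf 0 \<otimes> [Fw, Fw, Fw] \<odot> [Fw] \<otimes> Ph \<otimes> [Fw, Fw, Fw, Fw] \<odot> Act 0 \<otimes> [Fw, Fw, Fw, Fw] \<odot> [Fw] \<otimes> Crf 0 \<otimes> [Fw,
     Fw, Fw] \<odot> [Fw, Fw] \<otimes> Crf 0 \<otimes> [Fw, Fw] \<odot> Ph \<otimes> Ph \<doteq> Act 0 \<otimes> Act 0 \<otimes> Act 0 \<otimes> Act 0 \<odot> [Fw] \<otimes> Crf 0 \<otimes> [Fw, Fw] \<otimes>
     Crf 0 \<otimes> [Fw] \<odot> [Fw, Fw] \<otimes> Del \<otimes> Del \<otimes> [Fw, Fw] \<odot> [Fw, Fw] \<otimes> Crf 0 \<otimes> [Fw, Fw] \<odot> Ph \<otimes> Ph)"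
definition "bassoc = (MuB \<odot> MuB \<otimes> [Bw] \<doteq> MuB \<odot> [Bw] \<otimes> MuB)"
definition "bunit_l = (MuB \<odot> EtaB \<otimes> [Bw] \<doteq> [Bw])"
definition "bunit_r = (MuB \<odot> [Bw] \<otimes> EtaB \<doteq> [Bw])"
definition "crb_mul n = (Crb n \<odot> MuB \<otimes> [Mw n] \<doteq> [Mw n] \<otimes> MuB \<odot> Crb n \<otimes> [Bw] \<odot> [Bw] \<otimes> Crb n)"
definition "crb_unit n = (Crb n \<odot> EtaB \<otimes> [Mw n] \<doteq> [Mw n] \<otimes> EtaB)"
definition "crb_act n = (Crb n \<odot> [Bw] \<otimes> Act n \<doteq> Act n \<otimes> [Bw] \<odot> [Fw] \<otimes> Crb n \<odot> Crb 0 \<otimes> [Mw n])"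
definition "lam_crb n = ([Mw n] \<otimes> Lam \<odot> Crb n \<doteq> Crf n \<otimes> [Bw] \<odot> [Fw] \<otimes> Crb n \<odot> Lam \<otimes> [Mw n])"
definition "crb_yb n = ([Mw n] \<otimes> Crb 0 \<odot> Crb n \<otimes> [Fw] \<odot> [Bw] \<otimes> Crf n \<doteq> Crf n \<otimes> [Bw] \<odot> [Fw] \<otimes> Crb n \<odot> Crb 0 \<otimes> [Mw
     n])"
definition "lam_unit = (Lam \<odot> EtaB \<doteq> Eta \<otimes> EtaB)"
definition "lam_counit = (Cou \<otimes> [Bw] \<odot> Lam \<doteq> [Bw])"
definition "ph_b = (Ph \<otimes> [Bw] \<doteq> [Fw, Fw] \<otimes> Crb 0 \<odot> [Fw] \<otimes> Crb 0 \<otimes> [Fw] \<odot> Crb 0 \<otimes> [Fw, Fw] \<odot> [Bw] \<otimes> Ph)"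
definition "transport n = ([Mw n] \<otimes> El 0 \<doteq> Crf n \<otimes> [Fw, Bw] \<odot> [Fw] \<otimes> Crf n \<otimes> [Bw] \<odot> [Fw, Fw] \<otimes> Crb n \<odot> El 0 \<otimes>
     [Mw n])"
definition "crb_eps = (Cou \<otimes> [Bw] \<odot> Crb 0 \<doteq> [Bw] \<otimes> Cou)"
definition "crb_eta = (Crb 0 \<odot> [Bw] \<otimes> Eta \<doteq> Eta \<otimes> [Bw])"
definition "crb_del = (Del \<otimes> [Bw] \<odot> Crb 0 \<doteq> [Fw] \<otimes> Crb 0 \<odot> Crb 0 \<otimes> [Fw] \<odot> [Bw] \<otimes> Del)"
definition "lmor_act n = (LMor n \<odot> Act n \<doteq> Act (n + 4) \<odot> [Fw] \<otimes> LMor n)"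
definition "lmor_b n = (LMor n \<otimes> [Bw] \<odot> Crb n \<doteq> Crb (n + 4) \<odot> [Bw] \<otimes> LMor n)"
definition "lmor_f n = (LMor n \<otimes> [Fw] \<odot> Crf n \<doteq> Crf (n + 4) \<odot> [Fw] \<otimes> LMor n)"
definition "rassoc n = (RAct n \<odot> [Rw n] \<otimes> Act 0 \<doteq> RAct n \<odot> RAct n \<otimes> [Fw])"
definition "runit n = (RAct n \<odot> [Rw n] \<otimes> Eta \<doteq> [Rw n])"
definition "sig_mul n = (Sig n \<odot> [Rw n] \<otimes> Act 0 \<doteq> Act 0 \<otimes> [Rw n] \<odot> [Fw] \<otimes> Sig n \<odot> Sig n \<otimes> [Fw])"
definition "sig_eta n = (Sig n \<odot> [Rw n] \<otimes> Eta \<doteq> Eta \<otimes> [Rw n])"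
definition "sig_del n = (Del \<otimes> [Rw n] \<odot> Sig n \<doteq> [Fw] \<otimes> Sig n \<odot> Sig n \<otimes> [Fw] \<odot> [Rw n] \<otimes> Del)"
definition "ph_r n = (Ph \<otimes> [Rw n] \<doteq> [Fw, Fw] \<otimes> Sig n \<odot> [Fw] \<otimes> Sig n \<otimes> [Fw] \<odot> Sig n \<otimes> [Fw, Fw] \<odot> [Rw n] \<otimes> Ph)"
definition "sig_yb n = (Crf 0 \<otimes> [Rw n] \<odot> [Fw] \<otimes> Sig n \<odot> Sig n \<otimes> [Fw] \<doteq> [Fw] \<otimes> Sig n \<odot> Sig n \<otimes> [Fw] \<odot> [Rw n] \<otimes>
     Crf 0)"
definition "sig_act n = (Sig n \<odot> RAct n \<otimes> [Fw] \<doteq> [Fw] \<otimes> RAct n \<odot> Sig n \<otimes> [Fw] \<odot> [Rw n] \<otimes> Crf 0)"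
definition "rmor_act n = (RMor n \<odot> RAct n \<doteq> RAct (n + 4) \<odot> RMor n \<otimes> [Fw])"
definition "rmor_sig n = ([Fw] \<otimes> RMor n \<odot> Sig n \<doteq> Sig (n + 4) \<odot> RMor n \<otimes> [Fw])"


section \<open>Symbolic modules and the operators defined by elements\<close>

datatype lstructure = LStructure (lword: "wire list") (ltauB: diag) (ltauF: diag) (lact: diag)
datatype rstructure = RStructure (rword: "wire list") (rsig: diag) (raction: diag)

text \<open>Tensor products are composite diagrams instead of further generators, so that an
  operator at a tensor product unfolds into the generators of its factors and the same laws
  apply.\<close>

definition ltensor :: "lstructure \<Rightarrow> lstructure \<Rightarrow> lstructure" where
  "ltensor X Y = LStructure (lword X @ lword Y)
     (Wire (lword X) \<otimes> ltauB Y \<odot> ltauB X \<otimes> Wire (lword Y))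
     (Wire (lword X) \<otimes> ltauF Y \<odot> ltauF X \<otimes> Wire (lword Y))
     (lact X \<otimes> lact Y \<odot> [Fw] \<otimes> ltauF X \<otimes> Wire (lword Y) \<odot> Del \<otimes> Wire (lword X @ lword Y))"

definition rtensor :: "rstructure \<Rightarrow> rstructure \<Rightarrow> rstructure" where
  "rtensor X Y = RStructure (rword X @ rword Y)
     (rsig X \<otimes> Wire (rword Y) \<odot> Wire (rword X) \<otimes> rsig Y)
     (raction X \<otimes> raction Y \<odot> Wire (rword X) \<otimes> rsig Y \<otimes> [Fw] \<odot> Wire (rword X @ rword Y) \<otimes> Del)"

definition "lunit = LStructure [] [Bw] [Fw] Cou"
definition "lmod n = LStructure [Mw n] (Crb n) (Crf n) (Act n)"
definition "rmod n = RStructure [Rw n] (Sig n) (RAct n)"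

text \<open>The axiom relating the action to the crossing with B, for the object FF. Its action
  contains \<open>Del\<close>, which is how compatibility of \<open>Crb 0\<close> with
  \<open>Del\<close> becomes accessible.\<close>

definition "crb_act_tensor = (let X = ltensor (lmod 0) (lmod 0) in
  (ltauB X \<odot> [Bw] \<otimes> lact X \<doteq> lact X \<otimes> [Bw] \<odot> [Fw] \<otimes> ltauB X \<odot> Crb 0 \<otimes> [Fw, Fw]))"

definition alphaD :: "lstructure \<Rightarrow> lstructure \<Rightarrow> lstructure \<Rightarrow> diag" where
  "alphaD X Y Z = (lact X \<otimes> lact Y \<otimes> lact Z
     \<odot> [Fw] \<otimes> ltauF X \<otimes> ltauF Y \<otimes> Wire (lword Z)
     \<odot> [Fw, Fw] \<otimes> ltauF X \<otimes> Wire (lword Y @ lword Z)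
     \<odot> Ph \<otimes> Wire (lword X @ lword Y @ lword Z))"

definition psiD :: "lstructure \<Rightarrow> diag" where
  "psiD X = (lact X \<otimes> [Bw] \<odot> [Fw] \<otimes> ltauB X \<odot> Lam \<otimes> Wire (lword X))"

definition actB1 :: "diag \<Rightarrow> lstructure \<Rightarrow> diag" where
  "actB1 u X = (lact X \<otimes> [Bw] \<odot> [Fw] \<otimes> ltauB X \<odot> u \<otimes> Wire (lword X))"

text \<open>The diagram \<open>u\<close> may start at B as well as at the identity:
  \<open>linsource\<close> and \<open>lintarget\<close> are 2-cells from B to FFB, and linearity
  compares the operators they define.\<close>

definition rhoD :: "diag \<Rightarrow> lstructure \<Rightarrow> lstructure \<Rightarrow> diag" where
  "rhoD u X Y = (lact X \<otimes> lact Y \<otimes> [Bw] \<odot> [Fw] \<otimes> ltauF X \<otimes> ltauB Y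
     \<odot> [Fw] \<otimes> [Fw] \<otimes> ltauB X \<otimes> Wire (lword Y) \<odot> u \<otimes> Wire (lword X) \<otimes> Wire (lword Y))"

text \<open>The threefold analogue of \<open>rhoD\<close>, for elements of FFFB;
  \<open>actB1\<close> is the onefold one, and \<open>ract4\<close> plays this part for right
  actions and elements of FFFF.\<close>

definition actB3 :: "diag \<Rightarrow> lstructure \<Rightarrow> lstructure \<Rightarrow> lstructure \<Rightarrow> diag" where
  "actB3 u X Y Z = (lact X \<otimes> lact Y \<otimes> lact Z \<otimes> [Bw] \<odot> [Fw] \<otimes> ltauF X \<otimes> ltauF Y \<otimes> ltauB Z
     \<odot> [Fw, Fw] \<otimes> ltauF X \<otimes> ltauB Y \<otimes> Wire (lword Z) \<odot> [Fw, Fw, Fw] \<otimes> ltauB X \<otimes> Wire (lword Y @ lword Z)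
     \<odot> u \<otimes> Wire (lword X @ lword Y @ lword Z))"

definition ractD :: "diag \<Rightarrow> rstructure \<Rightarrow> rstructure \<Rightarrow> rstructure \<Rightarrow> diag" where
  "ractD p X Y Z = ((raction X \<otimes> raction Y \<otimes> raction Z \<odot> Wire (rword X) \<otimes> rsig Y \<otimes> rsig Z \<otimes> [Fw]
     \<odot> Wire (rword X @ rword Y) \<otimes> rsig Z \<otimes> [Fw, Fw]) \<odot> Wire (rword X) \<otimes> Wire (rword Y) \<otimes> Wire (rword Z) \<otimes> p)"

definition ract4 :: "diag \<Rightarrow> rstructure \<Rightarrow> rstructure \<Rightarrow> rstructure \<Rightarrow> rstructure \<Rightarrow> diag" where
  "ract4 p X Y Z W = (raction X \<otimes> raction Y \<otimes> raction Z \<otimes> raction W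
     \<odot> Wire (rword X) \<otimes> rsig Y \<otimes> rsig Z \<otimes> rsig W \<otimes> [Fw]
     \<odot> Wire (rword X @ rword Y) \<otimes> rsig Z \<otimes> rsig W \<otimes> [Fw, Fw]
     \<odot> Wire (rword X @ rword Y @ rword Z) \<otimes> rsig W \<otimes> [Fw, Fw, Fw]
     \<odot> Wire (rword X @ rword Y @ rword Z @ rword W) \<otimes> p)"

definition conv :: "diag \<Rightarrow> diag \<Rightarrow> diag" where
  "conv u v = (prodFFB \<odot> u \<otimes> v)"

text \<open>The Kleisli extension of a 2-cell from FF to FFB, with respect to multiplication in B.
  Applied to \<open>rhoD u\<close> at F, F it becomes left convolution by \<open>u\<close>.\<close>

definition leftmult :: "diag \<Rightarrow> diag" where
  "leftmult u = ([Fw, Fw] \<otimes> MuB \<odot> u \<otimes> [Bw])"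

definition "oneFFB = (Eta \<otimes> Eta \<otimes> EtaB :: diag)"

definition "deltaM = (Act 0 \<otimes> Act 0 \<otimes> [Bw] \<odot> [Fw] \<otimes> Crf 0 \<otimes> [Fw] \<otimes> [Bw]
  \<odot> [Fw] \<otimes> [Fw] \<otimes> Del \<otimes> [Bw] \<odot> [Fw] \<otimes> [Fw] \<otimes> Crb 0 \<odot> El 0 \<otimes> [Fw] :: diag)"

definition "epsM = (EtaB \<odot> Cou :: diag)"

definition "linsource = conv (El 0) (Del \<otimes> [Bw] \<odot> Lam)"
definition "lintarget = conv ([Fw] \<otimes> Lam \<odot> Lam) (El 0)"

definition rightmult :: "diag \<Rightarrow> diag" where
  "rightmult p = (prodFFF \<odot> [Fw] \<otimes> [Fw] \<otimes> [Fw] \<otimes> p)"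

text \<open>The two sides of the pentagon of the datum with \<beta> taken out. The datum requires
  that \<open>rightmult Phi\<close> sends \<open>cocR\<close> to \<open>cocL\<close>, while the
  condition on \<rho> says that \<open>rightmult Ph\<close> sends \<open>cocL\<close> to
  \<open>cocR\<close>.\<close>

definition "cocL = ([Fw, Fw, Fw] \<otimes> MuB \<odot> [Fw] \<otimes> deltaM \<otimes> [Bw] \<odot> El 0 :: diag)"
definition "cocR = ([Fw, Fw, Fw] \<otimes> MuB \<odot> [Fw, Fw] \<otimes> psiF \<otimes> [Bw] \<odot> deltaM \<otimes> [Fw] \<otimes> [Bw] \<odot> El 0 :: diag)"

definition "couL = (Cou \<otimes> [Fw] \<otimes> [Bw] \<odot> El 0 :: diag)"
definition "couR = ([Fw] \<otimes> Cou \<otimes> [Bw] \<odot> El 0 :: diag)"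

text \<open>Compatibility of \<open>Crb 0\<close> with \<open>Eta\<close> and \<open>Del\<close> is
  absent from the list because it is derived from it in \<open>crb_eta\<close> and
  \<open>crb_del\<close>.\<close>

locale comodule_diagrams = typed_diagrams K \<A> arity cel gen
  for K :: "('o, 'm, 'c) two_cat" (structure) and \<A> cel gen +
  assumes laws:
    "holds (mod_assoc n)" "holds (mod_unit n)" "holds mul_unit" "holds (crf_mul n)" "holds
      (crf_eta n)" "holds (crf_del n)" "holds (crf_eps n)" "holds (ph_mod n)" "holds (crf_yb
      n)" "holds (crf_act n)" "holds tau_eta" "holds del_tau" "holds del_mul" "holds
      del_eta" "holds eps_eta" "holds ph_inv_r" "holds ph_inv_l" "holds ph_counit" "holds
      ph_cocycle" "holds bassoc" "holds bunit_l" "holds bunit_r" "holds (crb_mul n)" "holds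
      (crb_unit n)" "holds (crb_act n)" "holds (lam_crb n)" "holds (crb_yb n)" "holds
      lam_unit" "holds lam_counit" "holds ph_b" "holds (transport n)" "holds crb_eps" "holds
      (lmor_act n)" "holds (lmor_b n)" "holds (lmor_f n)" "holds (rassoc n)" "holds (runit
      n)" "holds (sig_mul n)" "holds (sig_eta n)" "holds (sig_del n)" "holds (ph_r n)"
      "holds (sig_yb n)" "holds (sig_act n)" "holds (rmor_act n)" "holds (rmor_sig n)"
      "holds crb_act_tensor"
begin

lemma ev_eq: "holds (s \<doteq> t) \<Longrightarrow> ev s = ev t"
  by (simp add: holds_def)

text \<open>Moving \<open>\<Phi>\<close> across \<open>B\<close> and applying \<open>\<epsilon>\<close> to its middle leg shows that the unit of \<open>F\<close>, used
  twice, can be moved across \<open>B\<close>; applying \<open>\<epsilon>\<close> again removes one of the two.\<close>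

lemma crb_eta: "holds crb_eta"
proof -
  have 1: "holds ([Fw] \<otimes> Cou \<otimes> [Fw] \<otimes> [Bw] \<odot> Ph \<otimes> [Bw] \<doteq> [Fw] \<otimes> Crb 0 \<odot> Crb 0 \<otimes> [Fw] \<odot> [Bw] \<otimes> Eta \<otimes> Eta)"
    by (rule derivable_sound[of "[(ph_b, [0], 0), (crb_eps, [2, 4], 1), (ph_counit, [0, 2], 1)]" "[]"], code_simp,
      simp add: laws)
  have 2: "holds ([Fw] \<otimes> Cou \<otimes> [Fw] \<otimes> [Bw] \<odot> Ph \<otimes> [Bw] \<doteq> Eta \<otimes> Eta \<otimes> [Bw])"
    by (rule derivable_sound[of "[(ph_counit, [0, 1], 0)]" "[]"], code_simp, simp add: laws)
  have 3: "holds (Crb 0 \<odot> [Bw] \<otimes> Eta \<doteq> [Fw] \<otimes> Cou \<otimes> [Bw] \<odot> ([Fw] \<otimes> Crb 0 \<odot> Crb 0 \<otimes> [Fw] \<odot> [Bw] \<otimes> Eta \<otimes> Eta))"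
    by (rule derivable_sound[of "[]" "[(crb_eps, [3, 4], 1), (eps_eta, [1, 3], 2)]"], code_simp, simp add: laws)
  have 4: "holds ([Fw] \<otimes> Cou \<otimes> [Bw] \<odot> Eta \<otimes> Eta \<otimes> [Bw] \<doteq> Eta \<otimes> [Bw])"
    by (rule derivable_sound[of "[(eps_eta, [1, 2], 1)]" "[]"], code_simp, simp add: laws)
  have "ev (Crb 0 \<odot> [Bw] \<otimes> Eta) = ev (Eta \<otimes> [Bw])"
    using ev_eq[OF 1] ev_eq[OF 2] ev_eq[OF 3] ev_eq[OF 4] by simp
  then show ?thesis by (simp add: holds_def crb_eta_def)
qed

text \<open>The action of \<open>F\<close> on the tensor square of \<open>F\<close> restricts to \<open>\<Delta>\<close> on \<open>F \<times> \<eta> \<times> \<eta>\<close>.\<close>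

lemma crb_del: "holds crb_del"
proof -
  let ?X = "ltensor (lmod 0) (lmod 0)"
  have 1: "holds ((ltauB ?X \<odot> [Bw] \<otimes> lact ?X) \<odot> [Bw] \<otimes> [Fw] \<otimes> Eta \<otimes> Eta \<doteq> [Fw] \<otimes> Crb 0 \<odot> Crb 0 \<otimes> [Fw] \<odot> [Bw] \<otimes> Del)"
    by (rule derivable_sound[of "[(mul_unit, [1, 5], 2), (tau_eta, [0, 2], 2), (mul_unit, [1, 2], 1)]" "[]"],
      code_simp, simp add: laws crb_eta holds_swap)
  have 2: "holds ((lact ?X \<otimes> [Bw] \<odot> [Fw] \<otimes> ltauB ?X \<odot> Crb 0 \<otimes> [Fw, Fw]) \<odot> [Bw] \<otimes> [Fw] \<otimes> Eta \<otimes> Eta \<doteq> Del \<otimes> [Bw]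
      \<odot> Crb 0)"
    by (rule derivable_sound[of "[(crb_eta, [0, 3], 1), (tau_eta, [2, 5], 1), (mul_unit, [4, 5], 0), (crb_eta, [0,
      2], 1), (mul_unit, [1, 3], 1)]" "[]"], code_simp, simp add: laws crb_eta holds_swap)
  have "holds crb_act_tensor" using laws by simp
  then have "ev (ltauB ?X \<odot> [Bw] \<otimes> lact ?X) = ev (lact ?X \<otimes> [Bw] \<odot> [Fw] \<otimes> ltauB ?X \<odot> Crb 0 \<otimes> [Fw, Fw])"
    unfolding crb_act_tensor_def Let_def by (rule ev_eq)
  then have "ev ([Fw] \<otimes> Crb 0 \<odot> Crb 0 \<otimes> [Fw] \<odot> [Bw] \<otimes> Del) = ev (Del \<otimes> [Bw] \<odot> Crb 0)"
    using ev_eq[OF 1] ev_eq[OF 2] by (simp only: ev.simps)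
  then show ?thesis by (simp add: holds_def crb_del_def)
qed

section \<open>Convolution of elements and composition of operators\<close>

lemmas all_laws = laws crb_eta crb_del holds_swap

text \<open>Moving the second factor's actions past the crossings of the first turns these crossings
  into those of \<open>prodFFB\<close>; \<open>mod_assoc\<close> then merges the actions. So
  convolution becomes Kleisli composition of operators.\<close>

lemma rho_conv: "holds (Wire [Mw 1, Mw 2] \<otimes> MuB \<odot> rhoD (El 1) (lmod 1) (lmod 2) \<otimes> [Bw] \<odot> rhoD (El 2) (lmod 1)
    (lmod 2)
    \<doteq> rhoD (conv (El 1) (El 2)) (lmod 1) (lmod 2))"
  by (rule derivable_sound[of "[(crb_act 1, [4, 7], 2), (crf_act 1, [8, 9], 1), (crb_act 2, [4, 11], 3), (crb_yb
      1, [2, 6, 10], 3)]" "[(mod_assoc 1, [5, 11], 0), (crf_mul 1, [5, 8], 2), (mod_assoc 2, [9, 13], 1),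
      (crb_mul 1, [5, 6], 4), (crb_mul 2, [7, 10], 5)]"], code_simp, simp add: all_laws)

lemma rho_one: "holds (rhoD oneFFB (lmod 1) (lmod 2) \<doteq> [Mw 1, Mw 2] \<otimes> EtaB)"
  by (rule derivable_sound[of "[(mod_unit 1, [0, 6], 0), (crf_eta 1, [0, 3], 0), (mod_unit 2, [2, 4], 1),
      (crb_unit 1, [0, 1], 0), (crb_unit 2, [0, 1], 1)]" "[]"], code_simp, simp add: all_laws)

text \<open>At F the action is \<mu> and the crossings are those of \<open>prodFFB\<close>: both
  sides are the same diagram up to interchange, hence the empty lists.\<close>

lemma conv_leftmult: "holds (conv (El 1) (El 2) \<doteq> leftmult (rhoD (El 1) (lmod 0) (lmod 0)) \<odot> El 2)"
  by (rule derivable_sound[of "[]" "[]"], code_simp, simp add: all_laws)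

text \<open>\<open>rho_conv\<close> at F followed by one more multiplication in B. Together with
  \<open>conv_leftmult\<close> this is associativity of convolution.\<close>

lemma leftmult_conv: "holds (leftmult (rhoD (El 1) (lmod 0) (lmod 0)) \<odot> leftmult (rhoD (El 2) (lmod 0) (lmod
    0)) \<odot> El 3
    \<doteq> leftmult (rhoD (conv (El 1) (El 2)) (lmod 0) (lmod 0)) \<odot> El 3)"
  by (rule derivable_sound[of "[(crb_act 0, [5, 9], 2), (crf_act 0, [10, 11], 1), (crb_act 0, [5, 13], 3),
      (crb_yb 0, [3, 8, 12], 3)]" "[(mod_assoc 0, [6, 12], 0), (crf_mul 0, [6, 9], 2), (mod_assoc 0, [10, 14],
      1), (crb_mul 0, [6, 7], 4), (crb_mul 0, [8, 11], 5), (bassoc, [12, 17], 2)]"], code_simp, simp add: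
      all_laws)

lemma leftmult_one: "holds (leftmult (rhoD oneFFB (lmod 0) (lmod 0)) \<odot> El 1 \<doteq> El 1)"
  by (rule derivable_sound[of "[(mod_unit 0, [1, 7], 0), (crf_eta 0, [1, 4], 0), (mod_unit 0, [3, 5], 1),
      (crb_unit 0, [1, 2], 0), (crb_unit 0, [1, 2], 1), (bunit_l, [1, 2], 2)]" "[]"], code_simp, simp add:
      all_laws)

lemma leftmult_one_right: "holds (leftmult (rhoD (El 1) (lmod 0) (lmod 0)) \<odot> oneFFB \<doteq> El 1)"
  by (rule derivable_sound[of "[(bunit_r, [2, 9], 2), (crb_eta, [0, 3], 2), (tau_eta, [2, 3], 1), (mul_unit, [2,
      4], 0), (crb_eta, [0, 2], 2), (mul_unit, [1, 2], 1)]" "[]"], code_simp, simp add: all_laws)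

text \<open>Only associativity of \<open>MuB\<close> enters, so the statement is available for an
  arbitrary 2-cell \<open>Inv\<close> that need not come from an element.\<close>

lemma leftmult_Inv: "holds (leftmult Inv \<odot> leftmult (rhoD (El 1) (lmod 0) (lmod 0)) \<odot> El 2
    \<doteq> leftmult ([Fw, Fw] \<otimes> MuB \<odot> Inv \<otimes> [Bw] \<odot> rhoD (El 1) (lmod 0) (lmod 0)) \<odot> El 2)"
  by (rule derivable_sound[of "[]" "[(bassoc, [8, 9], 2)]"], code_simp, simp add: all_laws)

lemma leftmult_Inv_right: "holds (leftmult (rhoD (El 1) (lmod 0) (lmod 0)) \<odot> Inv \<odot> Eta \<otimes> Eta
    \<doteq> ([Fw, Fw] \<otimes> MuB \<odot> rhoD (El 1) (lmod 0) (lmod 0) \<otimes> [Bw] \<odot> Inv) \<odot> Eta \<otimes> Eta)"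
  by (rule derivable_sound[of "[]" "[]"], code_simp, simp add: all_laws)

lemma leftmult_unit: "holds (leftmult ([Fw, Fw] \<otimes> EtaB) \<odot> El 1 \<doteq> El 1)"
  by (rule derivable_sound[of "[(bunit_l, [1, 2], 2)]" "[]"], code_simp, simp add: all_laws)

lemma unit_Eta_Eta: "holds ([Fw, Fw] \<otimes> EtaB \<odot> Eta \<otimes> Eta \<doteq> oneFFB)"
  by (rule derivable_sound[of "[]" "[]"], code_simp, simp add: all_laws)

section \<open>Naturality and linearity\<close>

lemma rho_natural: "holds (LMor 1 \<otimes> LMor 2 \<otimes> [Bw] \<odot> rhoD (El 0) (lmod 1) (lmod 2)
    \<doteq> rhoD (El 0) (lmod 5) (lmod 6) \<odot> LMor 1 \<otimes> LMor 2)"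
  by (rule derivable_sound[of "[(lmor_act 1, [4, 6], 0), (lmor_act 2, [4, 7], 1), (lmor_b 2, [3, 6], 2), (lmor_f
      1, [2, 3], 1), (lmor_b 1, [1, 2], 2)]" "[]"], code_simp, simp add: all_laws)

text \<open>The computation of \<open>rho_conv\<close> with
  \<open>(Del \<otimes> [Bw]) \<odot> Lam\<close> as second factor: the action on a tensor product
  contributes the \<open>Del\<close>, and \<psi> the \<open>Lam\<close>.\<close>

lemma linear_source: "holds ([Mw 1, Mw 2] \<otimes> MuB \<odot> rhoD (El 0) (lmod 1) (lmod 2) \<otimes> [Bw] \<odot> psiD (ltensor (lmod
    1) (lmod 2))
    \<doteq> rhoD linsource (lmod 1) (lmod 2))"
  by (rule derivable_sound[of "[(crb_act 1, [5, 8], 2), (crf_act 1, [9, 10], 1), (crb_act 2, [5, 12], 3),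
      (crb_yb 1, [4, 7, 11], 3)]" "[(mod_assoc 1, [6, 12], 0), (crf_mul 1, [6, 9], 2), (mod_assoc 2, [10, 14],
      1), (crb_mul 1, [6, 7], 4), (crb_mul 2, [8, 11], 5)]"], code_simp, simp add: all_laws)

text \<open>The coaction belonging to Y is applied to B after it has crossed X.
  \<open>lam_crb\<close> moves it in front of that crossing, where it stands directly behind the
  first coaction and gives \<open>[Fw] \<otimes> Lam \<odot> Lam\<close>.\<close>

lemma linear_target: "holds ([Mw 1, Mw 2] \<otimes> MuB
      \<odot> ([Mw 1] \<otimes> psiD (lmod 2) \<odot> psiD (lmod 1) \<otimes> [Mw 2]) \<otimes> [Bw] \<odot> [Bw] \<otimes> rhoD (El 0) (lmod 1) (lmod 2)
    \<doteq> rhoD lintarget (lmod 1) (lmod 2))"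
  by (rule derivable_sound[of "[(crb_act 1, [4, 7], 1), (crb_act 2, [4, 11], 2), (lam_crb 1, [6, 9], 2),
      (lam_crb 0, [5, 6], 1), (crb_yb 1, [2, 8, 12], 3)]" "[(mod_assoc 1, [6, 12], 0), (crf_mul 1, [6, 9], 2),
      (mod_assoc 2, [10, 14], 1), (crb_mul 1, [6, 7], 4), (crb_mul 2, [8, 11], 5)]"], code_simp, simp add:
      all_laws)

text \<open>\<open>deltaM\<close> splits F after it has passed B, \<open>linsource\<close> splits it
  before; \<open>crb_del\<close> exchanges the two.\<close>

lemma datum_linear_source: "holds ([Fw, Fw] \<otimes> MuB \<odot> deltaM \<otimes> [Bw] \<odot> Lam \<doteq> linsource)"
  by (rule derivable_sound[of "[(crb_del, [2, 3], 2)]" "[]"], code_simp, simp add: all_laws)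

lemma datum_linear_target: "holds ([Fw, Fw] \<otimes> MuB \<odot> [Fw] \<otimes> psiF \<otimes> [Bw] \<odot> psiF \<otimes> [Fw] \<otimes> [Bw] \<odot> [Bw] \<otimes> El 0
    \<doteq> lintarget)"
  by (rule derivable_sound[of "[(lam_crb 0, [2, 4], 1)]" "[]"], code_simp, simp add: all_laws)

text \<open>The products inside \<open>conv\<close> are first taken apart by
  \<open>mod_assoc\<close>, \<open>crf_mul\<close> and \<open>crb_mul\<close>; then each unit meets
  single crossings only, passes them by \<open>tau_eta\<close> and \<open>crb_eta\<close>, and is
  absorbed by \<open>mul_unit\<close>.\<close>

lemma rho_linsource: "holds (rhoD linsource (lmod 0) (lmod 0) \<odot> [Bw] \<otimes> Eta \<otimes> Eta \<doteq> linsource)"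
  by (rule derivable_sound[of "[(mod_assoc 0, [8, 14], 0), (crf_mul 0, [8, 11], 2), (mod_assoc 0, [12, 16], 1),
      (crb_mul 0, [8, 9], 4), (crb_mul 0, [10, 13], 5), (crb_eta, [0, 8], 5), (crb_eta, [0, 11], 6), (crb_eta,
      [6, 7], 4), (tau_eta, [6, 7], 3), (tau_eta, [6, 7], 2), (mul_unit, [6, 10], 1), (crb_eta, [6, 7], 4),
      (mul_unit, [6, 9], 2)]" "[]"], code_simp, simp add: all_laws)

lemma rho_lintarget: "holds (rhoD lintarget (lmod 0) (lmod 0) \<odot> [Bw] \<otimes> Eta \<otimes> Eta \<doteq> lintarget)"
  by (rule derivable_sound[of "[(mod_assoc 0, [8, 14], 0), (crf_mul 0, [8, 11], 2), (mod_assoc 0, [12, 16], 1),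
      (crb_mul 0, [8, 9], 4), (crb_mul 0, [10, 13], 5), (crb_eta, [0, 8], 5), (crb_eta, [0, 11], 6), (crb_eta,
      [6, 7], 4), (tau_eta, [6, 7], 3), (tau_eta, [6, 7], 2), (mul_unit, [6, 10], 1), (crb_eta, [6, 7], 4),
      (mul_unit, [6, 9], 2)]" "[]"], code_simp, simp add: all_laws)

section \<open>Normalization and the counit\<close>

lemma rho_unit_right: "holds (rhoD (El 0) (lmod 1) lunit \<doteq> actB1 couR (lmod 1))"
  by (rule derivable_sound[of "[(crf_eps 1, [2, 4], 1)]" "[]"], code_simp, simp add: all_laws)

lemma rho_unit_left: "holds (rhoD (El 0) lunit (lmod 1) \<doteq> actB1 couL (lmod 1))"
  by (rule derivable_sound[of "[]" "[]"], code_simp, simp add: all_laws)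

lemma actB1_one: "holds (actB1 (Eta \<otimes> EtaB) (lmod 1) \<doteq> [Mw 1] \<otimes> EtaB)"
  by (rule derivable_sound[of "[(mod_unit 1, [0, 3], 0), (crb_unit 1, [0, 1], 0)]" "[]"], code_simp, simp add:
      all_laws)

lemma actB1_couR: "holds (actB1 couR (lmod 0) \<odot> Eta \<doteq> couR)"
  by (rule derivable_sound[of "[(crb_eta, [0, 3], 1), (mul_unit, [2, 3], 0)]" "[]"], code_simp, simp add:
      all_laws)

lemma actB1_couL: "holds (actB1 couL (lmod 0) \<odot> Eta \<doteq> couL)"
  by (rule derivable_sound[of "[(crb_eta, [0, 3], 1), (mul_unit, [2, 3], 0)]" "[]"], code_simp, simp add:
      all_laws)

lemma unit_Eta: "holds ([Fw] \<otimes> EtaB \<odot> Eta \<doteq> Eta \<otimes> EtaB)"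
  by (rule derivable_sound[of "[]" "[]"], code_simp, simp add: all_laws)

lemma datum_unit_left: "holds ([Fw] \<otimes> MuB \<odot> psiF \<otimes> [Bw] \<odot> epsM \<otimes> [Fw] \<otimes> [Bw] \<odot> El 0 \<doteq> couL)"
  by (rule derivable_sound[of "[(lam_unit, [2, 3], 0), (mod_unit 0, [2, 5], 0), (crb_unit 0, [2, 3], 0),
      (bunit_l, [2, 3], 1)]" "[]"], code_simp, simp add: all_laws)

lemma datum_unit_right: "holds ([Fw] \<otimes> MuB \<odot> [Fw] \<otimes> epsM \<otimes> [Bw] \<odot> El 0 \<doteq> couR)"
  by (rule derivable_sound[of "[(bunit_l, [2, 3], 1)]" "[]"], code_simp, simp add: all_laws)

text \<open>With \<open>datum_counit_target\<close>, both sides of the counit clause of the datum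
  are the identity of B, so this clause holds for every \<open>\<Phi>L\<close>. The counit axiom for
  the coaction enters here.\<close>

lemma datum_counit_source: "holds (MuB \<odot> epsM \<otimes> [Bw] \<odot> Lam \<doteq> [Bw])"
  by (rule derivable_sound[of "[(bunit_l, [2, 3], 0), (lam_counit, [0, 1], 0)]" "[]"], code_simp, simp add:
      all_laws)

lemma datum_counit_target: "holds (MuB \<odot> [Bw] \<otimes> (epsM \<odot> Eta) \<doteq> [Bw])"
  by (rule derivable_sound[of "[(eps_eta, [0, 1], 1), (bunit_r, [0, 1], 0)]" "[]"], code_simp, simp add:
      all_laws)

text \<open>The datum recovers its 2-cocycle as the composite of \<Delta>M with the unit; this
  identifies it with the 2-cell given at the start.\<close>

lemma deltaM_Eta: "holds (deltaM \<odot> Eta \<doteq> El 0)"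
  by (rule derivable_sound[of "[(crb_eta, [0, 2], 2), (del_eta, [1, 2], 2), (mul_unit, [2, 5], 1), (tau_eta, [1,
      2], 1), (mul_unit, [1, 2], 0)]" "[]"], code_simp, simp add: all_laws)

section \<open>The cocycle condition\<close>

lemma cocycle_left: "holds ([Mw 1, Mw 2, Mw 3] \<otimes> MuB \<odot> [Mw 1] \<otimes> rhoD (El 0) (lmod 2) (lmod 3) \<otimes> [Bw]
      \<odot> rhoD (El 0) (lmod 1) (ltensor (lmod 2) (lmod 3)) \<odot> alphaD (lmod 1) (lmod 2) (lmod 3)
    \<doteq> actB3 (rightmult Ph \<otimes> [Bw] \<odot> cocL) (lmod 1) (lmod 2) (lmod 3))"
  \<comment> \<open>\<open>transport 1\<close> brings the inner \<open>El 0\<close> to the left of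
    the first module. On the other side, \<open>transport 0\<close> does the same for the inner
    \<open>El 0\<close> of \<open>cocL\<close>, and \<open>ph_b\<close> moves \<open>Ph\<close> to
    the right of B, where the associativity constraint inserts it.\<close>
  by (rule derivable_sound[of "[(transport 1, [17], 0), (crf_del 1, [9, 13], 1), (crb_act 1, [4, 8], 2),
      (crf_act 1, [9, 13], 2), (crf_act 1, [14, 15], 1), (crb_act 1, [17, 22], 2), (crf_act 1, [23, 24], 1),
      (crf_act 1, [25, 26], 0), (crb_act 1, [16, 22], 3), (crf_act 1, [23, 25], 2), (crf_act 1, [26, 28], 1),
      (crb_act 2, [4, 9], 4), (crf_act 2, [10, 17], 4), (crb_act 2, [19, 33], 3), (crf_act 2, [34, 35], 2),
      (crb_act 2, [18, 33], 4), (crf_act 2, [34, 36], 3), (crb_act 3, [4, 10], 6), (crb_act 3, [19, 40], 4),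
      (crb_act 3, [11, 40], 5), (crb_yb 1, [15, 21, 30], 4), (crb_yb 0, [14, 19, 24], 3), (crb_yb 2, [15, 32,
      38], 5), (crb_yb 0, [14, 30, 33], 4), (crb_yb 1, [13, 23, 30], 5), (crb_yb 0, [12, 18, 22], 4), (crf_yb
      1, [25, 26, 30], 3), (crf_yb 0, [20, 21, 25], 2), (crb_yb 1, [2, 6, 7], 3), (crb_yb 1, [7, 20, 31], 6),
      (crb_yb 2, [2, 7, 8], 5), (crb_yb 1, [1, 5, 6], 4), (crb_yb 2, [8, 34, 39], 6), (crb_yb 1, [6, 23, 33],
      7), (crf_yb 1, [25, 26, 32], 5), (crf_yb 1, [27, 28, 33], 4)]" "[(transport 0, [1], 0), (ph_b, [11], 3),
      (mod_assoc 1, [18, 27], 0), (crf_mul 0, [8, 16], 1), (mod_assoc 0, [17, 19], 2), (crf_mul 0, [8, 14],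
      3), (crf_mul 0, [15, 18], 4), (mod_assoc 0, [19, 22], 3), (crf_mul 1, [20, 26], 2), (mod_assoc 2, [27,
      32], 1), (crf_mul 1, [19, 25], 3), (mod_assoc 2, [26, 32], 2), (crf_mul 1, [20, 22], 5), (crf_mul 1,
      [19, 21], 6), (crf_mul 2, [24, 29], 6), (mod_assoc 3, [30, 37], 2), (crf_mul 2, [22, 28], 7), (mod_assoc
      3, [29, 37], 3), (crb_mul 0, [8, 10], 5), (crb_mul 0, [11, 12], 6), (crb_mul 0, [13, 14], 7), (crb_mul
      1, [15, 22], 8), (crb_mul 2, [23, 27], 9), (crb_mul 3, [28, 35], 10), (crb_del, [5, 6], 3)]"],
      code_simp, simp add: all_laws)

lemma cocycle_right: "holds ([Mw 1, Mw 2, Mw 3] \<otimes> MuB \<odot> [Mw 1, Mw 2] \<otimes> psiD (lmod 3) \<otimes> [Bw]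
      \<odot> rhoD (El 0) (lmod 1) (lmod 2) \<otimes> [Mw 3] \<otimes> [Bw] \<odot> rhoD (El 0) (ltensor (lmod 1) (lmod 2)) (lmod 3)
    \<doteq> actB3 cocR (lmod 1) (lmod 2) (lmod 3))"
  \<comment> \<open>The coaction in \<psi> for the third module is applied to a B that has crossed
    the first two modules; the uses of \<open>lam_crb\<close> take it back in front of them.\<close>
  by (rule derivable_sound[of "[(crb_act 1, [8, 12], 2), (crf_act 1, [13, 14], 1), (crb_act 2, [8, 16], 3),
      (crb_act 3, [8, 21], 3), (lam_crb 2, [15, 19], 3), (lam_crb 0, [14, 16], 2), (lam_crb 1, [10, 15], 3),
      (lam_crb 0, [9, 11], 2), (crb_yb 1, [7, 13, 18], 4), (crf_yb 1, [14, 15, 19], 3), (crb_yb 2, [4, 20,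
      24], 4), (crb_yb 1, [3, 12, 19], 5)]" "[(mod_assoc 1, [5, 17], 0), (crf_mul 1, [5, 13], 2), (mod_assoc
      2, [14, 19], 1), (crf_mul 1, [7, 10], 4), (crf_mul 2, [11, 15], 5), (mod_assoc 3, [16, 22], 2), (crb_mul
      1, [7, 8], 6), (crb_mul 2, [9, 12], 7), (crb_mul 3, [13, 18], 8), (lam_crb 0, [2, 5], 2), (del_tau, [4,
      5], 2), (crb_del, [3, 4], 3)]"], code_simp, simp add: all_laws)

lemma datum_cocycle: "holds (rightmult Phi \<otimes> MuB \<odot> [Fw, Fw] \<otimes> psiF \<otimes> [Bw] \<odot> deltaM \<otimes> [Fw] \<otimes> [Bw] \<odot> El 0
    \<doteq> rightmult Phi \<otimes> [Bw] \<odot> cocR)"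
  by (rule derivable_sound[of "[(mod_assoc 0, [5, 14], 0), (crf_mul 0, [5, 11], 2), (mod_assoc 0, [12, 16], 1),
      (crf_mul 0, [7, 9], 4), (crf_mul 0, [10, 13], 5), (mod_assoc 0, [14, 19], 2), (lam_crb 0, [2, 5], 2),
      (del_tau, [4, 5], 2), (crb_del, [3, 4], 3)]" "[(mod_assoc 0, [5, 15], 0), (crf_mul 0, [5, 12], 2),
      (mod_assoc 0, [13, 17], 1), (crf_mul 0, [7, 10], 4), (crf_mul 0, [11, 14], 5), (mod_assoc 0, [15, 20],
      2), (lam_crb 0, [2, 5], 2), (del_tau, [4, 5], 2), (crb_del, [3, 4], 3)]"], code_simp, simp add:
      all_laws)

lemma actB3_left: "holds (actB3 (rightmult Ph \<otimes> [Bw] \<odot> cocL) (lmod 0) (lmod 0) (lmod 0) \<odot> Eta \<otimes> Eta \<otimes> Eta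
    \<doteq> rightmult Ph \<otimes> [Bw] \<odot> cocL)"
  by (rule derivable_sound[of "[(mod_assoc 0, [15, 24], 0), (crf_mul 0, [8, 13], 1), (mod_assoc 0, [14, 16], 2),
      (crf_mul 0, [8, 11], 3), (crf_mul 0, [12, 15], 4), (mod_assoc 0, [16, 19], 3), (crf_mul 0, [17, 23], 2),
      (mod_assoc 0, [24, 29], 1), (crf_mul 0, [16, 22], 3), (mod_assoc 0, [23, 29], 2), (crf_mul 0, [17, 19],
      5), (crf_mul 0, [16, 18], 6), (crf_mul 0, [21, 26], 6), (mod_assoc 0, [27, 34], 2), (crf_mul 0, [19,
      25], 7), (mod_assoc 0, [26, 34], 3), (crb_mul 0, [8, 16], 8), (crb_mul 0, [17, 21], 9), (crb_mul 0, [22,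
      29], 10), (crb_eta, [0, 15], 9), (crb_eta, [0, 19], 10), (crb_eta, [0, 26], 11), (crb_eta, [12, 13], 8),
      (tau_eta, [12, 13], 7), (tau_eta, [12, 13], 6), (tau_eta, [12, 13], 5), (tau_eta, [12, 15], 4),
      (tau_eta, [14, 15], 3), (tau_eta, [14, 15], 2), (mul_unit, [14, 21], 1), (crb_eta, [12, 13], 8),
      (tau_eta, [12, 13], 7), (tau_eta, [12, 13], 6), (tau_eta, [12, 13], 5), (mul_unit, [12, 17], 3),
      (crb_eta, [12, 13], 8), (mul_unit, [12, 17], 4), (crb_del, [2, 3], 3)]" "[(crf_mul 0, [5, 10], 1),
      (mod_assoc 0, [11, 14], 1), (crf_mul 0, [5, 8], 3), (crf_mul 0, [9, 12], 4), (mod_assoc 0, [13, 17], 2),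
      (crb_del, [2, 3], 3)]"], code_simp, simp add: all_laws)

lemma actB3_right: "holds (actB3 cocR (lmod 0) (lmod 0) (lmod 0) \<odot> Eta \<otimes> Eta \<otimes> Eta \<doteq> cocR)"
  by (rule derivable_sound[of "[(mod_assoc 0, [8, 20], 0), (crf_mul 0, [8, 16], 2), (mod_assoc 0, [17, 22], 1),
      (crf_mul 0, [10, 13], 4), (crf_mul 0, [14, 18], 5), (mod_assoc 0, [19, 25], 2), (crb_mul 0, [10, 11],
      6), (crb_mul 0, [12, 15], 7), (crb_mul 0, [16, 21], 8), (lam_crb 0, [5, 8], 2), (del_tau, [7, 8], 2),
      (crb_eta, [0, 12], 7), (crb_eta, [0, 15], 8), (crb_eta, [0, 20], 9), (crb_eta, [9, 10], 6), (tau_eta,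
      [9, 10], 5), (tau_eta, [9, 10], 4), (tau_eta, [9, 12], 3), (tau_eta, [11, 12], 2), (mul_unit, [11, 17],
      1), (crb_eta, [9, 10], 6), (tau_eta, [9, 10], 5), (tau_eta, [9, 10], 4), (mul_unit, [9, 14], 2),
      (crb_eta, [9, 10], 6), (mul_unit, [9, 13], 3), (crb_del, [3, 4], 3)]" "[(lam_crb 0, [2, 7], 2),
      (del_tau, [4, 5], 2), (crb_del, [3, 4], 3)]"], code_simp, simp add: all_laws)

text \<open>Right multiplications compose in the opposite order, so \<open>rightmult Phi\<close>
  after \<open>rightmult Ph\<close> multiplies by \<open>Ph\<close> times \<open>Phi\<close>, and
  \<open>ph_inv_r\<close> is the relevant inverse law.\<close>

lemma rightmult_inverse_left: "ev (rightmult Phi \<otimes> [Bw] \<odot> rightmult Ph \<otimes> [Bw] \<odot> cocL) = ev cocL"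
proof -
  have 1: "holds (rightmult Phi \<otimes> [Bw] \<odot> rightmult Ph \<otimes> [Bw] \<odot> cocL
      \<doteq> rightmult (prodFFF \<odot> Ph \<otimes> Phi) \<otimes> [Bw] \<odot> cocL)"
    by (rule derivable_sound[of "[(mod_assoc 0, [12, 19], 0), (crf_mul 0, [5, 10], 1), (mod_assoc 0, [11, 13], 2),
      (crf_mul 0, [5, 8], 3), (crf_mul 0, [9, 12], 4), (mod_assoc 0, [13, 16], 3), (crf_mul 0, [14, 19], 2),
      (mod_assoc 0, [20, 24], 1), (crf_mul 0, [13, 18], 3), (mod_assoc 0, [19, 24], 2), (crf_mul 0, [14, 16],
      5), (crf_mul 0, [13, 15], 6), (crf_mul 0, [18, 22], 6), (mod_assoc 0, [23, 29], 2), (crf_mul 0, [16,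
      21], 7), (mod_assoc 0, [22, 29], 3), (crb_del, [2, 3], 3), (swap (crf_yb 0), [13, 17, 18], 4), (swap
      (crf_yb 0), [12, 15, 16], 5)]" "[(crf_mul 0, [5, 17], 1), (mod_assoc 0, [18, 21], 1), (crf_mul 0, [5,
      15], 3), (crf_mul 0, [16, 19], 4), (mod_assoc 0, [20, 24], 2), (crf_act 0, [11, 14], 4), (crf_act 0,
      [11, 19], 5), (crf_act 0, [14, 15], 3), (crf_act 0, [16, 17], 2), (crf_act 0, [18, 19], 1), (crf_act 0,
      [23, 24], 4), (crb_del, [2, 3], 3)]"], code_simp, simp add: all_laws)
  have 2: "holds (rightmult (prodFFF \<odot> Ph \<otimes> Phi) \<otimes> [Bw] \<odot> cocL \<doteq> cocL)"
    by (rule derivable_sound[of "[(ph_inv_r, [8, 9, 10, 11, 12, 13, 14, 15], 3), (mul_unit, [10, 16], 2), (crf_mul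
      0, [5, 11], 1), (mod_assoc 0, [12, 15], 1), (crf_mul 0, [5, 9], 3), (crf_mul 0, [10, 13], 4), (tau_eta,
      [6, 8], 4), (tau_eta, [6, 11], 5), (tau_eta, [6, 7], 3), (tau_eta, [6, 7], 2), (tau_eta, [6, 7], 1),
      (mul_unit, [6, 10], 0), (tau_eta, [6, 7], 3), (mul_unit, [6, 8], 2), (crb_del, [2, 3], 3)]" "[(crb_del,
      [2, 3], 3)]"], code_simp, simp add: all_laws)
  show ?thesis using ev_eq[OF 1] ev_eq[OF 2] by simp
qed

lemma rightmult_inverse_right: "ev (rightmult Ph \<otimes> [Bw] \<odot> rightmult Phi \<otimes> [Bw] \<odot> cocR) = ev cocR"
proof -
  have 1: "holds (rightmult Ph \<otimes> [Bw] \<odot> rightmult Phi \<otimes> [Bw] \<odot> cocR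
      \<doteq> rightmult (prodFFF \<odot> Phi \<otimes> Ph) \<otimes> [Bw] \<odot> cocR)"
    by (rule derivable_sound[of "[(mod_assoc 0, [5, 15], 0), (mod_assoc 0, [15, 22], 0), (mod_assoc 0, [14, 21],
      1), (crf_mul 0, [5, 12], 2), (mod_assoc 0, [13, 15], 3), (crf_mul 0, [7, 10], 4), (crf_mul 0, [11, 14],
      5), (mod_assoc 0, [15, 18], 4), (crf_mul 0, [16, 21], 3), (mod_assoc 0, [22, 27], 1), (crf_mul 0, [15,
      20], 4), (mod_assoc 0, [21, 27], 2), (crf_mul 0, [16, 18], 6), (crf_mul 0, [15, 17], 7), (crf_mul 0,
      [20, 24], 7), (mod_assoc 0, [25, 32], 2), (crf_mul 0, [18, 23], 8), (mod_assoc 0, [24, 32], 3), (lam_crb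
      0, [2, 5], 2), (del_tau, [4, 5], 2), (crb_del, [3, 4], 3), (swap (crf_yb 0), [17, 21, 22], 5), (swap
      (crf_yb 0), [16, 19, 20], 6)]" "[(mod_assoc 0, [5, 22], 0), (crf_mul 0, [5, 19], 2), (mod_assoc 0, [20,
      24], 1), (crf_mul 0, [7, 17], 4), (crf_mul 0, [18, 21], 5), (mod_assoc 0, [22, 27], 2), (crf_act 0, [13,
      16], 5), (crf_act 0, [13, 21], 6), (crf_act 0, [16, 17], 4), (crf_act 0, [18, 19], 3), (crf_act 0, [20,
      21], 2), (crf_act 0, [25, 26], 5), (lam_crb 0, [2, 5], 2), (del_tau, [4, 5], 2), (crb_del, [3, 4],
      3)]"], code_simp, simp add: all_laws)
  have 2: "holds (rightmult (prodFFF \<odot> Phi \<otimes> Ph) \<otimes> [Bw] \<odot> cocR \<doteq> cocR)"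
    by (rule derivable_sound[of "[(ph_inv_l, [11, 12, 13, 14, 15, 16, 17, 18], 3), (mod_assoc 0, [5, 17], 0),
      (mul_unit, [12, 19], 2), (crf_mul 0, [5, 13], 2), (mod_assoc 0, [14, 18], 1), (crf_mul 0, [7, 11], 4),
      (crf_mul 0, [12, 15], 5), (tau_eta, [8, 10], 5), (tau_eta, [8, 13], 6), (tau_eta, [8, 9], 4), (tau_eta,
      [8, 9], 3), (tau_eta, [8, 9], 2), (mul_unit, [8, 12], 1), (tau_eta, [8, 9], 4), (mul_unit, [8, 11], 2),
      (lam_crb 0, [2, 5], 2), (del_tau, [4, 5], 2), (crb_del, [3, 4], 3)]" "[(lam_crb 0, [2, 7], 2), (del_tau,
      [4, 5], 2), (crb_del, [3, 4], 3)]"], code_simp, simp add: all_laws)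
  show ?thesis using ev_eq[OF 1] ev_eq[OF 2] by simp
qed

section \<open>The right action of elements and the pentagon for \<Phi>\<close>

lemma ract_natural: "holds (RMor 0 \<otimes> RMor 1 \<otimes> RMor 2 \<odot> ractD Phi (rmod 0) (rmod 1) (rmod 2)
    \<doteq> ractD Phi (rmod 4) (rmod 5) (rmod 6) \<odot> RMor 0 \<otimes> RMor 1 \<otimes> RMor 2)"
  by (rule derivable_sound[of "[(rmor_act 0, [4, 7], 0), (rmor_act 1, [4, 8], 1), (rmor_act 2, [4, 9], 2),
      (rmor_sig 1, [2, 6], 1), (rmor_sig 2, [2, 8], 2), (rmor_sig 2, [1, 6], 2)]" "[]"], code_simp, simp add:
      all_laws)

text \<open>The sources of the left-hand side appear from left to right as \<open>\<eta> \<times> \<Phi>\<close>, the middle factor and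
  \<open>\<Phi> \<times> \<eta>\<close>; in the cocycle identity of \<open>\<Phi>\<close> the first one is created last and has to be moved to the
  left across \<open>F\<close>.\<close>

lemma ract_left: "holds (ractD Ph (rmod 0) (rmod 1) (rmod 2) \<otimes> [Rw 3] \<odot> ractD Ph (rmod 0) (rtensor (rmod 1)
    (rmod 2)) (rmod 3)
      \<odot> [Rw 0] \<otimes> ractD Ph (rmod 1) (rmod 2) (rmod 3)
    \<doteq> ract4 (fst ph_cocycle) (rmod 0) (rmod 1) (rmod 2) (rmod 3))"
  by (rule derivable_sound[of "[(ph_r 3, [18], 3), (swap (rassoc 0), [12, 25], 0), (sig_del 3, [11, 12], 4),
      (sig_act 1, [4, 10], 1), (swap (rassoc 1), [11, 16], 2), (sig_act 1, [16, 24], 2), (crf_mul 0, [15, 23],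
      3), (swap (rassoc 1), [26, 30], 1), (mod_assoc 0, [24, 29], 2), (sig_act 2, [4, 8], 3), (sig_act 2, [9,
      15], 4), (swap (rassoc 2), [16, 17], 5), (sig_act 2, [17, 23], 5), (crf_mul 0, [16, 22], 6), (sig_act 2,
      [25, 29], 6), (crf_mul 0, [23, 28], 7), (swap (rassoc 2), [31, 37], 2), (mod_assoc 0, [29, 36], 3),
      (sig_act 3, [4, 6], 5), (sig_act 3, [7, 13], 6), (sig_act 3, [14, 15], 7), (swap (rassoc 3), [16, 19],
      8), (sig_act 3, [19, 21], 8), (crf_mul 0, [18, 20], 9), (sig_act 3, [23, 24], 9), (crf_mul 0, [21, 23],
      10), (sig_act 3, [26, 27], 10), (crf_mul 0, [24, 26], 11), (sig_yb 3, [3, 6, 7], 4), (sig_yb 2, [2, 8,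
      9], 2), (sig_yb 3, [1, 5, 7], 3), (sig_yb 3, [15, 21, 30], 7), (swap (crf_yb 0), [14, 19, 25], 8),
      (sig_yb 2, [15, 32, 33], 4), (swap (crf_yb 0), [14, 30, 31], 5), (sig_yb 3, [13, 24, 29], 6), (swap
      (crf_yb 0), [12, 18, 23], 7), (sig_yb 3, [7, 24, 30], 5), (sig_yb 2, [8, 32, 34], 3), (sig_yb 3, [6, 23,
      31], 4), (sig_yb 3, [25, 26, 31], 6), (sig_yb 3, [28, 29, 36], 8), (sig_yb 3, [27, 33, 37], 7)]"
      "[(ph_mod 0, [5], 4), (mod_assoc 0, [14, 18], 5), (crf_mul 0, [11, 13], 9), (crf_mul 0, [14, 16], 9),
      (crf_mul 0, [14, 18], 7), (mod_assoc 0, [19, 22], 6), (crf_act 0, [4, 6], 6), (crf_act 0, [7, 8], 5),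
      (crf_act 0, [9, 10], 4), (del_tau, [12, 13], 7), (crf_del 0, [3, 12], 8), (sig_mul 3, [13, 28], 3),
      (sig_mul 2, [29, 30], 2), (sig_mul 1, [31, 33], 1), (sig_mul 3, [24, 31], 5), (sig_mul 2, [32, 36], 3),
      (sig_mul 3, [23, 31], 6), (sig_mul 2, [32, 37], 4), (sig_mul 3, [24, 40], 5), (sig_mul 3, [23, 40],
      6)]"], code_simp, simp add: all_laws)

text \<open>The operator applied first supplies the left factor of the product. Hence
  \<open>Del\<close> falls on the last leg of the first \<open>Ph\<close> and on the first leg of
  the second, as in \<open>snd ph_cocycle\<close>.\<close>

lemma ract_right: "holds (ractD Ph (rtensor (rmod 0) (rmod 1)) (rmod 2) (rmod 3) \<odot> ractD Ph (rmod 0) (rmod 1)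
    (rtensor (rmod 2) (rmod 3))
    \<doteq> ract4 (snd ph_cocycle) (rmod 0) (rmod 1) (rmod 2) (rmod 3))"
  by (rule derivable_sound[of "[(swap (rassoc 0), [6, 18], 0), (sig_del 2, [13, 15], 3), (sig_del 3, [12, 14],
      4), (sig_act 1, [6, 18], 2), (swap (rassoc 1), [19, 22], 1), (sig_act 2, [8, 15], 4), (sig_act 2, [16,
      17], 5), (swap (rassoc 2), [18, 25], 2), (sig_act 3, [8, 11], 6), (sig_act 3, [12, 13], 7), (sig_act 3,
      [14, 15], 8), (swap (rassoc 3), [16, 29], 3), (sig_yb 3, [7, 11, 16], 5), (sig_yb 3, [14, 15, 18], 6),
      (sig_yb 2, [5, 14, 20], 3), (sig_yb 3, [4, 12, 17], 4)]" "[(crf_del 0, [2, 4], 6), (del_tau, [4, 5], 6),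
      (del_tau, [3, 4], 7), (sig_mul 3, [10, 14], 3), (sig_mul 2, [15, 16], 2), (sig_mul 1, [17, 19], 1),
      (sig_mul 3, [10, 17], 5), (sig_mul 2, [18, 22], 3), (sig_mul 3, [10, 24], 5)]"], code_simp, simp add:
      all_laws)

lemma ract_Ph_cocycle:
  "ev (ractD Ph (rmod 0) (rmod 1) (rmod 2) \<otimes> [Rw 3] \<odot> ractD Ph (rmod 0) (rtensor (rmod 1) (rmod 2)) (rmod 3)
      \<odot> [Rw 0] \<otimes> ractD Ph (rmod 1) (rmod 2) (rmod 3))
    = ev (ractD Ph (rtensor (rmod 0) (rmod 1)) (rmod 2) (rmod 3) \<odot> ractD Ph (rmod 0) (rmod 1) (rtensor (rmod
        2) (rmod 3)))"
proof -
  have "holds ph_cocycle" using laws by simp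
  then have "ev (fst ph_cocycle) = ev (snd ph_cocycle)" by (simp add: holds_def)
  then show ?thesis unfolding ev_eq[OF ract_left] ev_eq[OF ract_right] by (simp add: ract4_def)
qed

text \<open>This and the next four lemmas treat the five factors of the pentagon. For the three on
  one side \<open>Phi\<close> gives a left inverse, for the two on the other side a right inverse,
  as needed for the cancellation in \<open>right_action_cocycle\<close>.\<close>

lemma ract_inverse_xyz_w: "ev (ractD Phi (rmod 0) (rmod 1) (rmod 2) \<otimes> [Rw 3] \<odot> ractD Ph (rmod 0) (rmod 1)
    (rmod 2) \<otimes> [Rw 3]) = ev (Wire [Rw 0, Rw 1, Rw 2, Rw 3])"
proof -
  have 1: "holds (ractD Phi (rmod 0) (rmod 1) (rmod 2) \<otimes> [Rw 3] \<odot> ractD Ph (rmod 0) (rmod 1) (rmod 2) \<otimes> [Rw 3]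
      \<doteq> ractD (prodFFF \<odot> Ph \<otimes> Phi) (rmod 0) (rmod 1) (rmod 2) \<otimes> [Rw 3])"
    by (rule derivable_sound[of "[(swap (rassoc 0), [4, 11], 0), (sig_act 1, [4, 8], 2), (swap (rassoc 1), [9,
      13], 1), (sig_act 2, [4, 6], 4), (sig_act 2, [7, 10], 5), (swap (rassoc 2), [11, 16], 2), (sig_yb 2, [3,
      6, 7], 3)]" "[(sig_mul 2, [5, 8], 2), (sig_mul 1, [9, 10], 1), (sig_mul 2, [5, 12], 3)]"], code_simp,
      simp add: all_laws)
  have 2: "holds (ractD (prodFFF \<odot> Ph \<otimes> Phi) (rmod 0) (rmod 1) (rmod 2) \<otimes> [Rw 3] \<doteq> [Rw 0, Rw 1, Rw 2, Rw 3])"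
    by (rule derivable_sound[of "[(ph_inv_r, [0, 1, 2, 3, 4, 5, 6, 7], 3), (runit 2, [2, 8], 2), (sig_eta 2, [0,
      2], 2), (sig_eta 1, [1, 2], 1), (runit 0, [1, 3], 0), (sig_eta 2, [0, 1], 2), (runit 1, [0, 1], 1)]"
      "[]"], code_simp, simp add: all_laws)
  show ?thesis using ev_eq[OF 1] ev_eq[OF 2] by simp
qed

lemma ract_inverse_x_yz_w: "ev (ractD Phi (rmod 0) (rtensor (rmod 1) (rmod 2)) (rmod 3) \<odot> ractD Ph (rmod 0)
    (rtensor (rmod 1) (rmod 2)) (rmod 3)) = ev (Wire [Rw 0, Rw 1, Rw 2, Rw 3])"
proof -
  have 1: "holds (ractD Phi (rmod 0) (rtensor (rmod 1) (rmod 2)) (rmod 3) \<odot> ractD Ph (rmod 0) (rtensor (rmod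
      1) (rmod 2)) (rmod 3) \<doteq> ractD (prodFFF \<odot> Ph \<otimes> Phi) (rmod 0) (rtensor (rmod 1) (rmod 2)) (rmod 3))"
    \<comment> \<open>The middle leg acts on a tensor product through \<open>Del\<close>, so a
      product of middle legs has to be split by \<open>del_mul\<close>.\<close>
    by (rule derivable_sound[of "[(swap (rassoc 0), [5, 16], 0), (sig_del 3, [4, 5], 4), (sig_del 3, [15, 18], 3),
      (sig_act 1, [8, 14], 2), (swap (rassoc 1), [15, 22], 1), (sig_act 2, [8, 12], 4), (sig_act 2, [13, 21],
      3), (swap (rassoc 2), [22, 25], 2), (sig_act 3, [8, 10], 6), (sig_act 3, [11, 19], 5), (sig_act 3, [20,
      21], 6), (swap (rassoc 3), [22, 29], 3), (sig_yb 3, [6, 10, 11], 5), (sig_yb 2, [6, 12, 13], 3), (sig_yb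
      3, [5, 9, 11], 4)]" "[(sig_mul 3, [5, 8], 3), (sig_mul 2, [9, 10], 2), (sig_mul 1, [11, 12], 1),
      (sig_mul 3, [5, 14], 4), (del_mul, [15, 17], 3), (sig_mul 2, [19, 21], 2), (sig_del 3, [13, 16], 3),
      (crf_del 0, [3, 14], 5), (sig_del 3, [18, 19], 5), (del_tau, [3, 18], 6)]"], code_simp, simp add:
      all_laws)
  have 2: "holds (ractD (prodFFF \<odot> Ph \<otimes> Phi) (rmod 0) (rtensor (rmod 1) (rmod 2)) (rmod 3) \<doteq> [Rw 0, Rw 1, Rw
      2, Rw 3])"
    by (rule derivable_sound[of "[(ph_inv_r, [0, 1, 2, 3, 4, 5, 6, 7], 4), (runit 3, [2, 12], 3), (sig_eta 3, [0,
      2], 3), (sig_eta 2, [1, 2], 2), (sig_eta 1, [1, 2], 1), (runit 0, [1, 3], 0), (sig_eta 3, [0, 1], 3),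
      (del_eta, [0, 1], 3), (runit 2, [1, 4], 2), (sig_eta 2, [0, 1], 2), (runit 1, [0, 1], 1)]" "[]"],
      code_simp, simp add: all_laws)
  show ?thesis using ev_eq[OF 1] ev_eq[OF 2] by simp
qed

lemma ract_inverse_x_yzw: "ev ([Rw 0] \<otimes> ractD Phi (rmod 1) (rmod 2) (rmod 3) \<odot> [Rw 0] \<otimes> ractD Ph (rmod 1)
    (rmod 2) (rmod 3)) = ev (Wire [Rw 0, Rw 1, Rw 2, Rw 3])"
proof -
  have 1: "holds ([Rw 0] \<otimes> ractD Phi (rmod 1) (rmod 2) (rmod 3) \<odot> [Rw 0] \<otimes> ractD Ph (rmod 1) (rmod 2) (rmod 3)
      \<doteq> [Rw 0] \<otimes> ractD (prodFFF \<odot> Ph \<otimes> Phi) (rmod 1) (rmod 2) (rmod 3))"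
    by (rule derivable_sound[of "[(swap (rassoc 1), [4, 11], 1), (sig_act 2, [4, 8], 3), (swap (rassoc 2), [9,
      13], 2), (sig_act 3, [4, 6], 5), (sig_act 3, [7, 10], 6), (swap (rassoc 3), [11, 16], 3), (sig_yb 3, [3,
      6, 7], 4)]" "[(sig_mul 3, [5, 8], 3), (sig_mul 2, [9, 10], 2), (sig_mul 3, [5, 12], 4)]"], code_simp,
      simp add: all_laws)
  have 2: "holds ([Rw 0] \<otimes> ractD (prodFFF \<odot> Ph \<otimes> Phi) (rmod 1) (rmod 2) (rmod 3) \<doteq> [Rw 0, Rw 1, Rw 2, Rw 3])"
    by (rule derivable_sound[of "[(ph_inv_r, [0, 1, 2, 3, 4, 5, 6, 7], 4), (runit 3, [2, 8], 3), (sig_eta 3, [0,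
      2], 3), (sig_eta 2, [1, 2], 2), (runit 1, [1, 3], 1), (sig_eta 3, [0, 1], 3), (runit 2, [0, 1], 2)]"
      "[]"], code_simp, simp add: all_laws)
  show ?thesis using ev_eq[OF 1] ev_eq[OF 2] by simp
qed

lemma ract_inverse_xy_z_w: "ev (ractD Ph (rtensor (rmod 0) (rmod 1)) (rmod 2) (rmod 3) \<odot> ractD Phi (rtensor
    (rmod 0) (rmod 1)) (rmod 2) (rmod 3)) = ev (Wire [Rw 0, Rw 1, Rw 2, Rw 3])"
proof -
  have 1: "holds (ractD Ph (rtensor (rmod 0) (rmod 1)) (rmod 2) (rmod 3) \<odot> ractD Phi (rtensor (rmod 0) (rmod
      1)) (rmod 2) (rmod 3) \<doteq> ractD (prodFFF \<odot> Phi \<otimes> Ph) (rtensor (rmod 0) (rmod 1)) (rmod 2) (rmod 3))"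
    by (rule derivable_sound[of "[(swap (rassoc 0), [6, 16], 0), (sig_del 2, [2, 4], 2), (sig_del 2, [12, 14], 3),
      (sig_del 3, [1, 3], 3), (sig_del 3, [12, 14], 4), (sig_act 1, [8, 18], 2), (swap (rassoc 1), [19, 22],
      1), (sig_act 2, [8, 15], 4), (sig_act 2, [16, 17], 5), (swap (rassoc 2), [18, 25], 2), (sig_act 3, [8,
      11], 6), (sig_act 3, [12, 13], 7), (sig_act 3, [14, 15], 8), (swap (rassoc 3), [16, 29], 3), (sig_yb 3,
      [4, 11, 16], 5), (sig_yb 3, [14, 15, 18], 6)]" "[(sig_mul 3, [5, 8], 3), (sig_mul 2, [9, 10], 2),
      (del_mul, [11, 13], 2), (sig_mul 1, [15, 17], 1), (sig_mul 3, [5, 11], 5), (sig_del 2, [8, 13], 2),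
      (sig_del 2, [14, 15], 4), (sig_del 3, [6, 11], 3), (sig_del 3, [9, 15], 5), (del_tau, [3, 11], 6),
      (del_tau, [2, 10], 7)]"], code_simp, simp add: all_laws)
  have 2: "holds (ractD (prodFFF \<odot> Phi \<otimes> Ph) (rtensor (rmod 0) (rmod 1)) (rmod 2) (rmod 3) \<doteq> [Rw 0, Rw 1, Rw
      2, Rw 3])"
    by (rule derivable_sound[of "[(ph_inv_l, [0, 1, 2, 3, 4, 5, 6, 7], 4), (runit 3, [2, 11], 3), (sig_eta 3, [0,
      2], 3), (sig_eta 2, [1, 2], 2), (del_eta, [1, 3], 2), (runit 1, [3, 6], 1), (sig_eta 1, [2, 3], 1),
      (runit 0, [2, 3], 0), (sig_eta 3, [0, 1], 3), (runit 2, [0, 1], 2)]" "[]"], code_simp, simp add: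
      all_laws)
  show ?thesis using ev_eq[OF 1] ev_eq[OF 2] by simp
qed

lemma ract_inverse_x_y_zw: "ev (ractD Ph (rmod 0) (rmod 1) (rtensor (rmod 2) (rmod 3)) \<odot> ractD Phi (rmod 0)
    (rmod 1) (rtensor (rmod 2) (rmod 3))) = ev (Wire [Rw 0, Rw 1, Rw 2, Rw 3])"
proof -
  have 1: "holds (ractD Ph (rmod 0) (rmod 1) (rtensor (rmod 2) (rmod 3)) \<odot> ractD Phi (rmod 0) (rmod 1)
      (rtensor (rmod 2) (rmod 3)) \<doteq> ractD (prodFFF \<odot> Phi \<otimes> Ph) (rmod 0) (rmod 1) (rtensor (rmod 2) (rmod 3)))"
    by (rule derivable_sound[of "[(swap (rassoc 0), [6, 18], 0), (sig_act 1, [6, 14], 2), (swap (rassoc 1), [15,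
      20], 1), (sig_act 2, [8, 12], 4), (sig_act 2, [13, 17], 5), (swap (rassoc 2), [18, 25], 2), (sig_act 3,
      [8, 10], 6), (sig_act 3, [11, 16], 7), (sig_act 3, [17, 25], 4), (swap (rassoc 3), [26, 29], 3), (sig_yb
      3, [7, 10, 11], 5), (sig_yb 2, [5, 12, 13], 3), (sig_yb 3, [4, 9, 11], 4), (sig_yb 3, [11, 16, 17], 6)]"
      "[(del_mul, [7, 15], 4), (crf_del 0, [4, 14], 5), (crf_del 0, [2, 9], 6), (sig_mul 3, [6, 7], 3),
      (sig_mul 2, [8, 9], 2), (sig_mul 1, [10, 11], 1), (sig_mul 3, [16, 17], 3), (sig_mul 2, [18, 19], 2),
      (sig_mul 3, [24, 26], 3)]"], code_simp, simp add: all_laws)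
  have 2: "holds (ractD (prodFFF \<odot> Phi \<otimes> Ph) (rmod 0) (rmod 1) (rtensor (rmod 2) (rmod 3)) \<doteq> [Rw 0, Rw 1, Rw
      2, Rw 3])"
    by (rule derivable_sound[of "[(ph_inv_l, [0, 1, 2, 3, 4, 5, 6, 7], 4), (del_eta, [2, 10], 4), (runit 3, [10,
      13], 3), (sig_eta 3, [0, 2], 3), (sig_eta 2, [1, 2], 2), (sig_eta 1, [1, 2], 1), (runit 0, [1, 4], 0),
      (sig_eta 3, [0, 1], 3), (sig_eta 2, [0, 1], 2), (runit 1, [0, 1], 1), (sig_eta 3, [0, 1], 3), (runit 2,
      [0, 1], 2)]" "[]"], code_simp, simp add: all_laws)
  show ?thesis using ev_eq[OF 1] ev_eq[OF 2] by simp
qed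


end

section \<open>Hausser--Nill data\<close>

locale hausser_nill_setting = two_category K for K :: "('o, 'm, 'c) two_cat" (structure) +
  fixes \<A> :: 'o and F B :: 'm
    and \<mu> \<eta> \<Delta> \<epsilon> \<tau> \<Phi> \<Phi>i \<mu>B \<eta>B coact \<tau>BF \<psi> \<Phi>L \<Delta>M \<epsilon>M \<beta> :: 'c
    and \<T> \<C> :: "('m, 'c) tambara set" and F0 :: "('m, 'c) tambara"
  assumes \<A>: "\<A> \<in> Cells0 K"
    and quasi_bimonad: "quasi_bimonad K \<A> F \<mu> \<eta> \<Delta> \<epsilon> \<tau> \<Phi> \<Phi>i"
    and comodule_monad: "comodule_monad K \<A> F \<eta> B \<mu>B \<eta>B \<psi> coact"
    and \<psi>_eq: "\<psi> = (\<mu> \<star> \<iota> B) \<bullet> (\<iota> F \<star> \<tau>BF) \<bullet> (coact \<star> \<iota> F)"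
    and counit: "(\<epsilon> \<star> \<iota> B) \<bullet> coact = \<iota> B"
    and \<Phi>_B: "\<Phi> \<star> \<iota> B = (\<iota> (F \<cdot> F) \<star> \<tau>BF) \<bullet> (\<iota> F \<star> \<tau>BF \<star> \<iota> F) \<bullet> (\<tau>BF \<star> \<iota> (F \<cdot> F)) \<bullet> (\<iota> B \<star> \<Phi>)"
    and \<Phi>L_hom: "\<Phi>L \<in> hom2 K (Id1 K \<A>) (F \<cdot> F \<cdot> B)"
    and \<T>_eq: "\<T> = tambara_objects K \<A> F \<mu> \<eta> \<Delta> \<epsilon> \<tau> \<Phi> B \<mu>B \<eta>B coact \<tau>BF"
    and closed: "tensor_closed K \<A> F \<Delta> \<epsilon> B \<T>"
    and \<C>_eq: "\<C> = {X \<in> \<T>. transports K F B \<Phi>L X}"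
    and F0_eq: "F0 = \<lparr>cell = F, tauB = \<tau>BF, tauF = \<tau>, act = \<mu>\<rparr>" and F0: "F0 \<in> \<C>"
    and \<Delta>M_eq: "\<Delta>M = (\<mu> \<star> \<mu> \<star> \<iota> B) \<bullet> (\<iota> F \<star> \<tau> \<star> \<iota> F \<star> \<iota> B) \<bullet> (\<iota> F \<star> \<iota> F \<star> \<Delta> \<star> \<iota> B)
               \<bullet> (\<iota> F \<star> \<iota> F \<star> \<tau>BF) \<bullet> (\<Phi>L \<star> \<iota> F)"
    and \<epsilon>M_eq: "\<epsilon>M = \<eta>B \<bullet> \<epsilon>"
    and \<beta>_eq: "\<beta> = mu_FFF K F \<mu> \<tau> \<bullet> (\<iota> F \<star> \<iota> F \<star> \<iota> F \<star> \<Phi>i)"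
begin

abbreviation "\<R> \<equiv> right_tambara_modules K \<A> F \<mu> \<eta> \<Delta> \<epsilon> \<tau> \<Phi>"

definition "R0 = \<lparr>rcell = F, rtau = \<tau>, ract = \<mu>\<rparr>"

lemmas qb = quasi_bimonad[unfolded quasi_bimonad_def monad_def left_monadic_def right_monadic_def
  left_comonadic_def right_comonadic_def Phi_invertible_def Phi_cocycle_def]

lemma coact_eq: "coact = \<psi> \<bullet> (\<iota> B \<star> \<eta>)"
  using comodule_monad by (simp add: comodule_monad_def)

lemma cm: "monad K \<A> B \<mu>B \<eta>B" "\<psi> \<in> hom2 K (B \<cdot> F) (F \<cdot> B)" "coact \<in> hom2 K B (F \<cdot> B)"
  "(\<iota> F \<star> \<mu>B) \<bullet> (\<psi> \<star> \<iota> B) \<bullet> (\<iota> B \<star> coact) = coact \<bullet> \<mu>B" "coact \<bullet> \<eta>B = \<eta> \<star> \<eta>B"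
  using comodule_monad unfolding comodule_monad_def by - (elim conjE, assumption)+

lemmas B_monad = cm(1)[unfolded monad_def]

lemmas F0_axioms = F0[unfolded \<C>_eq \<T>_eq F0_eq mem_Collect_eq tambara_objects_def left_tambara_def
  left_module_def EM_cell_def transports_def tambara.simps]

text \<open>At F, the mirrored axioms are right monadicity, left comonadicity, left monadicity for
  the action, the 0-cell condition for \<Phi>, and the Yang-Baxter equation, which F satisfies as a
  left Tambara module.\<close>

lemma R0: "R0 \<in> Objs \<R>"
  using qb F0_axioms
  by (simp add: R0_def right_tambara_modules_def is_right_tambara_def right_module_def)

definition elements :: "'c set" where
  "elements = hom2 K (Id1 K \<A>) (F \<cdot> F \<cdot> B)"

definition convolution :: "'c \<Rightarrow> 'c \<Rightarrow> 'c" (infixl "\<^bold>*" 65) where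
  "u \<^bold>* v = mu_FFB K F \<mu> \<tau> B \<mu>B \<tau>BF \<bullet> (u \<star> v)"

definition linear_at :: "('m, 'c) tambara \<Rightarrow> ('m, 'c) tambara \<Rightarrow> bool" where
  "linear_at X Y \<longleftrightarrow>
    (\<iota> (cell X \<cdot> cell Y) \<star> \<mu>B) \<bullet> (rho_bar K F B \<Phi>L X Y \<star> \<iota> B) \<bullet> psiB K F B coact (tambara_tensor K F \<Delta> X Y)
    = (\<iota> (cell X \<cdot> cell Y) \<star> \<mu>B)
         \<bullet> (((\<iota> (cell X) \<star> psiB K F B coact Y) \<bullet> (psiB K F B coact X \<star> \<iota> (cell Y))) \<star> \<iota> B)
         \<bullet> (\<iota> B \<star> rho_bar K F B \<Phi>L X Y)"

definition datum_linear :: bool where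
  "datum_linear \<longleftrightarrow> (\<iota> (F \<cdot> F) \<star> \<mu>B) \<bullet> (\<Delta>M \<star> \<iota> B) \<bullet> coact
    = (\<iota> (F \<cdot> F) \<star> \<mu>B) \<bullet> (\<iota> F \<star> \<psi> \<star> \<iota> B) \<bullet> (\<psi> \<star> \<iota> F \<star> \<iota> B) \<bullet> (\<iota> B \<star> \<Phi>L)"

definition cocycle_at :: "('m, 'c) tambara \<Rightarrow> ('m, 'c) tambara \<Rightarrow> ('m, 'c) tambara \<Rightarrow> bool" where
  "cocycle_at X Y Z \<longleftrightarrow>
    (\<iota> (cell X \<cdot> cell Y \<cdot> cell Z) \<star> \<mu>B) \<bullet> (\<iota> (cell X) \<star> rho_bar K F B \<Phi>L Y Z \<star> \<iota> B)
       \<bullet> rho_bar K F B \<Phi>L X (tambara_tensor K F \<Delta> Y Z) \<bullet> tambara_alpha K F \<Phi> X Y Z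
    = (\<iota> (cell X \<cdot> cell Y \<cdot> cell Z) \<star> \<mu>B) \<bullet> (\<iota> (cell X \<cdot> cell Y) \<star> psiB K F B coact Z \<star> \<iota> B)
       \<bullet> (rho_bar K F B \<Phi>L X Y \<star> \<iota> (cell Z) \<star> \<iota> B) \<bullet> rho_bar K F B \<Phi>L (tambara_tensor K F \<Delta> X Y) Z"

definition datum_cocycle :: bool where
  "datum_cocycle \<longleftrightarrow> (\<beta> \<star> \<mu>B) \<bullet> (\<iota> (F \<cdot> F) \<star> \<psi> \<star> \<iota> B) \<bullet> (\<Delta>M \<star> \<iota> F \<star> \<iota> B) \<bullet> \<Phi>L
    = (\<iota> (F \<cdot> F \<cdot> F) \<star> \<mu>B) \<bullet> (\<iota> F \<star> \<Delta>M \<star> \<iota> B) \<bullet> \<Phi>L"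

definition normalized_at :: "('m, 'c) tambara \<Rightarrow> bool" where
  "normalized_at X \<longleftrightarrow> rho_bar K F B \<Phi>L X (tambara_unit K \<A> F \<epsilon> B) = \<iota> (cell X) \<star> \<eta>B \<and>
     rho_bar K F B \<Phi>L (tambara_unit K \<A> F \<epsilon> B) X = \<iota> (cell X) \<star> \<eta>B"

definition datum_normalized :: bool where
  "datum_normalized \<longleftrightarrow> (\<iota> F \<star> \<mu>B) \<bullet> (\<psi> \<star> \<iota> B) \<bullet> (\<epsilon>M \<star> \<iota> F \<star> \<iota> B) \<bullet> \<Phi>L = \<eta> \<star> \<eta>B \<and>
     (\<iota> F \<star> \<mu>B) \<bullet> (\<iota> F \<star> \<epsilon>M \<star> \<iota> B) \<bullet> \<Phi>L = \<eta> \<star> \<eta>B"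

text \<open>The operator on XYZ that extends \<beta>. It is bracketed so that its value at F, F, F
  is literally the expression defining \<beta>.\<close>

definition right_action :: "'c \<Rightarrow> ('m, 'c) right_tambara \<Rightarrow> ('m, 'c) right_tambara \<Rightarrow> ('m, 'c) right_tambara \<Rightarrow>
    'c" where
  "right_action p X Y Z = ((ract X \<star> ract Y \<star> ract Z) \<bullet> (\<iota> (rcell X) \<star> rtau Y \<star> rtau Z \<star> \<iota> F)
     \<bullet> (\<iota> (rcell X \<cdot> rcell Y) \<star> rtau Z \<star> \<iota> (F \<cdot> F))) \<bullet> (\<iota> (rcell X) \<star> \<iota> (rcell Y) \<star> \<iota> (rcell Z) \<star> p)"

end

locale hausser_nill_instance = hausser_nill_setting +
  fixes M :: "nat \<Rightarrow> ('b, 'c) tambara" and R :: "nat \<Rightarrow> ('b, 'c) right_tambara"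
    and el :: "nat \<Rightarrow> 'c" and inv :: 'c and lm rm :: "nat \<Rightarrow> 'c"
  assumes M_0: "M 0 = F0" and M: "M n \<in> \<C>" and R: "R n \<in> Objs \<R>"
    and el_0: "el 0 = \<Phi>L" and el: "el n \<in> elements"
    and inv: "inv \<in> hom2 K (F \<cdot> F) (F \<cdot> F \<cdot> B)"
    and lm: "lm n \<in> tambara_mor K F B (M n) (M (n + 4))"
    and rm: "rm n \<in> Mors \<R> (R n) (R (n + 4))"
begin

section \<open>Values of wires and generators, and validity of the laws\<close>

primrec wire_cell :: "wire \<Rightarrow> 'b" where
  "wire_cell Bw = B" | "wire_cell (Mw n) = cell (M n)" | "wire_cell (Rw n) = rcell (R n)"

primrec gen_cell :: "generator \<Rightarrow> 'c" where
  "gen_cell (Act n) = act (M n)" | "gen_cell (Crf n) = tauF (M n)" | "gen_cell (Crb n) = tauB (M n)"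
| "gen_cell Eta = \<eta>" | "gen_cell Del = \<Delta>" | "gen_cell Cou = \<epsilon>" | "gen_cell Ph = \<Phi>" | "gen_cell Phi = \<Phi>i"
| "gen_cell MuB = \<mu>B" | "gen_cell EtaB = \<eta>B" | "gen_cell Lam = coact" | "gen_cell (El n) = el n"
| "gen_cell Inv = inv" | "gen_cell (LMor n) = lm n" | "gen_cell (RAct n) = ract (R n)"
| "gen_cell (Sig n) = rtau (R n)" | "gen_cell (RMor n) = rm n"

sublocale diagrams K \<A> arity wire_cell gen_cell
  by unfold_locales (rule \<A>)

lemma M_0_simps [simp]: "cell (M 0) = F" "tauB (M 0) = \<tau>BF" "tauF (M 0) = \<tau>" "act (M 0) = \<mu>"
  by (simp_all add: M_0 F0_eq)

lemmas M_axioms = M[unfolded \<C>_eq \<T>_eq mem_Collect_eq tambara_objects_def left_tambara_def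
  left_module_def EM_cell_def transports_def]

lemmas R_axioms = R[unfolded right_tambara_modules_def structured_cells.simps mem_Collect_eq
  is_right_tambara_def right_module_def]

lemma wire_cell_endo: "wire_cell w \<in> endo K \<A>"
  using B_monad M_axioms R_axioms by (cases w) auto

text \<open>The defining equation of \<open>word\<close> leaves a trailing identity 1-cell. This
  rule and the next replace it, so that words become the composites occurring in the axioms.\<close>

lemma word_single: "word [w] = wire_cell w"
  using wire_cell_endo[of w] comp1_Id by (auto simp: endo_def)

lemma word_Cons2: "word (v # w # ws) = wire_cell v \<cdot> word (w # ws)"
  by simp

lemmas word_simps = word_single word_Cons2 word.simps(1) wire_cell.simps M_0_simps

lemma gen_cell_hom: "gen_cell g \<in> hom2 K (word (fst (arity g))) (word (snd (arity g)))"
proof (cases g)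
  case (LMor n)
  then show ?thesis using lm[of n] by (simp add: word_simps tambara_mor_def del: word.simps(2))
next
  case (RMor n)
  then show ?thesis using rm[of n] by (simp add: word_simps right_tambara_modules_def del: word.simps(2))
next
  case (RAct n)
  then show ?thesis using R_axioms[of n] by (simp add: word_simps del: word.simps(2))
next
  case (Sig n)
  then show ?thesis using R_axioms[of n] by (simp add: word_simps del: word.simps(2))
next
  case (Act n)
  then show ?thesis using M_axioms[of n] by (simp add: word_simps del: word.simps(2))
next
  case (Crf n)
  then show ?thesis using M_axioms[of n] by (simp add: word_simps del: word.simps(2))
next
  case (Crb n)
  then show ?thesis using M_axioms[of n] by (simp add: word_simps del: word.simps(2))
next
  case (El n)
  then show ?thesis using el[of n] by (simp add: elements_def word_simps del: word.simps(2))
qed (use qb B_monad cm(2,3) inv in \<open>simp_all add: word_simps del: word.simps(2)\<close>)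

sublocale typed_diagrams K \<A> arity wire_cell gen_cell
  by unfold_locales (rule wire_cell_endo, rule gen_cell_hom)

lemmas eval = ev.simps gen_cell.simps word_simps

lemma holds_intro: "typed arity s \<Longrightarrow> typed arity t \<Longrightarrow> dmw arity s = dmw arity t \<Longrightarrow> cdw arity s = cdw arity t
    \<Longrightarrow> ev s = ev t \<Longrightarrow> holds (s \<doteq> t)"
  by (simp add: holds_def)

lemma module_laws: "holds (mod_assoc n)" "holds (mod_unit n)" "holds (crf_mul n)" "holds (crf_eta n)" "holds
    (crf_del n)" "holds (crf_eps n)" "holds (ph_mod n)" "holds (crf_yb n)" "holds (crf_act n)" "holds (crb_mul
    n)" "holds (crb_unit n)" "holds (crb_act n)" "holds (lam_crb n)" "holds (crb_yb n)"
  unfolding mod_assoc_def mod_unit_def crf_mul_def crf_eta_def crf_del_def crf_eps_def ph_mod_def crf_yb_def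
      crf_act_def crb_mul_def crb_unit_def crb_act_def lam_crb_def crb_yb_def 
  by ((rule holds_intro, simp, simp, simp, simp, simp only: eval, insert M_axioms[of n], elim conjE,
      assumption)[1])+

lemma quasi_bimonad_laws: "holds mul_unit" "holds tau_eta" "holds del_tau" "holds del_mul" "holds del_eta"
    "holds eps_eta" "holds ph_counit" "holds ph_cocycle"
  unfolding mul_unit_def tau_eta_def del_tau_def del_mul_def del_eta_def eps_eta_def ph_counit_def ph_cocycle_def 
  by ((rule holds_intro, simp, simp, simp, simp, simp only: eval, insert qb, elim conjE, assumption)[1])+

lemma Phi_inverse_laws: "holds ph_inv_r" "holds ph_inv_l"
  unfolding ph_inv_r_def ph_inv_l_def prodFFF_def
  by ((rule holds_intro, simp, simp, simp, simp, simp only: eval, insert qb[unfolded mu_FFF_def], elim conjE,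
      assumption)[1])+

lemma monad_laws: "holds bassoc" "holds bunit_l" "holds bunit_r"
  unfolding bassoc_def bunit_l_def bunit_r_def 
  by ((rule holds_intro, simp, simp, simp, simp, simp only: eval, insert B_monad, elim conjE, assumption)[1])+

lemma right_module_laws: "holds (rassoc n)" "holds (runit n)" "holds (sig_mul n)" "holds (sig_eta n)" "holds
    (sig_del n)" "holds (ph_r n)" "holds (sig_yb n)" "holds (sig_act n)"
  unfolding rassoc_def runit_def sig_mul_def sig_eta_def sig_del_def ph_r_def sig_yb_def sig_act_def 
  by ((rule holds_intro, simp, simp, simp, simp, simp only: eval, insert R_axioms[of n], elim conjE,
      assumption)[1])+


lemma morphism_laws: "holds (lmor_act n)" "holds (lmor_b n)" "holds (lmor_f n)"
  unfolding lmor_act_def lmor_b_def lmor_f_def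
  by ((rule holds_intro, simp, simp, simp, simp, simp only: eval,
      insert lm[of n, unfolded tambara_mor_def mem_Collect_eq], elim conjE, assumption)[1])+

lemma right_morphism_laws: "holds (rmor_act n)" "holds (rmor_sig n)"
  unfolding rmor_act_def rmor_sig_def
  by ((rule holds_intro, simp, simp, simp, simp, simp only: eval,
      insert rm[of n, unfolded right_tambara_modules_def structured_cells.simps mem_Collect_eq], elim conjE,
          (assumption | erule sym))[1])+

lemma coaction_laws: "holds lam_unit" "holds lam_counit" "holds ph_b"
  unfolding lam_unit_def lam_counit_def ph_b_def
  by ((rule holds_intro, simp, simp, simp, simp, simp only: eval,
      (rule cm(5) | rule counit | rule \<Phi>_B))[1])+

lemma transport_law: "holds (transport n)"
  unfolding transport_def
  by (rule holds_intro, simp, simp, simp, simp, simp only: eval el_0, insert M_axioms[of n], elim conjE, assumption)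

text \<open>The unit object carries the action \<epsilon> and trivial crossings; the axiom relating
  its action to the crossing with B is the claim.\<close>

lemma crb_eps: "holds crb_eps"
proof -
  have "tambara_unit K \<A> F \<epsilon> B \<in> \<T>" using closed by (simp add: tensor_closed_def)
  then have "\<iota> B \<bullet> (\<iota> B \<star> \<epsilon>) = (\<epsilon> \<star> \<iota> B) \<bullet> (\<iota> F \<star> \<iota> B) \<bullet> (\<tau>BF \<star> \<iota> (Id1 K \<A>))"
    unfolding \<T>_eq tambara_objects_def tambara_unit_def by simp
  then have "ev ([Bw] \<odot> [Bw] \<otimes> Cou) = ev (Cou \<otimes> [Bw] \<odot> [Fw] \<otimes> [Bw] \<odot> Crb 0 \<otimes> Wire [])"
    by (simp only: eval)
  moreover have "holds ([Bw] \<odot> [Bw] \<otimes> Cou \<doteq> [Bw] \<otimes> Cou)" "holds (Cou \<otimes> [Bw] \<odot> [Fw] \<otimes> [Bw] \<odot> Crb 0 \<otimes> Wire [] \<doteq>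
      Cou \<otimes> [Bw] \<odot> Crb 0)"
    by (rule derivable_sound[of "[]" "[]"], code_simp, simp)+
  ultimately show ?thesis by (simp add: crb_eps_def holds_def)
qed

lemma crb_act_tensor: "holds crb_act_tensor"
proof -
  have "tambara_tensor K F \<Delta> F0 F0 \<in> \<T>" using closed F0 by (auto simp: tensor_closed_def \<C>_eq)
  then have "tauB (tambara_tensor K F \<Delta> F0 F0) \<bullet> (\<iota> B \<star> act (tambara_tensor K F \<Delta> F0 F0)) =
      (act (tambara_tensor K F \<Delta> F0 F0) \<star> \<iota> B) \<bullet> (\<iota> F \<star> tauB (tambara_tensor K F \<Delta> F0 F0)) \<bullet> (\<tau>BF \<star> \<iota> (cell
          (tambara_tensor K F \<Delta> F0 F0)))"
    unfolding \<T>_eq tambara_objects_def by simp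
  then show ?thesis
    unfolding crb_act_tensor_def Let_def
    by (intro holds_intro) (simp_all add: ltensor_def lmod_def tambara_tensor_def F0_eq eval del: word.simps(2))
qed

sublocale comodule_diagrams K \<A> wire_cell gen_cell
  by unfold_locales (rule module_laws quasi_bimonad_laws Phi_inverse_laws monad_laws right_module_laws
    morphism_laws right_morphism_laws coaction_laws transport_law crb_eps crb_act_tensor)+

section \<open>Translation between diagrams and the conditions on 2-cells\<close>

definition real :: "lstructure \<Rightarrow> ('b, 'c) tambara" where
  "real X = \<lparr>cell = word (lword X), tauB = ev (ltauB X), tauF = ev (ltauF X), act = ev (lact X)\<rparr>"

definition rreal :: "rstructure \<Rightarrow> ('b, 'c) right_tambara" where
  "rreal X = \<lparr>rcell = word (rword X), rtau = ev (rsig X), ract = ev (raction X)\<rparr>"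

lemma real_lmod: "real (lmod n) = M n"
  by (simp add: real_def lmod_def eval del: word.simps(2))

lemma rreal_rmod: "rreal (rmod n) = R n"
  by (simp add: rreal_def rmod_def eval del: word.simps(2))

lemma real_lunit: "real lunit = tambara_unit K \<A> F \<epsilon> B"
  by (simp add: real_def lunit_def tambara_unit_def eval del: word.simps(2))

lemma real_ltensor: "real (ltensor X Y) = tambara_tensor K F \<Delta> (real X) (real Y)"
  by (simp add: real_def ltensor_def tambara_tensor_def eval word_append del: word.simps(2))

lemma rreal_rtensor: "rreal (rtensor X Y) = tens \<R> (rreal X) (rreal Y)"
  by (simp add: rreal_def rtensor_def right_tambara_modules_def eval word_append del: word.simps(2))

lemma ev_rhoD: "ev (rhoD u X Y) = rho_bar K F B (ev u) (real X) (real Y)"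
  by (simp add: rhoD_def rho_bar_def real_def eval del: word.simps(2))

lemma ev_psiD: "ev (psiD X) = psiB K F B coact (real X)"
  by (simp add: psiD_def psiB_def real_def eval del: word.simps(2))

lemma ev_alphaD: "ev (alphaD X Y Z) = tambara_alpha K F \<Phi> (real X) (real Y) (real Z)"
  by (simp add: alphaD_def tambara_alpha_def real_def eval word_append del: word.simps(2))


lemmas ev_real = ev_rhoD ev_psiD ev_alphaD real_lmod real_lunit real_ltensor rreal_rmod rreal_rtensor

lemma rho_hom: "rho_bar K F B (el k) (M i) (M j) \<in> hom2 K (cell (M i) \<cdot> cell (M j)) (cell (M i) \<cdot> cell (M j) \<cdot> B)"
proof -
  have "typed arity (rhoD (El k) (lmod i) (lmod j))" by (simp add: rhoD_def lmod_def)
  from ev_hom[OF this] show ?thesis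
    by (simp add: ev_real) (simp add: rhoD_def lmod_def word_simps del: word.simps(2))
qed

lemma rho_natural': "(lm 1 \<star> lm 2 \<star> \<iota> B) \<bullet> rho_bar K F B \<Phi>L (M 1) (M 2) = rho_bar K F B \<Phi>L (M 5) (M 6) \<bullet> (lm 1
    \<star> lm 2)"
  using ev_eq[OF rho_natural] by (simp add: ev_real eval el_0 del: word.simps(2) One_nat_def)

lemma ev_conv: "ev (conv u v) = ev u \<^bold>* ev v"
  by (simp add: convolution_def conv_def prodFFB_def mu_FFB_def eval del: word.simps(2))

lemma ev_oneFFB: "ev oneFFB = \<eta> \<star> \<eta> \<star> \<eta>B"
  by (simp add: oneFFB_def)

lemma ev_leftmult: "ev (leftmult u) = (\<iota> (F \<cdot> F) \<star> \<mu>B) \<bullet> (ev u \<star> \<iota> B)"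
  by (simp add: leftmult_def eval del: word.simps(2))

lemma conv_hom: "el i \<^bold>* el j \<in> elements"
proof -
  have "typed arity (conv (El i) (El j))" by (simp add: conv_def prodFFB_def)
  from ev_hom[OF this] show ?thesis
    by (simp add: ev_conv elements_def) (simp add: conv_def prodFFB_def word_simps del: word.simps(2))
qed

lemma rho_conv': "(\<iota> (cell (M 1) \<cdot> cell (M 2)) \<star> \<mu>B) \<bullet> (rho_bar K F B (el 1) (M 1) (M 2) \<star> \<iota> B) \<bullet> rho_bar K F
    B (el 2) (M 1) (M 2)
    = rho_bar K F B (el 1 \<^bold>* el 2) (M 1) (M 2)"
  using ev_eq[OF rho_conv] by (simp add: ev_real ev_conv eval del: word.simps(2) One_nat_def)

lemma rho_one': "rho_bar K F B (\<eta> \<star> \<eta> \<star> \<eta>B) (M 1) (M 2) = \<iota> (cell (M 1) \<cdot> cell (M 2)) \<star> \<eta>B"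
  using ev_eq[OF rho_one] by (simp add: ev_real ev_oneFFB eval del: word.simps(2) One_nat_def)

abbreviation "left_by u \<equiv> (\<iota> (F \<cdot> F) \<star> \<mu>B) \<bullet> (u \<star> \<iota> B)"

lemma conv_left_by: "el 1 \<^bold>* el 2 = left_by (rho_bar K F B (el 1) F0 F0) \<bullet> el 2"
  using ev_eq[OF conv_leftmult] by (simp add: ev_real ev_conv ev_leftmult M_0 del: One_nat_def)

lemma left_by_conv: "left_by (rho_bar K F B (el 1) F0 F0) \<bullet> left_by (rho_bar K F B (el 2) F0 F0) \<bullet> el 3
    = left_by (rho_bar K F B (el 1 \<^bold>* el 2) F0 F0) \<bullet> el 3"
  using ev_eq[OF leftmult_conv] by (simp add: ev_real ev_conv ev_leftmult M_0 del: One_nat_def)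

lemma left_by_one: "left_by (rho_bar K F B (\<eta> \<star> \<eta> \<star> \<eta>B) F0 F0) \<bullet> el 1 = el 1"
  using ev_eq[OF leftmult_one] by (simp add: ev_real ev_oneFFB ev_leftmult M_0 del: One_nat_def)

lemma left_by_one_right: "left_by (rho_bar K F B (el 1) F0 F0) \<bullet> (\<eta> \<star> \<eta> \<star> \<eta>B) = el 1"
  using ev_eq[OF leftmult_one_right] by (simp add: ev_real ev_oneFFB ev_leftmult M_0 del: One_nat_def)

lemma left_by_inv:
  assumes "(\<iota> (F \<cdot> F) \<star> \<mu>B) \<bullet> (inv \<star> \<iota> B) \<bullet> rho_bar K F B (el 1) F0 F0 = \<iota> (F \<cdot> F) \<star> \<eta>B"
  shows "left_by inv \<bullet> left_by (rho_bar K F B (el 1) F0 F0) \<bullet> el 2 = left_by (\<iota> (F \<cdot> F) \<star> \<eta>B) \<bullet> el 2"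
  using ev_eq[OF leftmult_Inv] assms
  by (simp add: ev_real ev_leftmult eval del: word.simps(2) One_nat_def) (simp add: M_0)

lemma left_by_inv_right:
  assumes "(\<iota> (F \<cdot> F) \<star> \<mu>B) \<bullet> (rho_bar K F B (el 1) F0 F0 \<star> \<iota> B) \<bullet> inv = \<iota> (F \<cdot> F) \<star> \<eta>B"
  shows "left_by (rho_bar K F B (el 1) F0 F0) \<bullet> inv \<bullet> (\<eta> \<star> \<eta>) = \<eta> \<star> \<eta> \<star> \<eta>B"
  using ev_eq[OF leftmult_Inv_right] ev_eq[OF unit_Eta_Eta] assms
  by (simp add: ev_real ev_leftmult ev_oneFFB eval del: word.simps(2) One_nat_def) (simp add: M_0)

lemma left_by_unit: "left_by (\<iota> (F \<cdot> F) \<star> \<eta>B) \<bullet> el 1 = el 1"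
  using ev_eq[OF leftmult_unit] by (simp add: ev_leftmult eval del: word.simps(2) One_nat_def)

lemma inv_eta: "inv \<bullet> (\<eta> \<star> \<eta>) \<in> elements"
proof -
  have "typed arity (Inv \<odot> Eta \<otimes> Eta)" by simp
  from ev_hom[OF this] show ?thesis by (simp add: elements_def word_simps del: word.simps(2))
qed

lemma ev_deltaM: "ev deltaM = \<Delta>M"
  by (simp add: deltaM_def \<Delta>M_eq eval el_0 del: word.simps(2))

lemma ev_epsM: "ev epsM = \<epsilon>M"
  by (simp add: epsM_def \<epsilon>M_eq)

lemma ev_psiF: "ev psiF = \<psi>"
  by (simp add: psiF_def \<psi>_eq eval del: word.simps(2))

lemma ev_rightmult_Phi: "ev (rightmult Phi) = \<beta>"
  by (simp add: rightmult_def prodFFF_def mu_FFF_def \<beta>_eq eval del: word.simps(2))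

lemmas ev_datum = ev_deltaM ev_epsM ev_psiF

lemma linear_at_iff: "linear_at (M 1) (M 2) \<longleftrightarrow>
    rho_bar K F B (ev linsource) (M 1) (M 2) = rho_bar K F B (ev lintarget) (M 1) (M 2)"
  using ev_eq[OF linear_source] ev_eq[OF linear_target]
  by (simp add: linear_at_def ev_real eval el_0 del: word.simps(2) One_nat_def)

lemma datum_linear_iff: "datum_linear \<longleftrightarrow> ev linsource = ev lintarget"
  using ev_eq[OF datum_linear_source] ev_eq[OF datum_linear_target]
  by (simp add: datum_linear_def ev_datum eval el_0 del: word.simps(2))

lemma linear_at: "datum_linear \<Longrightarrow> linear_at (M 1) (M 2)"
  by (simp only: linear_at_iff datum_linear_iff)

text \<open>Evaluation on units is available at number 0, linearity at numbers 1 and 2; the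
  additional assumptions make all three denote F.\<close>

lemma linear_at_F0:
  assumes "linear_at (M 1) (M 2)" and "M 1 = F0" "M 2 = F0" shows datum_linear
proof -
  let ?e = "ev ([Bw] \<otimes> Eta \<otimes> Eta)"
  have "ev linsource = rho_bar K F B (ev linsource) F0 F0 \<bullet> ?e"
    using ev_eq[OF rho_linsource] by (simp only: ev.simps(4) ev_rhoD real_lmod M_0)
  also have "rho_bar K F B (ev linsource) F0 F0 = rho_bar K F B (ev lintarget) F0 F0"
    using iffD1[OF linear_at_iff assms(1)] by (simp only: assms(2,3))
  also have "\<dots> \<bullet> ?e = ev lintarget"
    using ev_eq[OF rho_lintarget] by (simp only: ev.simps(4) ev_rhoD real_lmod M_0)
  finally show ?thesis by (simp only: datum_linear_iff)
qed

text \<open>The operator depends on \<open>u\<close> only through \<open>ev u\<close>, and on the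
  modules only through \<open>real\<close>. So an equation of elements passes to all modules, and an
  equation at numbers 1, 2, 3 passes to number 0 when the modules agree.\<close>

lemma ev_actB3: "ev (actB3 u X Y Z) = (act (real X) \<star> act (real Y) \<star> act (real Z) \<star> \<iota> B)
    \<bullet> (\<iota> F \<star> tauF (real X) \<star> tauF (real Y) \<star> tauB (real Z))
    \<bullet> (\<iota> (F \<cdot> F) \<star> tauF (real X) \<star> tauB (real Y) \<star> \<iota> (cell (real Z)))
    \<bullet> (\<iota> (F \<cdot> F \<cdot> F) \<star> tauB (real X) \<star> \<iota> (cell (real Y) \<cdot> cell (real Z)))
    \<bullet> (ev u \<star> \<iota> (cell (real X) \<cdot> cell (real Y) \<cdot> cell (real Z)))"
  by (simp add: actB3_def real_def eval word_append del: word.simps(2))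

lemma ev_actB1: "ev (actB1 u X) = (act (real X) \<star> \<iota> B) \<bullet> (\<iota> F \<star> tauB (real X)) \<bullet> (ev u \<star> \<iota> (cell (real X)))"
  by (simp add: actB1_def real_def eval word_append del: word.simps(2))

lemma cocycle_at_iff: "cocycle_at (M 1) (M 2) (M 3) \<longleftrightarrow>
    ev (actB3 (rightmult Ph \<otimes> [Bw] \<odot> cocL) (lmod 1) (lmod 2) (lmod 3)) = ev (actB3 cocR (lmod 1) (lmod 2) (lmod 3))"
  using ev_eq[OF cocycle_left] ev_eq[OF cocycle_right]
  by (simp add: cocycle_at_def ev_real ev_psiD ev_alphaD eval el_0 del: word.simps(2) One_nat_def)

lemma datum_cocycle_iff: "datum_cocycle \<longleftrightarrow> ev (rightmult Phi \<otimes> [Bw] \<odot> cocR) = ev cocL"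
proof -
  have "ev cocL = (\<iota> (F \<cdot> F \<cdot> F) \<star> \<mu>B) \<bullet> (\<iota> F \<star> \<Delta>M \<star> \<iota> B) \<bullet> \<Phi>L"
    by (simp add: cocL_def ev_datum eval el_0 del: word.simps(2))
  then show ?thesis
    unfolding ev_eq[OF datum_cocycle, symmetric]
    by (simp add: datum_cocycle_def ev_datum ev_rightmult_Phi eval el_0 del: word.simps(2))
qed

lemma cocycle_at: assumes datum_cocycle shows "cocycle_at (M 1) (M 2) (M 3)"
proof -
  \<comment> \<open>Applying \<open>rightmult Ph\<close> to both sides of the pentagon of the datum
    cancels \<beta>.\<close>
  have "ev (rightmult Ph \<otimes> [Bw] \<odot> cocL) = ev cocR"
    using assms rightmult_inverse_right unfolding datum_cocycle_iff by (simp only: ev.simps(4))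
  then show ?thesis by (simp only: cocycle_at_iff ev_actB3)
qed

lemma cocycle_at_F0:
  assumes "cocycle_at (M 1) (M 2) (M 3)" and "M 1 = F0" "M 2 = F0" "M 3 = F0" shows datum_cocycle
proof -
  let ?a = "rightmult Ph \<otimes> [Bw] \<odot> cocL" and ?e = "ev (Eta \<otimes> Eta \<otimes> Eta)"
  have "ev ?a = ev (actB3 ?a (lmod 0) (lmod 0) (lmod 0)) \<bullet> ?e"
    using ev_eq[OF actB3_left] by (simp only: ev.simps(4))
  also have "ev (actB3 ?a (lmod 0) (lmod 0) (lmod 0)) = ev (actB3 cocR (lmod 0) (lmod 0) (lmod 0))"
    using iffD1[OF cocycle_at_iff assms(1)] by (simp only: ev_actB3 real_lmod M_0 assms(2-4))
  also have "\<dots> \<bullet> ?e = ev cocR"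
    using ev_eq[OF actB3_right] by (simp only: ev.simps(4))
  finally show ?thesis using rightmult_inverse_left by (simp add: datum_cocycle_iff)
qed

lemma datum_normalized_iff: "datum_normalized \<longleftrightarrow> ev couL = \<eta> \<star> \<eta>B \<and> ev couR = \<eta> \<star> \<eta>B"
  unfolding ev_eq[OF datum_unit_left, symmetric] ev_eq[OF datum_unit_right, symmetric]
  by (simp add: datum_normalized_def ev_datum eval el_0 del: word.simps(2))

lemma normalized_at_iff: "normalized_at (M 1) \<longleftrightarrow>
    ev (actB1 couR (lmod 1)) = \<iota> (cell (M 1)) \<star> \<eta>B \<and> ev (actB1 couL (lmod 1)) = \<iota> (cell (M 1)) \<star> \<eta>B"
  unfolding ev_eq[OF rho_unit_left, symmetric] ev_eq[OF rho_unit_right, symmetric]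
  by (simp add: normalized_at_def ev_real el_0 del: One_nat_def)

lemma normalized_at: "datum_normalized \<Longrightarrow> normalized_at (M 1)"
  using ev_eq[OF actB1_one]
  by (simp add: normalized_at_iff datum_normalized_iff ev_actB1 eval del: word.simps(2) One_nat_def)

lemma normalized_at_F0:
  assumes "normalized_at (M 1)" and "M 1 = F0" shows datum_normalized
proof -
  have 1: "ev (actB1 couR (lmod 0)) = ev ([Fw] \<otimes> EtaB)" "ev (actB1 couL (lmod 0)) = ev ([Fw] \<otimes> EtaB)"
    using iffD1[OF normalized_at_iff assms(1)]
    by (simp_all add: ev_actB1 real_lmod M_0 assms(2) eval del: word.simps(2) One_nat_def)
  show ?thesis
    using ev_eq[OF actB1_couR] ev_eq[OF actB1_couL] ev_eq[OF unit_Eta]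
    unfolding datum_normalized_iff ev.simps(4) 1 by simp
qed

lemma datum_counit: "\<mu>B \<bullet> (\<epsilon>M \<star> \<iota> B) \<bullet> coact = \<mu>B \<bullet> (\<iota> B \<star> (\<epsilon>M \<bullet> \<eta>))"
  using ev_eq[OF datum_counit_source] ev_eq[OF datum_counit_target]
  by (simp add: ev_datum eval del: word.simps(2))

lemma datum_element: "\<Delta>M \<bullet> \<eta> = \<Phi>L"
  using ev_eq[OF deltaM_Eta] by (simp add: ev_datum el_0)

lemma datum_homs: "\<Delta>M \<in> hom2 K F (F \<cdot> F \<cdot> B)" "\<epsilon>M \<in> hom2 K F B"
proof -
  have "typed arity deltaM" "typed arity epsM" by (simp_all add: deltaM_def epsM_def)
  from this[THEN ev_hom] show "\<Delta>M \<in> hom2 K F (F \<cdot> F \<cdot> B)" "\<epsilon>M \<in> hom2 K F B"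
    unfolding ev_datum by (simp_all add: deltaM_def epsM_def word_simps del: word.simps(2))
qed

lemma ev_ractD: "ev (ractD p X Y Z) = right_action (ev p) (rreal X) (rreal Y) (rreal Z)"
  by (simp add: ractD_def right_action_def rreal_def eval word_append del: word.simps(2))

lemma right_action_natural: "(rm 0 \<star> rm 1 \<star> rm 2) \<bullet> right_action \<Phi>i (R 0) (R 1) (R 2)
    = right_action \<Phi>i (R 4) (R 5) (R 6) \<bullet> (rm 0 \<star> rm 1 \<star> rm 2)"
  using ev_eq[OF ract_natural] by (simp add: ev_ractD ev_real del: One_nat_def)

lemma right_action_hom: "right_action \<Phi>i (R 0) (R 1) (R 2) \<in> hom2 K (rcell (R 0) \<cdot> rcell (R 1) \<cdot> rcell (R 2))
    (rcell (R 0) \<cdot> rcell (R 1) \<cdot> rcell (R 2))"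
proof -
  have "typed arity (ractD Phi (rmod 0) (rmod 1) (rmod 2))" by (simp add: ractD_def rmod_def)
  from ev_hom[OF this] show ?thesis
    by (simp add: ev_ractD ev_real del: One_nat_def) (simp add: ractD_def rmod_def word_simps del: word.simps(2))
qed

lemma composite_inverse:
  assumes "f \<in> hom2 K X X" "g \<in> hom2 K X X" "f' \<in> hom2 K X X" "g' \<in> hom2 K X X"
    and "f' \<bullet> f = \<iota> X" "g' \<bullet> g = \<iota> X"
  shows "(f' \<bullet> g') \<bullet> (g \<bullet> f) = \<iota> X"
proof -
  have "(f' \<bullet> g') \<bullet> (g \<bullet> f) = f' \<bullet> (g' \<bullet> (g \<bullet> f))"
    by (rule vcomp_assoc) (use assms vcomp_cell in blast)+
  also have "g' \<bullet> (g \<bullet> f) = (g' \<bullet> g) \<bullet> f"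
    by (rule vcomp_assoc[symmetric]) (use assms in blast)+
  finally show ?thesis using assms vcomp_id[of f] by simp
qed

lemma inverse_unique:
  assumes "f \<in> hom2 K X X" "g \<in> hom2 K X X" "h \<in> hom2 K X X" and "f \<bullet> g = \<iota> X" "g \<bullet> h = \<iota> X"
  shows "f = h"
proof -
  have "(f \<bullet> g) \<bullet> h = f \<bullet> (g \<bullet> h)" by (rule vcomp_assoc) (use assms in blast)+
  then show ?thesis using assms vcomp_id[of f] vcomp_id[of h] by simp
qed

lemma right_action_cocycle:
  "(\<iota> (rcell (R 0)) \<star> right_action \<Phi>i (R 1) (R 2) (R 3)) \<bullet> right_action \<Phi>i (R 0) (tens \<R> (R 1) (R 2)) (R 3)
      \<bullet> (right_action \<Phi>i (R 0) (R 1) (R 2) \<star> \<iota> (rcell (R 3)))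
    = right_action \<Phi>i (R 0) (R 1) (tens \<R> (R 2) (R 3)) \<bullet> right_action \<Phi>i (tens \<R> (R 0) (R 1)) (R 2) (R 3)"
proof -
  let ?X = "word [Rw 0, Rw 1, Rw 2, Rw 3]"
  \<comment> \<open>The five factors of the pentagon on four modules, for \<open>Ph\<close> and
    \<open>Phi\<close> simultaneously.\<close>
  define a where "a p = ev (ractD p (rmod 0) (rmod 1) (rmod 2) \<otimes> [Rw 3])" for p
  define b where "b p = ev (ractD p (rmod 0) (rtensor (rmod 1) (rmod 2)) (rmod 3))" for p
  define c where "c p = ev ([Rw 0] \<otimes> ractD p (rmod 1) (rmod 2) (rmod 3))" for p
  define d where "d p = ev (ractD p (rtensor (rmod 0) (rmod 1)) (rmod 2) (rmod 3))" for p
  define e where "e p = ev (ractD p (rmod 0) (rmod 1) (rtensor (rmod 2) (rmod 3)))" for p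
  note defs = a_def b_def c_def d_def e_def
  have hom: "a p \<in> hom2 K ?X ?X" "b p \<in> hom2 K ?X ?X" "c p \<in> hom2 K ?X ?X" "d p \<in> hom2 K ?X ?X" "e p \<in> hom2 K ?X ?X"
    if "p = Ph \<or> p = Phi" for p
  proof -
    have p: "arity p = ([], [Fw, Fw, Fw])" using that by auto
    have ev: "ev t \<in> hom2 K ?X ?X" if "typed arity t" "dmw arity t = [Rw 0, Rw 1, Rw 2, Rw 3]" "cdw arity t =
        [Rw 0, Rw 1, Rw 2, Rw 3]" for t
      using ev_hom[OF that(1)] that by simp
    show "a p \<in> hom2 K ?X ?X" "b p \<in> hom2 K ?X ?X" "c p \<in> hom2 K ?X ?X" "d p \<in> hom2 K ?X ?X" "e p \<in> hom2 K ?X ?X"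
      unfolding defs by - (rule ev; simp add: p ractD_def rmod_def rtensor_def)+
  qed
  have inverses: "a Phi \<bullet> a Ph = \<iota> ?X" "b Phi \<bullet> b Ph = \<iota> ?X" "c Phi \<bullet> c Ph = \<iota> ?X" "d Ph \<bullet> d Phi = \<iota> ?X" "e Ph
      \<bullet> e Phi = \<iota> ?X"
    using ract_inverse_xyz_w ract_inverse_x_yz_w ract_inverse_x_yzw ract_inverse_xy_z_w ract_inverse_x_y_zw
    unfolding defs ev.simps(4) by (simp_all only: ev.simps(1))
  have cocycle: "a Ph \<bullet> b Ph \<bullet> c Ph = d Ph \<bullet> e Ph"
    using ract_Ph_cocycle unfolding defs ev.simps(4) .
  \<comment> \<open>The two sides of the pentagon for \<open>Ph\<close> are one and the same 2-cell.
    Inverting its factors along one side gives a left inverse and along the other a right inverse;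
    these two coincide, which is the 3-cocycle identity for \<open>Phi\<close>.\<close>
  have ab: "(b Phi \<bullet> a Phi) \<bullet> (a Ph \<bullet> b Ph) = \<iota> ?X"
    using hom inverses by (intro composite_inverse) auto
  have "(c Phi \<bullet> (b Phi \<bullet> a Phi)) \<bullet> ((a Ph \<bullet> b Ph) \<bullet> c Ph) = \<iota> ?X"
    by (rule composite_inverse[OF _ _ _ _ inverses(3) ab]; (intro vcomp_cell[where X = ?X and Y = ?X and Z =
        ?X] hom; simp))
  moreover have "(a Ph \<bullet> b Ph) \<bullet> c Ph = a Ph \<bullet> b Ph \<bullet> c Ph"
    using hom by (intro vcomp_assoc) auto
  ultimately have left: "(c Phi \<bullet> (b Phi \<bullet> a Phi)) \<bullet> (d Ph \<bullet> e Ph) = \<iota> ?X"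
    by (simp only: cocycle)
  have right: "(d Ph \<bullet> e Ph) \<bullet> (e Phi \<bullet> d Phi) = \<iota> ?X"
    using hom inverses by (intro composite_inverse) auto
  have "c Phi \<bullet> (b Phi \<bullet> a Phi) = e Phi \<bullet> d Phi"
    by (rule inverse_unique[OF _ _ _ left right]; (intro vcomp_cell[where X = ?X and Y = ?X and Z = ?X] hom; simp))
  then show ?thesis
    unfolding defs by (simp add: ev_ractD ev_real eval del: word.simps(2) One_nat_def)
qed

end

text \<open>The first argument is the value at 0 and also the default from 4 on, so that typing
  assumptions quantified over all numbers remain satisfied.\<close>

definition pick :: "'x \<Rightarrow> 'x \<Rightarrow> 'x \<Rightarrow> 'x \<Rightarrow> nat \<Rightarrow> 'x" where
  "pick a b c d n = (if n = 1 then b else if n = 2 then c else if n = 3 then d else a)"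

text \<open>From index 4 on the sequence is periodic, so that all morphisms from index \<open>n\<close> to \<open>n + 4\<close> with
  \<open>n \<ge> 4\<close> can be identities.\<close>

definition stage :: "(nat \<Rightarrow> 'x) \<Rightarrow> (nat \<Rightarrow> 'x) \<Rightarrow> nat \<Rightarrow> 'x" where
  "stage f g n = (if n < 4 then f n else g (n mod 4))"

lemma stage_shift: "stage f g (n + 4) = g (n mod 4)"
  by (simp add: stage_def)

section \<open>Choice of the values and assembly of the equivalence\<close>

context hausser_nill_setting
begin

lemma \<C>_cell: "X \<in> \<C> \<Longrightarrow> cell X \<in> endo K \<A>"
  by (simp add: \<C>_eq \<T>_eq tambara_objects_def left_tambara_def left_module_def)

lemma F_endo: "F \<in> endo K \<A>" and B_endo: "B \<in> endo K \<A>"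
  using qb B_monad by auto

lemma vcomp_id_left: "f \<in> hom2 K X Y \<Longrightarrow> \<iota> Y \<bullet> f = f" and vcomp_id_right: "f \<in> hom2 K X Y \<Longrightarrow> f \<bullet> \<iota> X = f"
  using vcomp_id by auto

lemma hcomp_id_endo: "X \<in> endo K \<A> \<Longrightarrow> Y \<in> endo K \<A> \<Longrightarrow> \<iota> X \<star> \<iota> Y = \<iota> (X \<cdot> Y)"
  using hcomp_id2 by (auto simp: endo_def)

lemma identity_tambara_mor:
  assumes "X \<in> \<C>" shows "\<iota> (cell X) \<in> tambara_mor K F B X X"
proof -
  have homs: "act X \<in> hom2 K (F \<cdot> cell X) (cell X)" "tauB X \<in> hom2 K (B \<cdot> cell X) (cell X \<cdot> B)"
    "tauF X \<in> hom2 K (F \<cdot> cell X) (cell X \<cdot> F)"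
    using assms by (auto simp: \<C>_eq \<T>_eq tambara_objects_def left_tambara_def left_module_def EM_cell_def)
  show ?thesis
    using \<C>_cell[OF assms] F_endo B_endo id2_cell
    by (auto simp: tambara_mor_def hcomp_id_endo homs[THEN vcomp_id_left] homs[THEN vcomp_id_right] endo_def)
qed

lemma identity_right_mor:
  assumes "X \<in> Objs \<R>" shows "\<iota> (rcell X) \<in> Mors \<R> X X"
proof -
  have homs: "ract X \<in> hom2 K (rcell X \<cdot> F) (rcell X)" "rtau X \<in> hom2 K (rcell X \<cdot> F) (F \<cdot> rcell X)"
    and cell: "rcell X \<in> endo K \<A>"
    using assms by (auto simp: right_tambara_modules_def is_right_tambara_def right_module_def)
  show ?thesis
    using cell F_endo id2_cell
    by (auto simp: right_tambara_modules_def hcomp_id_endo homs[THEN vcomp_id_left] homs[THEN vcomp_id_right]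
        endo_def)
qed

lemma instance_stage:
  assumes "\<And>n. M n \<in> \<C>" "\<And>n. M' n \<in> \<C>" "M 0 = F0" "\<And>n. R n \<in> Objs \<R>" "\<And>n. R' n \<in> Objs \<R>"
    and "\<And>n. f n \<in> tambara_mor K F B (M n) (M' n)" "\<And>n. g n \<in> Mors \<R> (R n) (R' n)"
    and "el 0 = \<Phi>L" "\<And>n. el n \<in> elements" and "i \<in> hom2 K (F \<cdot> F) (F \<cdot> F \<cdot> B)"
  shows "hausser_nill_instance K \<A> F B \<mu> \<eta> \<Delta> \<epsilon> \<tau> \<Phi> \<Phi>i \<mu>B \<eta>B coact \<tau>BF \<psi> \<Phi>L \<Delta>M \<epsilon>M \<beta> \<T> \<C> F0
    (stage M M') (stage R R') el i (stage f (\<lambda>n. \<iota> (cell (M' n)))) (stage g (\<lambda>n. \<iota> (rcell (R' n))))"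
proof unfold_locales
  fix n
  show "stage f (\<lambda>n. \<iota> (cell (M' n))) n \<in> tambara_mor K F B (stage M M' n) (stage M M' (n + 4))"
    unfolding stage_shift using assms identity_tambara_mor by (auto simp: stage_def)
  show "stage g (\<lambda>n. \<iota> (rcell (R' n))) n \<in> Mors \<R> (stage R R' n) (stage R R' (n + 4))"
    unfolding stage_shift using assms identity_right_mor by (auto simp: stage_def)
qed (use assms in \<open>auto simp: stage_def\<close>)

lemma \<Phi>L: "\<Phi>L \<in> elements"
  using \<Phi>L_hom by (simp add: elements_def)

text \<open>The default value of the generator \<open>Inv\<close> for identities in which no inverse
  occurs.\<close>

lemma FF_etaB: "\<iota> (F \<cdot> F) \<star> \<eta>B \<in> hom2 K (F \<cdot> F) (F \<cdot> F \<cdot> B)"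
proof -
  have FF: "F \<cdot> F \<in> Cells1 K" "src K (F \<cdot> F) = \<A>" "trg K (F \<cdot> F) = \<A>"
    using F_endo comp1_cell[of F F] by (auto simp: endo_def)
  have "trg K (Id1 K \<A>) = \<A>" using Id1_cell[OF \<A>] by (simp add: endo_def)
  then have "\<iota> (F \<cdot> F) \<star> \<eta>B \<in> hom2 K ((F \<cdot> F) \<cdot> Id1 K \<A>) ((F \<cdot> F) \<cdot> B)"
    using FF B_monad by (intro hcomp_cell id2_cell) auto
  moreover have "(F \<cdot> F) \<cdot> Id1 K \<A> = F \<cdot> F" using comp1_Id[OF FF(1)] FF by simp
  moreover have "(F \<cdot> F) \<cdot> B = F \<cdot> F \<cdot> B" using F_endo B_endo by (intro comp1_assoc) (auto simp: endo_def)
  ultimately show ?thesis by simp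
qed

lemma left_instance:
  assumes "X \<in> \<C>" "Y \<in> \<C>" "Z \<in> \<C>" "u \<in> elements" "v \<in> elements" "w \<in> elements" "i \<in> hom2 K (F \<cdot> F) (F \<cdot> F \<cdot> B)"
  shows "hausser_nill_instance K \<A> F B \<mu> \<eta> \<Delta> \<epsilon> \<tau> \<Phi> \<Phi>i \<mu>B \<eta>B coact \<tau>BF \<psi> \<Phi>L \<Delta>M \<epsilon>M \<beta> \<T> \<C> F0
    (stage (pick F0 X Y Z) (pick F0 X Y Z)) (stage (\<lambda>_. R0) (\<lambda>_. R0)) (pick \<Phi>L u v w) i
    (stage (\<lambda>n. \<iota> (cell (pick F0 X Y Z n))) (\<lambda>n. \<iota> (cell (pick F0 X Y Z n)))) (stage (\<lambda>_. \<iota> (rcell R0)) (\<lambda>_. \<iota>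
        (rcell R0)))"
proof -
  have "pick F0 X Y Z n \<in> \<C>" "pick \<Phi>L u v w n \<in> elements" for n
    using assms F0 \<Phi>L by (auto simp: pick_def)
  then show ?thesis
    by (intro instance_stage R0 identity_tambara_mor identity_right_mor assms) (auto simp: pick_def)
qed

lemmas F0_instance = left_instance[OF F0 F0 F0]
lemmas cell_instance = left_instance[OF _ _ _ \<Phi>L \<Phi>L \<Phi>L FF_etaB]

lemma cocycle_natural: "cocycle_natural K F B \<C> (rho_bar K F B \<Phi>L)"
  unfolding cocycle_natural_def
proof (intro ballI)
  fix X X' Y Y' f g
  assume XY: "X \<in> \<C>" "X' \<in> \<C>" "Y \<in> \<C>" "Y' \<in> \<C>" "f \<in> tambara_mor K F B X X'" "g \<in> tambara_mor K F B Y Y'"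
  \<comment> \<open>The sources X, Y receive the numbers 1, 2; the second family then places the
    targets at 5 and 6.\<close>
  have "hausser_nill_instance K \<A> F B \<mu> \<eta> \<Delta> \<epsilon> \<tau> \<Phi> \<Phi>i \<mu>B \<eta>B coact \<tau>BF \<psi> \<Phi>L \<Delta>M \<epsilon>M \<beta> \<T> \<C> F0
    (stage (pick F0 X Y F0) (pick F0 X' Y' F0)) (stage (\<lambda>_. R0) (\<lambda>_. R0)) (\<lambda>_. \<Phi>L) (\<iota> (F \<cdot> F) \<star> \<eta>B)
    (stage (pick (\<iota> (cell F0)) f g (\<iota> (cell F0))) (\<lambda>n. \<iota> (cell (pick F0 X' Y' F0 n))))
    (stage (\<lambda>_. \<iota> (rcell R0)) (\<lambda>_. \<iota> (rcell R0)))"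
    using XY F0 by (intro instance_stage R0 identity_right_mor \<Phi>L FF_etaB) (auto simp: pick_def
        identity_tambara_mor)
  from hausser_nill_instance.rho_natural'[OF this]
  show "(f \<star> g \<star> \<iota> B) \<bullet> rho_bar K F B \<Phi>L X Y = rho_bar K F B \<Phi>L X' Y' \<bullet> (f \<star> g)"
    by (simp add: stage_def pick_def)
qed

lemma cocycle_linear_iff: "cocycle_linear K F \<Delta> B \<mu>B coact \<C> (rho_bar K F B \<Phi>L) \<longleftrightarrow> datum_linear"
proof -
  have "cocycle_linear K F \<Delta> B \<mu>B coact \<C> (rho_bar K F B \<Phi>L) \<longleftrightarrow> (\<forall>X\<in>\<C>. \<forall>Y\<in>\<C>. linear_at X Y)"
    unfolding cocycle_linear_def linear_at_def ..
  moreover have "linear_at X Y" if datum_linear "X \<in> \<C>" "Y \<in> \<C>" for X Y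
    using hausser_nill_instance.linear_at[OF cell_instance[OF that(2,3) F0] that(1)] by (simp add: stage_def
        pick_def)
  moreover have datum_linear if "linear_at F0 F0"
    using hausser_nill_instance.linear_at_F0[OF cell_instance[OF F0 F0 F0]] that by (simp add: stage_def pick_def)
  ultimately show ?thesis using F0 by blast
qed

lemma cocycle_condition_iff: "cocycle_condition K F \<Delta> \<Phi> B \<mu>B coact \<C> (rho_bar K F B \<Phi>L) \<longleftrightarrow> datum_cocycle"
proof -
  have "cocycle_condition K F \<Delta> \<Phi> B \<mu>B coact \<C> (rho_bar K F B \<Phi>L) \<longleftrightarrow> (\<forall>X\<in>\<C>. \<forall>Y\<in>\<C>. \<forall>Z\<in>\<C>. cocycle_at X Y Z)"
    unfolding cocycle_condition_def cocycle_at_def ..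
  moreover have "cocycle_at X Y Z" if datum_cocycle "X \<in> \<C>" "Y \<in> \<C>" "Z \<in> \<C>" for X Y Z
    using hausser_nill_instance.cocycle_at[OF cell_instance[OF that(2,3,4)] that(1)] by (simp add: stage_def
        pick_def)
  moreover have datum_cocycle if "cocycle_at F0 F0 F0"
    using hausser_nill_instance.cocycle_at_F0[OF cell_instance[OF F0 F0 F0]] that by (simp add: stage_def pick_def)
  ultimately show ?thesis using F0 by blast
qed

lemma cocycle_normalized_iff: "cocycle_normalized K \<A> F \<epsilon> B \<eta>B \<C> (rho_bar K F B \<Phi>L) \<longleftrightarrow> datum_normalized"
proof -
  have "cocycle_normalized K \<A> F \<epsilon> B \<eta>B \<C> (rho_bar K F B \<Phi>L) \<longleftrightarrow> (\<forall>X\<in>\<C>. normalized_at X)"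
    unfolding cocycle_normalized_def normalized_at_def ..
  moreover have "normalized_at X" if datum_normalized "X \<in> \<C>" for X
    using hausser_nill_instance.normalized_at[OF cell_instance[OF that(2) F0 F0] that(1)] by (simp add:
        stage_def pick_def)
  moreover have datum_normalized if "normalized_at F0"
    using hausser_nill_instance.normalized_at_F0[OF cell_instance[OF F0 F0 F0]] that by (simp add: stage_def
        pick_def)
  ultimately show ?thesis using F0 by blast
qed

lemma convolution_invertible_iff: "convolution_invertible K \<A> F \<mu> \<eta> \<tau> B \<mu>B \<eta>B \<tau>BF \<Phi>L \<longleftrightarrow>
    (\<exists>u\<in>elements. \<Phi>L \<^bold>* u = \<eta> \<star> \<eta> \<star> \<eta>B \<and> u \<^bold>* \<Phi>L = \<eta> \<star> \<eta> \<star> \<eta>B)"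
  by (simp add: convolution_invertible_def elements_def convolution_def)

lemma convolution_inverse_rho:
  assumes "u \<in> elements" "v \<in> elements" "u \<^bold>* v = \<eta> \<star> \<eta> \<star> \<eta>B" "X \<in> \<C>" "Y \<in> \<C>"
  shows "(\<iota> (cell X \<cdot> cell Y) \<star> \<mu>B) \<bullet> (rho_bar K F B u X Y \<star> \<iota> B) \<bullet> rho_bar K F B v X Y = \<iota> (cell X \<cdot> cell Y) \<star> \<eta>B"
  using hausser_nill_instance.rho_conv'[OF left_instance[OF assms(4,5) F0 assms(1,2) \<Phi>L FF_etaB]]
    hausser_nill_instance.rho_one'[OF left_instance[OF assms(4,5) F0 assms(1,2) \<Phi>L FF_etaB]] assms(3)
  by (simp add: stage_def pick_def)

lemma rho_inverse_convolution:
  assumes u: "u \<in> elements" and i: "i \<in> hom2 K (F \<cdot> F) (F \<cdot> F \<cdot> B)"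
    and left: "(\<iota> (F \<cdot> F) \<star> \<mu>B) \<bullet> (i \<star> \<iota> B) \<bullet> rho_bar K F B u F0 F0 = \<iota> (F \<cdot> F) \<star> \<eta>B"
    and right: "(\<iota> (F \<cdot> F) \<star> \<mu>B) \<bullet> (rho_bar K F B u F0 F0 \<star> \<iota> B) \<bullet> i = \<iota> (F \<cdot> F) \<star> \<eta>B"
  defines "v \<equiv> i \<bullet> (\<eta> \<star> \<eta>)" and "one \<equiv> \<eta> \<star> \<eta> \<star> \<eta>B"
  shows "v \<in> elements" "u \<^bold>* v = one" "v \<^bold>* u = one"
proof -
  let ?L = "\<lambda>i. (\<iota> (F \<cdot> F) \<star> \<mu>B) \<bullet> (i \<star> \<iota> B)"
  have inst: "hausser_nill_instance K \<A> F B \<mu> \<eta> \<Delta> \<epsilon> \<tau> \<Phi> \<Phi>i \<mu>B \<eta>B coact \<tau>BF \<psi> \<Phi>L \<Delta>M \<epsilon>M \<beta> \<T> \<C> F0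
    (stage (pick F0 F0 F0 F0) (pick F0 F0 F0 F0)) (stage (\<lambda>_. R0) (\<lambda>_. R0)) (pick \<Phi>L a b c) i
    (stage (\<lambda>n. \<iota> (cell (pick F0 F0 F0 F0 n))) (\<lambda>n. \<iota> (cell (pick F0 F0 F0 F0 n)))) (stage (\<lambda>_. \<iota> (rcell R0))
        (\<lambda>_. \<iota> (rcell R0)))"
    if "a \<in> elements" "b \<in> elements" "c \<in> elements" for a b c
    using F0_instance[OF that i] .
  \<comment> \<open>In the uses below, the first three membership facts fix the elements numbered 1,
    2, 3; positions that do not matter are filled with \<open>u\<close>.\<close>
  note S = hausser_nill_instance.conv_left_by[OF inst] hausser_nill_instance.left_by_conv[OF inst]
    hausser_nill_instance.left_by_one[OF inst] hausser_nill_instance.left_by_one_right[OF inst]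
    hausser_nill_instance.left_by_inv[OF inst] hausser_nill_instance.left_by_inv_right[OF inst]
    hausser_nill_instance.left_by_unit[OF inst] hausser_nill_instance.conv_hom[OF inst, of _ _ _ 1 2]
  note S = S[unfolded pick_def, simplified]
  show v: "v \<in> elements"
    unfolding v_def using hausser_nill_instance.inv_eta[OF inst[OF u u u]] .
  have cancel: "a = b" if "u \<^bold>* a = u \<^bold>* b" "a \<in> elements" "b \<in> elements" for a b
  proof -
    \<comment> \<open>The Kleisli extension of \<open>i\<close> is a left inverse of left
      convolution by \<open>u\<close>, which makes the latter injective.\<close>
    have "?L i \<bullet> ?L (rho_bar K F B u F0 F0) \<bullet> c = c" if "c \<in> elements" for c
      using S(5)[OF u that u left] S(7)[OF that u u] by simp
    then show ?thesis using that S(1)[OF u _ u] by metis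
  qed
  show uv: "u \<^bold>* v = one"
    using S(1)[OF u v u] S(6)[OF u u u right] by (simp add: v_def one_def)
  have "u \<^bold>* (v \<^bold>* u) = ?L (rho_bar K F B u F0 F0) \<bullet> ?L (rho_bar K F B v F0 F0) \<bullet> u"
    using S(1)[OF v u u] S(1)[OF u S(8)[OF v u u] u] by simp
  also have "\<dots> = u"
    using S(2)[OF u v u] S(3)[OF u u u] uv by (simp add: one_def)
  also have "\<dots> = u \<^bold>* one"
    using S(1)[OF u S(8)[OF u v u] u] S(4)[OF u u u] uv by (simp add: one_def)
  finally show "v \<^bold>* u = one"
    using cancel S(8)[OF v u u] S(8)[OF u v u] uv by simp
qed

text \<open>Invertibility at F already yields an inverse element; conversely, its operators are
  inverse to all \<rho> at once by \<open>rho_conv\<close>.\<close>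

lemma cocycle_invertible_iff:
  "cocycle_invertible K B \<mu>B \<eta>B \<C> (rho_bar K F B \<Phi>L) \<longleftrightarrow> convolution_invertible K \<A> F \<mu> \<eta> \<tau> B \<mu>B \<eta>B \<tau>BF \<Phi>L"
  unfolding convolution_invertible_iff
proof
  assume "cocycle_invertible K B \<mu>B \<eta>B \<C> (rho_bar K F B \<Phi>L)"
  then obtain i where "i \<in> hom2 K (F \<cdot> F) (F \<cdot> F \<cdot> B)"
    "(\<iota> (F \<cdot> F) \<star> \<mu>B) \<bullet> (i \<star> \<iota> B) \<bullet> rho_bar K F B \<Phi>L F0 F0 = \<iota> (F \<cdot> F) \<star> \<eta>B"
    "(\<iota> (F \<cdot> F) \<star> \<mu>B) \<bullet> (rho_bar K F B \<Phi>L F0 F0 \<star> \<iota> B) \<bullet> i = \<iota> (F \<cdot> F) \<star> \<eta>B"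
    using F0 unfolding cocycle_invertible_def by (fastforce simp: F0_eq)
  from rho_inverse_convolution[OF \<Phi>L this]
  show "\<exists>u\<in>elements. \<Phi>L \<^bold>* u = \<eta> \<star> \<eta> \<star> \<eta>B \<and> u \<^bold>* \<Phi>L = \<eta> \<star> \<eta> \<star> \<eta>B" by blast
next
  assume "\<exists>u\<in>elements. \<Phi>L \<^bold>* u = \<eta> \<star> \<eta> \<star> \<eta>B \<and> u \<^bold>* \<Phi>L = \<eta> \<star> \<eta> \<star> \<eta>B"
  then obtain u where u: "u \<in> elements" "\<Phi>L \<^bold>* u = \<eta> \<star> \<eta> \<star> \<eta>B" "u \<^bold>* \<Phi>L = \<eta> \<star> \<eta> \<star> \<eta>B" by blast
  have hom: "rho_bar K F B u X Y \<in> hom2 K (cell X \<cdot> cell Y) (cell X \<cdot> cell Y \<cdot> B)" if "X \<in> \<C>" "Y \<in> \<C>" for X Y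
    using hausser_nill_instance.rho_hom[OF left_instance[OF that F0 u(1) \<Phi>L \<Phi>L FF_etaB], of 1 1 2]
    by (simp add: stage_def pick_def)
  show "cocycle_invertible K B \<mu>B \<eta>B \<C> (rho_bar K F B \<Phi>L)"
    unfolding cocycle_invertible_def
  proof (intro ballI)
    fix X Y assume XY: "X \<in> \<C>" "Y \<in> \<C>"
    show "\<exists>\<rho>i\<in>hom2 K (cell X \<cdot> cell Y) (cell X \<cdot> cell Y \<cdot> B).
       (\<iota> (cell X \<cdot> cell Y) \<star> \<mu>B) \<bullet> (\<rho>i \<star> \<iota> B) \<bullet> rho_bar K F B \<Phi>L X Y = \<iota> (cell X \<cdot> cell Y) \<star> \<eta>B \<and>
       (\<iota> (cell X \<cdot> cell Y) \<star> \<mu>B) \<bullet> (rho_bar K F B \<Phi>L X Y \<star> \<iota> B) \<bullet> \<rho>i = \<iota> (cell X \<cdot> cell Y) \<star> \<eta>B"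
      using hom[OF XY] convolution_inverse_rho[OF u(1) \<Phi>L u(3) XY] convolution_inverse_rho[OF \<Phi>L u(1) u(2) XY]
          by blast
  qed
qed

lemma right_instance:
  assumes "X \<in> Objs \<R>" "Y \<in> Objs \<R>" "Z \<in> Objs \<R>" "W \<in> Objs \<R>"
    "X' \<in> Objs \<R>" "Y' \<in> Objs \<R>" "Z' \<in> Objs \<R>"
    "f \<in> Mors \<R> X X'" "g \<in> Mors \<R> Y Y'" "h \<in> Mors \<R> Z Z'"
  shows "hausser_nill_instance K \<A> F B \<mu> \<eta> \<Delta> \<epsilon> \<tau> \<Phi> \<Phi>i \<mu>B \<eta>B coact \<tau>BF \<psi> \<Phi>L \<Delta>M \<epsilon>M \<beta> \<T> \<C> F0
    (stage (\<lambda>_. F0) (\<lambda>_. F0)) (stage (pick X Y Z W) (pick X' Y' Z' W)) (\<lambda>_. \<Phi>L) (\<iota> (F \<cdot> F) \<star> \<eta>B)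
    (stage (\<lambda>_. \<iota> (cell F0)) (\<lambda>_. \<iota> (cell F0)))
    (stage (pick f g h (\<iota> (rcell W))) (\<lambda>n. \<iota> (rcell (pick X' Y' Z' W n))))"
  using assms by (intro instance_stage F0 identity_tambara_mor \<Phi>L FF_etaB) (auto simp: pick_def identity_right_mor)

lemma three_cocycle_right_action: "three_cocycle K \<R> (right_action \<Phi>i)"
proof -
  have under: "under \<R> = rcell" by (simp add: right_tambara_modules_def)
  show ?thesis
    unfolding three_cocycle_def under
  proof (intro conjI ballI)
    fix X Y Z assume O: "X \<in> Objs \<R>" "Y \<in> Objs \<R>" "Z \<in> Objs \<R>"
    show "right_action \<Phi>i X Y Z \<in> hom2 K (rcell X \<cdot> rcell Y \<cdot> rcell Z) (rcell X \<cdot> rcell Y \<cdot> rcell Z)"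
      using hausser_nill_instance.right_action_hom[OF right_instance[OF O R0 O O[THEN identity_right_mor]]]
      by (simp add: stage_def pick_def)
  next
    fix X X' Y Y' Z Z' f g h
    assume "X \<in> Objs \<R>" "X' \<in> Objs \<R>" "Y \<in> Objs \<R>" "Y' \<in> Objs \<R>" "Z \<in> Objs \<R>" "Z' \<in> Objs \<R>"
      "f \<in> Mors \<R> X X'" "g \<in> Mors \<R> Y Y'" "h \<in> Mors \<R> Z Z'"
    then show "(f \<star> g \<star> h) \<bullet> right_action \<Phi>i X Y Z = right_action \<Phi>i X' Y' Z' \<bullet> (f \<star> g \<star> h)"
      using hausser_nill_instance.right_action_natural[OF right_instance[of X Y Z R0 X' Y' Z' f g h]] R0
      by (simp add: stage_def pick_def)
  next
    fix X Y Z W assume O: "X \<in> Objs \<R>" "Y \<in> Objs \<R>" "Z \<in> Objs \<R>" and W: "W \<in> Objs \<R>"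
    show "(\<iota> (rcell X) \<star> right_action \<Phi>i Y Z W) \<bullet> right_action \<Phi>i X (tens \<R> Y Z) W \<bullet> (right_action \<Phi>i X Y Z \<star>
        \<iota> (rcell W))
        = right_action \<Phi>i X Y (tens \<R> Z W) \<bullet> right_action \<Phi>i (tens \<R> X Y) Z W"
      using hausser_nill_instance.right_action_cocycle[OF right_instance[OF O W O O[THEN identity_right_mor]]]
      by (simp add: stage_def pick_def)
  qed
qed

text \<open>The monad and coaction clauses are part of the comodule monad, the counit clause is
  \<open>datum_counit\<close>, and \<beta> is a component of the 3-cocycle
  \<open>right_action \<Phi>i\<close>. Three clauses about \<open>\<Phi>L\<close> remain.\<close>

lemma hausser_nill_datum_iff:
  "hausser_nill_datum K \<A> \<R> R0 B \<mu>B \<eta>B F \<psi> \<Delta>M \<epsilon>M \<eta> \<beta> \<longleftrightarrow> datum_linear \<and> datum_cocycle \<and> datum_normalized"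
proof -
  note inst = cell_instance[OF F0 F0 F0]
  have "right_action \<Phi>i R0 R0 R0 = \<beta>"
    by (simp add: right_action_def R0_def \<beta>_eq mu_FFF_def)
  then have "\<exists>\<rho>. three_cocycle K \<R> \<rho> \<and> \<rho> R0 R0 R0 = \<beta>" using three_cocycle_right_action by blast
  moreover have "under \<R> R0 = F" by (simp add: right_tambara_modules_def R0_def)
  ultimately show ?thesis
    unfolding hausser_nill_datum_def Let_def coact_eq[symmetric] hausser_nill_instance.datum_element[OF inst]
      datum_linear_def datum_cocycle_def datum_normalized_def
    using cm F_endo R0 hausser_nill_instance.datum_homs[OF inst] hausser_nill_instance.datum_counit[OF inst] qb
    by blast
qed

text \<open>Naturality holds for every \<open>\<Phi>L\<close>. The other four conditions correspond
  one by one to the three remaining clauses of the datum and to convolution invertibility.\<close>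

theorem cocycle_iff_datum:
  "invertible_normalized_2cocycle K \<A> F \<Delta> \<epsilon> \<Phi> B \<mu>B \<eta>B coact \<C> (rho_bar K F B \<Phi>L)
     \<longleftrightarrow> hausser_nill_datum K \<A> \<R> R0 B \<mu>B \<eta>B F \<psi> \<Delta>M \<epsilon>M \<eta> \<beta>
          \<and> convolution_invertible K \<A> F \<mu> \<eta> \<tau> B \<mu>B \<eta>B \<tau>BF \<Phi>L"
  unfolding invertible_normalized_2cocycle_def hausser_nill_datum_iff cocycle_linear_iff cocycle_condition_iff
    cocycle_normalized_iff cocycle_invertible_iff
  using cocycle_natural by blast

end

theorem proposition6p2:
  fixes K :: "('o, 'm, 'c) two_cat" (structure)
    and \<A> :: 'o and F B :: 'm
    and \<mu> \<eta> \<Delta> \<epsilon> \<tau> \<Phi> \<Phi>i \<mu>B \<eta>B coact \<tau>BF \<psi> \<Phi>L \<Delta>M \<epsilon>M \<beta> :: 'c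
    and \<T> \<C> :: "('m, 'c) tambara set" and F0 :: "('m, 'c) tambara"
  assumes "two_category K" and "\<A> \<in> Cells0 K"
    and "quasi_bimonad K \<A> F \<mu> \<eta> \<Delta> \<epsilon> \<tau> \<Phi> \<Phi>i"
    and "comodule_monad K \<A> F \<eta> B \<mu>B \<eta>B \<psi> coact"
    and "\<psi> = (\<mu> \<star> \<iota> B) \<bullet> (\<iota> F \<star> \<tau>BF) \<bullet> (coact \<star> \<iota> F)"
    and counit: "(\<epsilon> \<star> \<iota> B) \<bullet> coact = \<iota> B"
    and "\<Phi> \<star> \<iota> B = (\<iota> (F \<cdot> F) \<star> \<tau>BF) \<bullet> (\<iota> F \<star> \<tau>BF \<star> \<iota> F) \<bullet> (\<tau>BF \<star> \<iota> (F \<cdot> F)) \<bullet> (\<iota> B \<star> \<Phi>)"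
    and "\<Phi>L \<in> hom2 K (Id1 K \<A>) (F \<cdot> F \<cdot> B)"
    and "\<T> = tambara_objects K \<A> F \<mu> \<eta> \<Delta> \<epsilon> \<tau> \<Phi> B \<mu>B \<eta>B coact \<tau>BF"
    and "tensor_closed K \<A> F \<Delta> \<epsilon> B \<T>"
    and "\<C> = {X \<in> \<T>. transports K F B \<Phi>L X}"
    and "F0 = \<lparr>cell = F, tauB = \<tau>BF, tauF = \<tau>, act = \<mu>\<rparr>" and "F0 \<in> \<C>"
    and "\<Delta>M = (\<mu> \<star> \<mu> \<star> \<iota> B) \<bullet> (\<iota> F \<star> \<tau> \<star> \<iota> F \<star> \<iota> B) \<bullet> (\<iota> F \<star> \<iota> F \<star> \<Delta> \<star> \<iota> B)
               \<bullet> (\<iota> F \<star> \<iota> F \<star> \<tau>BF) \<bullet> (\<Phi>L \<star> \<iota> F)"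
    and "\<epsilon>M = \<eta>B \<bullet> \<epsilon>"
    and "\<beta> = mu_FFF K F \<mu> \<tau> \<bullet> (\<iota> F \<star> \<iota> F \<star> \<iota> F \<star> \<Phi>i)"
  shows "invertible_normalized_2cocycle K \<A> F \<Delta> \<epsilon> \<Phi> B \<mu>B \<eta>B coact \<C> (rho_bar K F B \<Phi>L)
     \<longleftrightarrow> hausser_nill_datum K \<A> (right_tambara_modules K \<A> F \<mu> \<eta> \<Delta> \<epsilon> \<tau> \<Phi>)
            \<lparr>rcell = F, rtau = \<tau>, ract = \<mu>\<rparr> B \<mu>B \<eta>B F \<psi> \<Delta>M \<epsilon>M \<eta> \<beta>
          \<and> convolution_invertible K \<A> F \<mu> \<eta> \<tau> B \<mu>B \<eta>B \<tau>BF \<Phi>L"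
proof -
  interpret hausser_nill_setting K \<A> F B \<mu> \<eta> \<Delta> \<epsilon> \<tau> \<Phi> \<Phi>i \<mu>B \<eta>B coact \<tau>BF \<psi> \<Phi>L \<Delta>M \<epsilon>M \<beta> \<T> \<C> F0
    by (intro hausser_nill_setting.intro hausser_nill_setting_axioms.intro assms)
  show ?thesis
    using cocycle_iff_datum by (simp only: R0_def)
qed

end
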